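(* Let $F$ be a field of characteristic zero and $W$ a unital $\mathbb{Z}_2$-graded $F$-algebra. Let $UT_2^D$ be the $\mathbb{Z}_2$-graded $W$-algebra of $2\times2$ upper triangular matrices over $F$ with the canonical grading, where $W$ acts as the algebra $D=Fe_{11}\oplus Fe_{22}$ by left and right multiplication. Let $n\ge1$, $0\le r\le n$, and let $$\chi_{r,n-r}^{\mathbb{Z}_2,W}(UT_2^D)=\sum_{\lambda\vdash r,\ \mu\vdash n-r}m_{\lambda,\mu}(\chi_\lambda\otimes\chi_\mu)$$ be the $(r,n-r)$th generalized graded cocharacter of $UT_2^D$. If $r=n$, then $m_{\lambda,\mu}=2$ for $\lambda=(n)$, $\mu=\emptyset$, and $m_{\lambda,\mu}=0$ otherwise. If $r=n-1$, then $m_{\lambda,\mu}=n$ for $\lambda=(n-1)$, $\mu=(1)$; $m_{\lambda,\mu}=q+1$ for $\lambda=(p+q,p)$, $\mu=(1)$ with $p\ge1$, $q\ge0$, $2p+q=n-1$; and $m_{\lambda,\mu}=0$ otherwise. If $r\le n-2$, then all $m_{\lambda,\mu}=0$.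
   Context: The canonical grading is $UT_2^0=Fe_{11}\oplus Fe_{22}$, $UT_2^1=Fe_{12}$. "$W$ acts as a unital graded subalgebra $B\subseteq UT_2$ by left and right multiplication" means there is a surjective unital graded homomorphism $\varphi:W\to B$ with $wa=\varphi(w)a$, $aw=a\varphi(w)$ (here $B=D$). Let $\{w_i\}$ be a vector space basis of $W$, $y_1,y_2,\dots$ variables of degree $0$ and $z_1,z_2,\dots$ variables of degree $1$. The free $\mathbb{Z}_2$-graded $W$-algebra $W\langle Y,Z\rangle$ has vector space basis the monomials $w_{i_0}u_1w_{i_1}\cdots w_{i_{n-1}}u_nw_{i_n}$, $n\ge1$, each $u_j$ a variable; product is juxtaposition followed by multiplication in $W$, $W$ acts by multiplication at the two ends, and a variable $x$ is identified with $1_Wx1_W$. $\mathrm{Id}^{\mathbb{Z}_2,W}(A)$ is the set of elements vanishing under all substitutions of $y$'s by elements of $A^0$ and $z$'s by elements of $A^1$. $P^{\mathbb{Z}_2,W}_{r,n-r}$ is the space of multilinear elements in $y_1,\dots,y_r,z_1,\dots,z_{n-r}$ (span of monomials in which each of these variables occurs exactly once, with arbitrary basis elements of $W$ in between). $S_r\times S_{n-r}$ acts on it by permuting the $y$'s and the $z$'s respectively, and $\chi^{\mathbb{Z}_2,W}_{r,n-r}(A)$ is the character of $P^{\mathbb{Z}_2,W}_{r,n-r}/(P^{\mathbb{Z}_2,W}_{r,n-r}\cap\mathrm{Id}^{\mathbb{Z}_2,W}(A))$. $\chi_\lambda$, $\chi_\mu$ are the irreducible characters of $S_r$, $S_{n-r}$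 attached to the partitions $\lambda,\mu$, and $\chi_\lambda\otimes\chi_\mu$ is their outer product. *)

theory Defs
  imports
    "HOL-Analysis.Analysis"
    "HOL-Combinatorics.Permutations"
    "HOL-Library.Poly_Mapping"
    "HOL-Library.Z2"
begin

section \<open>Traces on quotients of vector spaces\<close>

text \<open>\<open>B\<close> is a finite set of representatives of a basis of \<open>V / U\<close>.\<close>

definition quotient_basis ::
    "('f::field \<Rightarrow> 'v \<Rightarrow> 'v::ab_group_add) \<Rightarrow> 'v set \<Rightarrow> 'v set \<Rightarrow> 'v set \<Rightarrow> bool" where
  "quotient_basis sc V U B \<longleftrightarrow> finite B \<and> B \<subseteq> V
     \<and> (\<forall>v\<in>V. \<exists>c. v - (\<Sum>b\<in>B. sc (c b) b) \<in> U)
     \<and> (\<forall>c. (\<Sum>b\<in>B. sc (c b) b) \<in> U \<longrightarrow> (\<forall>b\<in>B. c b = 0))"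

definition quotient_coord ::
    "('f::field \<Rightarrow> 'v \<Rightarrow> 'v::ab_group_add) \<Rightarrow> 'v set \<Rightarrow> 'v set \<Rightarrow> 'v \<Rightarrow> 'v \<Rightarrow> 'f" where
  "quotient_coord sc U B v = (SOME c. v - (\<Sum>b\<in>B. sc (c b) b) \<in> U)"

text \<open>
  The trace of the endomorphism of \<open>V / U\<close> induced by a linear map \<open>f\<close> that maps the subspaces
  \<open>U \<subseteq> V\<close> into themselves. It does not depend on the chosen basis. The value is meaningful only
  if \<open>V / U\<close> is finite-dimensional; \<open>V\<close> itself may have infinite dimension.
\<close>

definition quotient_trace ::
    "('f::field \<Rightarrow> 'v \<Rightarrow> 'v::ab_group_add) \<Rightarrow> 'v set \<Rightarrow> 'v set \<Rightarrow> ('v \<Rightarrow> 'v) \<Rightarrow> 'f" where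
  "quotient_trace sc V U f =
     (let B = (SOME B. quotient_basis sc V U B)
      in \<Sum>b\<in>B. quotient_coord sc U B (f b) b)"


section \<open>Formal linear combinations\<close>

definition pm_scale :: "'f::field \<Rightarrow> ('x \<Rightarrow>\<^sub>0 'f) \<Rightarrow> ('x \<Rightarrow>\<^sub>0 'f)" where
  "pm_scale c p = Poly_Mapping.map ((*) c) p"

lemma lookup_pm_scale [simp]: "Poly_Mapping.lookup (pm_scale c p) x = c * Poly_Mapping.lookup p x"
  by (simp add: pm_scale_def Poly_Mapping.map.rep_eq when_def)

global_interpretation pm: vector_space "pm_scale :: 'f::field \<Rightarrow> ('x \<Rightarrow>\<^sub>0 'f) \<Rightarrow> ('x \<Rightarrow>\<^sub>0 'f)"
  by unfold_locales (auto intro!: poly_mapping_eqI simp: Poly_Mapping.lookup_add algebra_simps)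

definition linear_extension ::
    "('f::field \<Rightarrow> 'v \<Rightarrow> 'v::ab_group_add) \<Rightarrow> ('x \<Rightarrow> 'v) \<Rightarrow> ('x \<Rightarrow>\<^sub>0 'f) \<Rightarrow> 'v" where
  "linear_extension sc f p = (\<Sum>x\<in>Poly_Mapping.keys p. sc (Poly_Mapping.lookup p x) (f x))"

definition map_basis :: "('x \<Rightarrow> 'y) \<Rightarrow> ('x \<Rightarrow>\<^sub>0 'f::field) \<Rightarrow> ('y \<Rightarrow>\<^sub>0 'f)" where
  "map_basis g = linear_extension pm_scale (\<lambda>x. Poly_Mapping.single (g x) 1)"


section \<open>Partitions and the irreducible characters of the symmetric groups\<close>

text \<open>A partition is the weakly decreasing list of its (nonzero) parts.\<close>

definition is_partition :: "nat list \<Rightarrow> nat \<Rightarrow> bool" (infix "\<turnstile>\<^sub>p" 50) where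
  "lam \<turnstile>\<^sub>p n \<longleftrightarrow> sorted_wrt (\<ge>) lam \<and> 0 \<notin> set lam \<and> sum_list lam = n"

text \<open>The partition usually written \<open>(k)\<close>, which is the empty one for \<open>k = 0\<close>.\<close>

definition one_row :: "nat \<Rightarrow> nat list" where
  "one_row k = (if k = 0 then [] else [k])"

definition boxes :: "nat list \<Rightarrow> (nat \<times> nat) set" where
  "boxes lam = {(i, j). i < length lam \<and> j < lam ! i}"

definition tableaux :: "nat list \<Rightarrow> (nat \<times> nat \<Rightarrow> nat) set" where
  "tableaux lam = {t. bij_betw t (boxes lam) {1..sum_list lam}}"

text \<open>The tabloid of a tableau is the list of the sets of entries of its rows.\<close>

definition tabloid :: "nat list \<Rightarrow> (nat \<times> nat \<Rightarrow> nat) \<Rightarrow> nat set list" where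
  "tabloid lam t = map (\<lambda>i. (\<lambda>j. t (i, j)) ` {..<lam ! i}) [0..<length lam]"

definition column_stabilizer :: "nat list \<Rightarrow> (nat \<times> nat \<Rightarrow> nat) \<Rightarrow> (nat \<Rightarrow> nat) set" where
  "column_stabilizer lam t =
     {\<pi>. \<pi> permutes {1..sum_list lam} \<and>
          (\<forall>(i, j)\<in>boxes lam. \<exists>i'. (i', j) \<in> boxes lam \<and> \<pi> (t (i, j)) = t (i', j))}"

definition polytabloid :: "nat list \<Rightarrow> (nat \<times> nat \<Rightarrow> nat) \<Rightarrow> (nat set list \<Rightarrow>\<^sub>0 'f::field)" where
  "polytabloid lam t =
     (\<Sum>\<pi>\<in>column_stabilizer lam t. Poly_Mapping.single (tabloid lam (\<pi> \<circ> t)) (of_int (sign \<pi>)))"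

definition specht_module :: "nat list \<Rightarrow> (nat set list \<Rightarrow>\<^sub>0 'f::field) set" where
  "specht_module lam = pm.span (polytabloid lam ` tableaux lam)"

text \<open>
  In characteristic zero the Specht modules form a complete system of irreducible modules of the
  symmetric group, and \<open>\<chi>\<^sub>\<lambda>\<close> is the character of the Specht module of \<open>\<lambda>\<close>. A permutation
  acts on a tabloid by acting on the entries.
\<close>

definition irr_char :: "nat list \<Rightarrow> (nat \<Rightarrow> nat) \<Rightarrow> 'f::field" where
  "irr_char lam \<sigma> = quotient_trace pm_scale (specht_module lam) {0} (map_basis (map ((`) \<sigma>)))"


section \<open>Graded algebras and graded algebras with a \<open>W\<close>-action\<close>

text \<open>The two-element field \<^typ>\<open>bit\<close> serves as the grading group.\<close>

locale Z2_graded_algebra = vector_space sc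
  for sc :: "'f::field \<Rightarrow> 'w::ring_1 \<Rightarrow> 'w" +
  fixes W :: "bit \<Rightarrow> 'w set"
  assumes scale_mult_left: "sc c (a * b) = sc c a * b"
    and scale_mult_right: "sc c (a * b) = a * sc c b"
    and subspace_component: "subspace (W i)"
    and direct_sum: "\<exists>!p. p \<in> W 0 \<times> W 1 \<and> w = fst p + snd p"
    and component_mult: "a \<in> W i \<Longrightarrow> b \<in> W j \<Longrightarrow> a * b \<in> W (i + j)"

text \<open>The underlying set of the algebra is the direct sum of its two components.\<close>

record ('f, 'w, 'a) graded_W_algebra =
  smult :: "'f \<Rightarrow> 'a \<Rightarrow> 'a"
  amult :: "'a \<Rightarrow> 'a \<Rightarrow> 'a"
  left_act :: "'w \<Rightarrow> 'a \<Rightarrow> 'a"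
  right_act :: "'a \<Rightarrow> 'w \<Rightarrow> 'a"
  component :: "bit \<Rightarrow> 'a set"

definition matrix_scale :: "'f::field \<Rightarrow> 'f^2^2 \<Rightarrow> 'f^2^2" where
  "matrix_scale c = map_matrix ((*) c)"

definition matrix_unit :: "2 \<Rightarrow> 2 \<Rightarrow> 'f::field^2^2" where
  "matrix_unit i j = axis i (axis j 1)"

definition UT2_component :: "bit \<Rightarrow> ('f::field^2^2) set" where
  "UT2_component d =
     (if d = 0
      then {matrix_scale a (matrix_unit 1 1) + matrix_scale b (matrix_unit 2 2) | a b. True}
      else {matrix_scale c (matrix_unit 1 2) | c. True})"

definition diagonal_algebra :: "('f::field^2^2) set" where
  "diagonal_algebra =
     {matrix_scale a (matrix_unit 1 1) + matrix_scale b (matrix_unit 2 2) | a b. True}"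

definition graded_hom_onto_D ::
    "('f::field \<Rightarrow> 'w::ring_1 \<Rightarrow> 'w) \<Rightarrow> (bit \<Rightarrow> 'w set) \<Rightarrow> ('w \<Rightarrow> 'f^2^2) \<Rightarrow> bool" where
  "graded_hom_onto_D sc W \<phi> \<longleftrightarrow>
     Vector_Spaces.linear sc matrix_scale \<phi>
     \<and> \<phi> 1 = mat 1 \<and> (\<forall>a b. \<phi> (a * b) = \<phi> a ** \<phi> b)
     \<and> range \<phi> = diagonal_algebra
     \<and> (\<forall>d. \<phi> ` W d \<subseteq> diagonal_algebra \<inter> UT2_component d)"

definition UT2_D :: "('w \<Rightarrow> 'f::field^2^2) \<Rightarrow> ('f, 'w, 'f^2^2) graded_W_algebra" where
  "UT2_D \<phi> = \<lparr> smult = matrix_scale, amult = (**),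
     left_act = (\<lambda>w a. \<phi> w ** a), right_act = (\<lambda>a w. a ** \<phi> w),
     component = UT2_component \<rparr>"


section \<open>The free graded \<open>W\<close>-algebra and generalized graded identities\<close>

datatype gvar = Y nat | Z nat

text \<open>
  The pair \<open>(w\<^sub>0, [(u\<^sub>1, w\<^sub>1), \<dots>, (u\<^sub>n, w\<^sub>n)])\<close> encodes the monomial \<open>w\<^sub>0 u\<^sub>1 w\<^sub>1 \<dots> u\<^sub>n w\<^sub>n\<close>; the basis
  of \<open>W\<close> is the set \<open>B\<close>.
\<close>

type_synonym 'w gmonomial = "'w \<times> (gvar \<times> 'w) list"

definition gmonomials :: "'w set \<Rightarrow> 'w gmonomial set" where
  "gmonomials B = {(w0, us). w0 \<in> B \<and> snd ` set us \<subseteq> B \<and> us \<noteq> []}"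

definition free_W_algebra :: "'w set \<Rightarrow> ('w gmonomial \<Rightarrow>\<^sub>0 'f::field) set" where
  "free_W_algebra B = pm.span ((\<lambda>m. Poly_Mapping.single m 1) ` gmonomials B)"

text \<open>
  Value of \<open>u\<^sub>1 w\<^sub>1 \<dots> u\<^sub>n w\<^sub>n\<close> under the substitution \<open>s\<close>. The empty word does not occur
  in the free algebra, which has no unit.
\<close>

fun eval_word ::
    "('f, 'w, 'a::ab_group_add) graded_W_algebra \<Rightarrow> (gvar \<Rightarrow> 'a) \<Rightarrow> (gvar \<times> 'w) list \<Rightarrow> 'a" where
  "eval_word A s [] = undefined"
| "eval_word A s [(u, w)] = right_act A (s u) w"
| "eval_word A s ((u, w) # x # xs) = amult A (right_act A (s u) w) (eval_word A s (x # xs))"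

definition eval_monomial ::
    "('f, 'w, 'a::ab_group_add) graded_W_algebra \<Rightarrow> (gvar \<Rightarrow> 'a) \<Rightarrow> 'w gmonomial \<Rightarrow> 'a" where
  "eval_monomial A s m = left_act A (fst m) (eval_word A s (snd m))"

definition substitute ::
    "('f::field, 'w, 'a::ab_group_add) graded_W_algebra \<Rightarrow> (gvar \<Rightarrow> 'a)
       \<Rightarrow> ('w gmonomial \<Rightarrow>\<^sub>0 'f) \<Rightarrow> 'a" where
  "substitute A s = linear_extension (smult A) (eval_monomial A s)"

definition graded_W_identities ::
    "'w set \<Rightarrow> ('f::field, 'w, 'a::ab_group_add) graded_W_algebra \<Rightarrow> ('w gmonomial \<Rightarrow>\<^sub>0 'f) set" where
  "graded_W_identities B A =
     {p \<in> free_W_algebra B.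
        \<forall>s. (\<forall>i. s (Y i) \<in> component A 0 \<and> s (Z i) \<in> component A 1) \<longrightarrow> substitute A s p = 0}"

definition multilinear_monomials :: "'w set \<Rightarrow> nat \<Rightarrow> nat \<Rightarrow> 'w gmonomial set" where
  "multilinear_monomials B r k =
     {(w0, us) \<in> gmonomials B. distinct (map fst us) \<and> set (map fst us) = Y ` {1..r} \<union> Z ` {1..k}}"

definition multilinear_space :: "'w set \<Rightarrow> nat \<Rightarrow> nat \<Rightarrow> ('w gmonomial \<Rightarrow>\<^sub>0 'f::field) set" where
  "multilinear_space B r k = pm.span ((\<lambda>m. Poly_Mapping.single m 1) ` multilinear_monomials B r k)"

fun permute_var :: "(nat \<Rightarrow> nat) \<Rightarrow> (nat \<Rightarrow> nat) \<Rightarrow> gvar \<Rightarrow> gvar" where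
  "permute_var \<sigma> \<tau> (Y i) = Y (\<sigma> i)"
| "permute_var \<sigma> \<tau> (Z i) = Z (\<tau> i)"

definition permute_monomial :: "(nat \<Rightarrow> nat) \<Rightarrow> (nat \<Rightarrow> nat) \<Rightarrow> 'w gmonomial \<Rightarrow> 'w gmonomial" where
  "permute_monomial \<sigma> \<tau> = map_prod id (map (map_prod (permute_var \<sigma> \<tau>) id))"

definition graded_cocharacter ::
    "'w set \<Rightarrow> ('f::field, 'w, 'a::ab_group_add) graded_W_algebra
       \<Rightarrow> nat \<Rightarrow> nat \<Rightarrow> (nat \<Rightarrow> nat) \<Rightarrow> (nat \<Rightarrow> nat) \<Rightarrow> 'f" where
  "graded_cocharacter B A r k \<sigma> \<tau> =
     quotient_trace pm_scale (multilinear_space B r k)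
       (multilinear_space B r k \<inter> graded_W_identities B A)
       (map_basis (permute_monomial \<sigma> \<tau>))"

text \<open>
  \<open>m\<close> is a family of multiplicities in the decomposition of the function \<open>ch\<close> on
  \<open>S\<^sub>r \<times> S\<^sub>k\<close> into the irreducible characters \<open>\<chi>\<^sub>\<lambda> \<otimes> \<chi>\<^sub>\<mu>\<close>.
\<close>

definition multiplicities ::
    "nat \<Rightarrow> nat \<Rightarrow> ((nat \<Rightarrow> nat) \<Rightarrow> (nat \<Rightarrow> nat) \<Rightarrow> 'f::field) \<Rightarrow> (nat list \<Rightarrow> nat list \<Rightarrow> nat) \<Rightarrow> bool" where
  "multiplicities r k ch m \<longleftrightarrow>
     (\<forall>\<sigma> \<tau>. \<sigma> permutes {1..r} \<and> \<tau> permutes {1..k} \<longrightarrow>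
        ch \<sigma> \<tau> = (\<Sum>lam | lam \<turnstile>\<^sub>p r. \<Sum>mu | mu \<turnstile>\<^sub>p k.
                   of_nat (m lam mu) * (irr_char lam \<sigma> * irr_char mu \<tau>)))"

lemma finite_partitions: "finite {lam. lam \<turnstile>\<^sub>p n}"
proof (rule finite_subset)
  have len: "length xs \<le> sum_list xs" if "0 \<notin> set xs" for xs :: "nat list"
    using that by (induction xs) auto
  show "{lam. lam \<turnstile>\<^sub>p n} \<subseteq> {xs. set xs \<subseteq> {..n} \<and> length xs \<le> n}"
    using len by (auto simp: is_partition_def intro: member_le_sum_list)
  show "finite {xs. set xs \<subseteq> {..n} \<and> length xs \<le> n}"
    by (rule finite_lists_length_le) simp
qed

end

theory Submission
  imports Defs
begin

text \<open>
  The theorem has an algebraic half, which finds the modules behind the cocharacters, and a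
  half about symmetric groups, which decomposes them.

  A multilinear monomial with two variables of degree one vanishes on upper triangular matrices,
  because \<open>e\<^sub>1\<^sub>2 D e\<^sub>1\<^sub>2 = 0\<close>; so everything is zero for \<open>r \<le> n - 2\<close>. If all variables have
  degree zero, then all values are diagonal and the order of the variables is irrelevant: what
  remains of a monomial are the two scalars that its coefficients in \<open>W\<close> contribute to the
  diagonal. Hence \<open>P / (P \<inter> Id)\<close> is a plane with the trivial action (\<open>cocharacter_no_z\<close>). If exactly one
  variable \<open>z\<close> has degree one, then the \<open>y\<close>'s to the left of \<open>z\<close> contribute their upper left entries
  \<open>\<alpha>\<close> and those to the right their lower right entries \<open>\<beta>\<close>, so a monomial is determined modulo
  identities, up to a scalar, by the set \<open>S\<close> of the \<open>y\<close>'s before \<open>z\<close>. The functions \<open>\<Prod>\<^sub>i\<^sub>\<in>\<^sub>S \<alpha>\<^sub>i \<Prod>\<^sub>i\<^sub>\<notin>\<^sub>S \<beta>\<^sub>i\<close> are linearly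
  independent, and the quotient is the permutation module on all subsets of \<open>{1..N}\<close>, where
  \<open>N = n - 1\<close> (\<open>cocharacter_one_z\<close>).

  The \<open>k\<close>-subsets span a module \<open>M\<^sub>k\<close>, and \<open>M\<^sub>N\<^sub>-\<^sub>k\<close> has the same character by passing to complements. For
  \<open>1 \<le> k\<close> and \<open>2 k \<le> N\<close> the map \<open>down\<close>, which sends a set to the sum of the sets with one element
  less, maps \<open>M\<^sub>k\<close> onto \<open>M\<^sub>k\<^sub>-\<^sub>1\<close>, and its kernel is the Specht module of \<open>(N - k, k)\<close>; so the characters of
  \<open>M\<^sub>k\<close> and \<open>M\<^sub>k\<^sub>-\<^sub>1\<close> differ by \<open>\<chi>\<close> of \<open>(N - k, k)\<close> (\<open>fixed_subsets_step\<close>). Surjectivity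
  comes from the commutation rule of \<open>down\<close> with the opposite map \<open>up\<close>. The kernel is no larger than
  the Specht module because it is spanned by products of differences of variables
  (\<open>kernel_down_pair_products\<close>), which are polytabloids (\<open>pair_product_in_image\<close>).
  So \<open>\<chi>\<close> of \<open>(N - j, j)\<close> occurs in \<open>M\<^sub>k\<close> once if \<open>j \<le> k \<le> N - j\<close> and otherwise not at all, which is
  \<open>N - 2 j + 1\<close> times in total.

  The multiplicities are determined by the cocharacter because the irreducible characters are
  linearly independent (\<open>irr_chars_independent\<close>). Instead of orthogonality, the proof evaluates
  class functions by the signed sum over the column stabilizer of a tableau of shape \<open>\<mu>\<close>. This
  functional takes a nonzero value at \<open>\<chi>\<^sub>\<mu>\<close> and vanishes at all other \<open>\<chi>\<^sub>\<lambda>\<close> for which \<open>\<lambda>\<close> has no larger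
  weight \<open>\<Sum>\<^sub>i i \<lambda>\<^sub>i\<close> than \<open>\<mu>\<close>, so the system is triangular.
\<close>

section \<open>Traces on quotient spaces\<close>

abbreviation "keys \<equiv> Poly_Mapping.keys"
abbreviation "lookup \<equiv> Poly_Mapping.lookup"

context vector_space
begin

lemma quotient_basisD:
  assumes "quotient_basis scale V U B"
  shows "finite B" "B \<subseteq> V" "(\<Sum>b\<in>B. scale (c b) b) \<in> U \<Longrightarrow> b \<in> B \<Longrightarrow> c b = 0"
    "v \<in> V \<Longrightarrow> \<exists>c. v - (\<Sum>b\<in>B. scale (c b) b) \<in> U"
proof -
  have *: "finite B" "B \<subseteq> V" "\<forall>v\<in>V. \<exists>c. v - (\<Sum>b\<in>B. scale (c b) b) \<in> U"
    "\<forall>c. (\<Sum>b\<in>B. scale (c b) b) \<in> U \<longrightarrow> (\<forall>b\<in>B. c b = 0)"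
    using assms unfolding quotient_basis_def by simp_all
  show "finite B" "B \<subseteq> V" by fact+
  show "c b = 0" if "(\<Sum>b\<in>B. scale (c b) b) \<in> U" "b \<in> B"
    using *(4)[rule_format, OF that] .
  show "\<exists>c. v - (\<Sum>b\<in>B. scale (c b) b) \<in> U" if "v \<in> V"
    using *(3)[rule_format, OF that] .
qed

lemma quotient_coord:
  assumes "quotient_basis scale V U B" "v \<in> V"
  shows "v - (\<Sum>b\<in>B. scale (quotient_coord scale U B v b) b) \<in> U"
proof -
  have "\<exists>c. v - (\<Sum>b\<in>B. scale (c b) b) \<in> U"
    using assms by (auto simp: quotient_basis_def)
  then show ?thesis
    unfolding quotient_coord_def by (rule someI_ex)
qed

lemma quotient_coord_unique:
  assumes "quotient_basis scale V U B" "subspace U"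
    and "v - (\<Sum>b\<in>B. scale (c b) b) \<in> U" "v - (\<Sum>b\<in>B. scale (c' b) b) \<in> U" "b \<in> B"
  shows "c b = c' b"
proof -
  have "(v - (\<Sum>b\<in>B. scale (c' b) b)) - (v - (\<Sum>b\<in>B. scale (c b) b)) \<in> U"
    using subspace_diff[OF assms(2,4,3)] .
  moreover have "(v - (\<Sum>b\<in>B. scale (c' b) b)) - (v - (\<Sum>b\<in>B. scale (c b) b))
      = (\<Sum>b\<in>B. scale (c b - c' b) b)"
    by (simp add: scale_left_diff_distrib sum_subtractf)
  ultimately have "c b - c' b = 0"
    using quotient_basisD(3)[OF assms(1) _ assms(5), of "\<lambda>b. c b - c' b"] by simp
  then show ?thesis by simp
qed

lemma quotient_coord_eqI:
  assumes "quotient_basis scale V U B" "subspace U"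
    and "v - (\<Sum>b\<in>B. scale (c b) b) \<in> U" "b \<in> B"
  shows "quotient_coord scale U B v b = c b"
proof -
  have "v - (\<Sum>b\<in>B. scale (quotient_coord scale U B v b) b) \<in> U"
    unfolding quotient_coord_def by (rule someI_ex[of "\<lambda>c. v - (\<Sum>b\<in>B. scale (c b) b) \<in> U"]) (use assms(3) in blast)
  from quotient_coord_unique[OF assms(1,2) this assms(3,4)] show ?thesis .
qed

lemma quotient_coord_cong:
  assumes B: "quotient_basis scale V U B" "subspace U" and v: "v \<in> V" "v - v' \<in> U" "b \<in> B"
  shows "quotient_coord scale U B v' b = quotient_coord scale U B v b"
proof (rule quotient_coord_eqI[OF B _ v(3)])
  have "(v - (\<Sum>b\<in>B. scale (quotient_coord scale U B v b) b)) - (v - v') \<in> U"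
    by (intro subspace_diff B v quotient_coord[OF B(1)])
  then show "v' - (\<Sum>b\<in>B. scale (quotient_coord scale U B v b) b) \<in> U"
    by (simp add: algebra_simps)
qed

lemma quotient_coord_sum:
  assumes B: "quotient_basis scale V U B" "subspace U" and I: "finite I" "\<And>i. i \<in> I \<Longrightarrow> v i \<in> V" "b \<in> B"
  shows "quotient_coord scale U B (\<Sum>i\<in>I. scale (c i) (v i)) b
     = (\<Sum>i\<in>I. c i * quotient_coord scale U B (v i) b)"
proof (rule quotient_coord_eqI[OF B _ I(3)])
  have "(\<Sum>b\<in>B. scale (\<Sum>i\<in>I. c i * quotient_coord scale U B (v i) b) b)
      = (\<Sum>i\<in>I. scale (c i) (\<Sum>b\<in>B. scale (quotient_coord scale U B (v i) b) b))"
    by (simp add: scale_sum_left scale_sum_right) (rule sum.swap)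
  then have "(\<Sum>i\<in>I. scale (c i) (v i)) - (\<Sum>b\<in>B. scale (\<Sum>i\<in>I. c i * quotient_coord scale U B (v i) b) b)
      = (\<Sum>i\<in>I. scale (c i) (v i - (\<Sum>b\<in>B. scale (quotient_coord scale U B (v i) b) b)))"
    by (simp add: sum_subtractf scale_right_diff_distrib)
  also have "\<dots> \<in> U"
    by (intro subspace_sum B subspace_scale quotient_coord[OF B(1)] I)
  finally show "(\<Sum>i\<in>I. scale (c i) (v i)) - (\<Sum>b\<in>B. scale (\<Sum>i\<in>I. c i * quotient_coord scale U B (v i) b) b) \<in> U" .
qed

text \<open>
  The trace is defined by an arbitrarily chosen basis. Expanding the elements of that basis in
  terms of \<open>B\<close>, and the images of the elements of \<open>B\<close> in terms of it, turns one trace into the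
  other after an interchange of sums; no change of basis has to be inverted.
\<close>

lemma quotient_trace_of_basis:
  assumes B: "quotient_basis scale V U B" and U: "subspace U" and V: "subspace V"
    and f: "Vector_Spaces.linear scale scale f" "f ` V \<subseteq> V" "f ` U \<subseteq> U"
  shows "quotient_trace scale V U f = (\<Sum>b\<in>B. quotient_coord scale U B (f b) b)"
proof -
  interpret f: Vector_Spaces.linear scale scale f by fact
  define B' where "B' = (SOME B. quotient_basis scale V U B)"
  have B': "quotient_basis scale V U B'"
    unfolding B'_def using B by (rule someI)
  have fin: "finite B" "finite B'" and sub: "B \<subseteq> V" "B' \<subseteq> V"
    by (rule quotient_basisD[OF B] quotient_basisD[OF B'])+
  let ?c = "quotient_coord scale U B" and ?c' = "quotient_coord scale U B'"
  have 1: "?c' (f b') b' = (\<Sum>b\<in>B. ?c b' b * ?c' (f b) b')" if "b' \<in> B'" for b'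
  proof -
    have "f (b' - (\<Sum>b\<in>B. scale (?c b' b) b)) \<in> U"
      using quotient_coord[OF B, of b'] that sub f(3) by blast
    then have "f b' - (\<Sum>b\<in>B. scale (?c b' b) (f b)) \<in> U"
      by (simp add: f.diff f.sum f.scale)
    then have "?c' (f b') b' = ?c' (\<Sum>b\<in>B. scale (?c b' b) (f b)) b'"
      using that sub f(2) by (intro quotient_coord_cong[OF B' U, symmetric]) auto
    also have "\<dots> = (\<Sum>b\<in>B. ?c b' b * ?c' (f b) b')"
      using that sub f(2) fin by (intro quotient_coord_sum[OF B' U]) auto
    finally show ?thesis .
  qed
  have 2: "?c (f b) b = (\<Sum>b'\<in>B'. ?c' (f b) b' * ?c b' b)" if "b \<in> B" for b
  proof -
    have fb: "f b \<in> V" using that sub f(2) by auto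
    have "?c (\<Sum>b'\<in>B'. scale (?c' (f b) b') b') b = ?c (f b) b"
      by (rule quotient_coord_cong[OF B U fb quotient_coord[OF B' fb] that])
    then show ?thesis
      using quotient_coord_sum[OF B U fin(2), of "\<lambda>b'. b'" b "?c' (f b)"] that sub by auto
  qed
  have "quotient_trace scale V U f = (\<Sum>b'\<in>B'. ?c' (f b') b')"
    by (simp add: quotient_trace_def B'_def Let_def)
  also have "\<dots> = (\<Sum>b'\<in>B'. \<Sum>b\<in>B. ?c b' b * ?c' (f b) b')"
    by (simp add: 1)
  also have "\<dots> = (\<Sum>b\<in>B. \<Sum>b'\<in>B'. ?c' (f b) b' * ?c b' b)"
    by (subst sum.swap) (simp add: mult.commute)
  also have "\<dots> = (\<Sum>b\<in>B. ?c (f b) b)"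
    by (simp add: 2)
  finally show ?thesis .
qed

lemma quotient_trace_matrix:
  assumes B: "quotient_basis scale V U B" and U: "subspace U" and V: "subspace V"
    and f: "Vector_Spaces.linear scale scale f" "f ` V \<subseteq> V" "f ` U \<subseteq> U"
    and C: "\<And>b. b \<in> B \<Longrightarrow> f b - (\<Sum>b'\<in>B. scale (C b b') b') \<in> U"
  shows "quotient_trace scale V U f = (\<Sum>b\<in>B. C b b)"
  unfolding quotient_trace_of_basis[OF assms(1-6)]
  by (intro sum.cong refl quotient_coord_eqI[OF B U] C)

lemma quotient_trace_sum:
  assumes B: "quotient_basis scale V U B" and U: "subspace U" and V: "subspace V" and I: "finite I"
    and f: "\<And>i. i \<in> I \<Longrightarrow> Vector_Spaces.linear scale scale (f i)" 
      "\<And>i. i \<in> I \<Longrightarrow> f i ` V \<subseteq> V" "\<And>i. i \<in> I \<Longrightarrow> f i ` U \<subseteq> U"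
  shows "quotient_trace scale V U (\<lambda>v. \<Sum>i\<in>I. scale (c i) (f i v))
    = (\<Sum>i\<in>I. c i * quotient_trace scale V U (f i))"
proof -
  have lin: "Vector_Spaces.linear scale scale (\<lambda>v. \<Sum>i\<in>I. scale (c i) (f i v))"
  proof -
    interpret vector_space_pair scale scale ..
    show ?thesis
      using f(1) by (intro linear_compose_sum ballI linear_compose_scale_right) auto
  qed
  have BV: "B \<subseteq> V" using B by (simp add: quotient_basis_def)
  have "quotient_trace scale V U (\<lambda>v. \<Sum>i\<in>I. scale (c i) (f i v))
     = (\<Sum>b\<in>B. quotient_coord scale U B (\<Sum>i\<in>I. scale (c i) (f i b)) b)"
    using f(2,3) by (intro quotient_trace_of_basis[OF B U V lin])
      (auto intro!: subspace_sum subspace_scale U V dest: subsetD[OF f(2)] subsetD[OF f(3)])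
  also have "\<dots> = (\<Sum>b\<in>B. \<Sum>i\<in>I. c i * quotient_coord scale U B (f i b) b)"
    using f(2) BV by (intro sum.cong refl quotient_coord_sum[OF B U I]) auto
  also have "\<dots> = (\<Sum>i\<in>I. c i * (\<Sum>b\<in>B. quotient_coord scale U B (f i b) b))"
    by (subst sum.swap) (simp add: sum_distrib_left)
  also have "\<dots> = (\<Sum>i\<in>I. c i * quotient_trace scale V U (f i))"
    by (intro sum.cong refl) (simp add: quotient_trace_of_basis[OF B U V f])
  finally show ?thesis .
qed

text \<open>
  A basis of \<open>V / S\<close> and one of \<open>S / U\<close> together form a basis of \<open>V / U\<close>, with respect to which \<open>f\<close> is
  block triangular.
\<close>

lemma quotient_trace_add:
  assumes B1: "quotient_basis scale V S B1" and B2: "quotient_basis scale S U B2"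
    and sub: "subspace U" "subspace S" "subspace V" "U \<subseteq> S" "S \<subseteq> V"
    and f: "Vector_Spaces.linear scale scale f" "f ` V \<subseteq> V" "f ` S \<subseteq> S" "f ` U \<subseteq> U"
  shows "quotient_trace scale V U f = quotient_trace scale V S f + quotient_trace scale S U f"
proof -
  have fin: "finite B1" "finite B2" and BV: "B1 \<subseteq> V" "B2 \<subseteq> S"
    by (rule quotient_basisD[OF B1] quotient_basisD[OF B2])+
  have sumS: "(\<Sum>b\<in>B2. scale (c b) b) \<in> S" for c
    using BV by (intro subspace_sum sub subspace_scale) auto
  have disj: "B1 \<inter> B2 = {}"
  proof -
    have False if "b \<in> B1" "b \<in> S" for b
    proof -
      have "(\<Sum>b'\<in>B1. scale (if b' = b then 1 else 0) b') = b"
        using fin that by (simp add: if_distrib[of "\<lambda>c. scale c _"] cong: if_cong)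
      then show False
        using quotient_basisD(3)[OF B1, of "\<lambda>b'. if b' = b then 1 else 0" b] that by simp
    qed
    then show ?thesis using BV by auto
  qed
  have B: "quotient_basis scale V U (B1 \<union> B2)"
    unfolding quotient_basis_def
  proof (intro conjI ballI allI impI)
    fix v assume v: "v \<in> V"
    let ?v = "v - (\<Sum>b\<in>B1. scale (quotient_coord scale S B1 v b) b)"
    have 1: "?v \<in> S" by (rule quotient_coord[OF B1 v])
    have "?v - (\<Sum>b\<in>B2. scale (quotient_coord scale U B2 ?v b) b) \<in> U"
      by (rule quotient_coord[OF B2 1])
    moreover have "(\<Sum>b\<in>B1 \<union> B2. scale (if b \<in> B1 then quotient_coord scale S B1 v b
         else quotient_coord scale U B2 ?v b) b)
       = (\<Sum>b\<in>B1. scale (quotient_coord scale S B1 v b) b)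
         + (\<Sum>b\<in>B2. scale (quotient_coord scale U B2 ?v b) b)"
      using disj by (subst sum.union_disjoint[OF fin disj]) 
        (intro arg_cong2[of _ _ _ _ "(+)"] sum.cong; auto)
    ultimately have "v - (\<Sum>b\<in>B1 \<union> B2. scale (if b \<in> B1 then quotient_coord scale S B1 v b
         else quotient_coord scale U B2 ?v b) b) \<in> U"
      by (simp only: diff_diff_eq)
    then show "\<exists>c. v - (\<Sum>b\<in>B1 \<union> B2. scale (c b) b) \<in> U"
      by (rule exI[of "\<lambda>c. v - (\<Sum>b\<in>B1 \<union> B2. scale (c b) b) \<in> U"])
  next
    fix c b assume c: "(\<Sum>b\<in>B1 \<union> B2. scale (c b) b) \<in> U" and b: "b \<in> B1 \<union> B2"
    have eq: "(\<Sum>b\<in>B1 \<union> B2. scale (c b) b) = (\<Sum>b\<in>B1. scale (c b) b) + (\<Sum>b\<in>B2. scale (c b) b)"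
      by (rule sum.union_disjoint[OF fin disj])
    then have "(\<Sum>b\<in>B1. scale (c b) b) = (\<Sum>b\<in>B1 \<union> B2. scale (c b) b) - (\<Sum>b\<in>B2. scale (c b) b)"
      by simp
    also have "\<dots> \<in> S" using c sub sumS by (intro subspace_diff) auto
    finally have 0: "\<forall>b\<in>B1. c b = 0" using quotient_basisD(3)[OF B1] by blast
    then have "(\<Sum>b\<in>B2. scale (c b) b) \<in> U" using c eq by simp
    then have "\<forall>b\<in>B2. c b = 0" using quotient_basisD(3)[OF B2] by blast
    then show "c b = 0" using 0 b by auto
  qed (use fin BV sub in auto)
  have 1: "quotient_coord scale S B1 (f b) b = quotient_coord scale U (B1 \<union> B2) (f b) b" if "b \<in> B1" for b
  proof (rule quotient_coord_eqI[OF B1 sub(2) _ that, where c = "quotient_coord scale U (B1 \<union> B2) (f b)"])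
    let ?c = "quotient_coord scale U (B1 \<union> B2) (f b)"
    have "f b - (\<Sum>b\<in>B1 \<union> B2. scale (?c b) b) \<in> S"
      using quotient_coord[OF B, of "f b"] that f BV sub by blast
    then have "f b - (\<Sum>b\<in>B1 \<union> B2. scale (?c b) b) + (\<Sum>b\<in>B2. scale (?c b) b) \<in> S"
      using sub sumS by (intro subspace_add) auto
    then show "f b - (\<Sum>b\<in>B1. scale (?c b) b) \<in> S"
      by (simp add: sum.union_disjoint[OF fin disj])
  qed
  have 2: "quotient_coord scale U (B1 \<union> B2) (f b) b = quotient_coord scale U B2 (f b) b" if "b \<in> B2" for b
  proof -
    let ?c = "\<lambda>b'. if b' \<in> B1 then 0 else quotient_coord scale U B2 (f b) b'"
    have "(\<Sum>b\<in>B1 \<union> B2. scale (?c b) b) = (\<Sum>b'\<in>B2. scale (quotient_coord scale U B2 (f b) b') b')"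
      using disj by (subst sum.union_disjoint[OF fin disj]) (auto intro!: sum.cong)
    moreover have "f b - (\<Sum>b'\<in>B2. scale (quotient_coord scale U B2 (f b) b') b') \<in> U"
      using that f BV by (intro quotient_coord[OF B2]) blast
    ultimately have "quotient_coord scale U (B1 \<union> B2) (f b) b = ?c b"
      using that by (intro quotient_coord_eqI[OF B sub(1)]) auto
    then show ?thesis using that disj by auto
  qed
  show ?thesis
    unfolding quotient_trace_of_basis[OF B sub(1,3) f(1,2,4)]
      quotient_trace_of_basis[OF B1 sub(2,3) f(1,2,3)]
      quotient_trace_of_basis[OF B2 sub(1,2) f(1,3,4)]
    by (simp add: sum.union_disjoint[OF fin disj] 1 2)
qed

lemma quotient_basis_of_independent:
  assumes "independent B" "span B = V" "finite B"
  shows "quotient_basis scale V {0} B"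
  unfolding quotient_basis_def
proof (intro conjI ballI allI impI)
  show "B \<subseteq> V" using assms(2) span_superset by blast
  fix v assume "v \<in> V"
  then show "\<exists>c. v - (\<Sum>b\<in>B. scale (c b) b) \<in> {0}"
    using assms by (auto simp: span_finite)
next
  fix c b assume "(\<Sum>b\<in>B. scale (c b) b) \<in> {0}" "b \<in> B"
  then show "c b = 0" using assms by (auto simp: dependent_finite)
qed (use assms in auto)

lemma ex_quotient_basis:
  assumes "subspace V" "finite X" "V \<subseteq> span X" "independent E" "E \<subseteq> V"
  shows "\<exists>B. E \<subseteq> B \<and> quotient_basis scale V {0} B"
proof -
  obtain B where B: "E \<subseteq> B" "B \<subseteq> V" "independent B" "V \<subseteq> span B"
    using maximal_independent_subset_extend[OF assms(5,4)] by blast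
  have "finite B" using independent_span_bound[OF assms(2) B(3)] B(2) assms(3) by auto
  moreover have "span B = V" using B assms(1) by (simp add: span_minimal subset_antisym)
  ultimately show ?thesis using B quotient_basis_of_independent by blast
qed

text \<open>
  In a basis of \<open>V\<close> that contains \<open>e\<close>, the only diagonal entry of \<open>f\<close> that can be nonzero is the
  one at \<open>e\<close>.
\<close>

lemma trace_rank_one:
  assumes V: "subspace V" "finite X" "V \<subseteq> span X" and e: "e \<in> V" "e \<noteq> 0"
    and f: "Vector_Spaces.linear scale scale f" "f ` V \<subseteq> span {e}" "f e = scale k e"
  shows "quotient_trace scale V {0} f = k"
proof -
  have "independent {e}" using e(2) by simp
  then obtain B where B: "{e} \<subseteq> B" "quotient_basis scale V {0} B"
    using ex_quotient_basis[OF V, of "{e}"] e by blast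
  have fin: "finite B" and BV: "B \<subseteq> V" by (rule quotient_basisD[OF B(2)])+
  have "\<forall>b\<in>B. \<exists>c. f b = scale c e" using f(2) BV by (auto simp: span_singleton)
  then obtain c where c: "\<And>b. b \<in> B \<Longrightarrow> f b = scale (c b) e" by metis
  have "scale (c e) e = scale k e" using c B f(3) by auto
  then have ce: "c e = k" using e(2) by simp
  interpret f: Vector_Spaces.linear scale scale f by fact
  have "span {e} \<subseteq> V" using V e by (intro span_minimal) auto
  then have fV: "f ` V \<subseteq> V" using f(2) by simp
  have "quotient_trace scale V {0} f = (\<Sum>b\<in>B. if b = e then c b else 0)"
  proof (rule quotient_trace_matrix[OF B(2) _ V(1) f(1) fV, where C = "\<lambda>b b'. if b' = e then c b else 0"])
    show "f b - (\<Sum>b'\<in>B. scale (if b' = e then c b else 0) b') \<in> {0}" if "b \<in> B" for b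
    proof -
      have "(\<Sum>b'\<in>B. scale (if b' = e then c b else 0) b') = (\<Sum>b'\<in>B. if b' = e then scale (c b) e else 0)"
        by (intro sum.cong) auto
      then show ?thesis using c[OF that] fin B(1) by simp
    qed
  qed (simp_all add: f.zero)
  also have "\<dots> = k" using B fin ce by simp
  finally show ?thesis .
qed

end

text \<open>
  Under these assumptions \<open>T\<close> induces an isomorphism of \<open>V1 / U1\<close> onto \<open>V2 / U2\<close>, so preimages of a
  basis form a basis.
\<close>

lemma quotient_basis_transfer:
  assumes T: "Vector_Spaces.linear s1 s2 T"
    and ker: "\<And>v. v \<in> V1 \<Longrightarrow> T v \<in> U2 \<longleftrightarrow> v \<in> U1" and im: "T ` V1 = V2"
    and sub: "module.subspace s1 V1" "module.subspace s2 U2"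
    and B: "quotient_basis s2 V2 U2 B"
  obtains g where "g ` B \<subseteq> V1" "\<And>b. b \<in> B \<Longrightarrow> T (g b) = b" "quotient_basis s1 V1 U1 (g ` B)" "inj_on g B"
proof -
  interpret T: Vector_Spaces.linear s1 s2 T by fact
  have fin: "finite B" and BV: "B \<subseteq> V2" by (rule T.vs2.quotient_basisD[OF B])+
  have "\<forall>b\<in>B. \<exists>v\<in>V1. T v = b" using im BV by blast
  then obtain g where g: "\<And>b. b \<in> B \<Longrightarrow> g b \<in> V1" "\<And>b. b \<in> B \<Longrightarrow> T (g b) = b" by metis
  have inj: "inj_on g B" by (metis g(2) inj_onI)
  have sumV: "(\<Sum>b\<in>B. s1 (c b) (g b)) \<in> V1" for c
    using g sub by (intro T.vs1.subspace_sum T.vs1.subspace_scale) auto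
  have sumT: "T (\<Sum>b\<in>B. s1 (c b) (g b)) = (\<Sum>b\<in>B. s2 (c b) b)" for c
    using g by (auto simp: T.sum T.scale intro!: sum.cong)
  have "quotient_basis s1 V1 U1 (g ` B)"
    unfolding quotient_basis_def
  proof (intro conjI ballI allI impI)
    fix v assume v: "v \<in> V1"
    then obtain c where "T v - (\<Sum>b\<in>B. s2 (c b) b) \<in> U2"
      using T.vs2.quotient_basisD(4)[OF B, of "T v"] im by blast
    then have "v - (\<Sum>b\<in>B. s1 (c b) (g b)) \<in> U1"
      using sumT[of c] ker[OF T.vs1.subspace_diff[OF sub(1) v sumV[of c]]] by (simp add: T.diff)
    then have "v - (\<Sum>b\<in>g ` B. s1 (c (T b)) b) \<in> U1"
      using g by (simp add: sum.reindex[OF inj] cong: sum.cong)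
    then show "\<exists>c. v - (\<Sum>b\<in>g ` B. s1 (c b) b) \<in> U1" 
      by (rule exI[of "\<lambda>c. v - (\<Sum>b\<in>g ` B. s1 (c b) b) \<in> U1"])
  next
    fix c b assume c: "(\<Sum>b\<in>g ` B. s1 (c b) b) \<in> U1" and b: "b \<in> g ` B"
    then have "(\<Sum>b\<in>B. s1 (c (g b)) (g b)) \<in> U1" by (simp add: sum.reindex[OF inj])
    then have "(\<Sum>b\<in>B. s2 (c (g b)) b) \<in> U2" using ker[OF sumV] sumT by metis
    then have "\<forall>b\<in>B. c (g b) = 0"
      using T.vs2.quotient_basisD(3)[OF B, of "\<lambda>b. c (g b)"] by blast
    then show "c b = 0" using b by auto
  qed (use fin g in auto)
  then show thesis using that g inj by blast
qed

text \<open>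
  In bases that correspond to each other under the isomorphism induced by \<open>T\<close>, the maps \<open>f\<close> and \<open>h\<close>
  have the same matrix.
\<close>

lemma quotient_trace_transfer:
  assumes T: "Vector_Spaces.linear s1 s2 T"
    and ker: "\<And>v. v \<in> V1 \<Longrightarrow> T v \<in> U2 \<longleftrightarrow> v \<in> U1" and im: "T ` V1 = V2"
    and sub: "module.subspace s1 U1" "module.subspace s1 V1" "module.subspace s2 U2" "module.subspace s2 V2"
    and "U1 \<subseteq> V1"
    and B: "quotient_basis s2 V2 U2 B"
    and f: "Vector_Spaces.linear s1 s1 f" "f ` V1 \<subseteq> V1"
    and h: "Vector_Spaces.linear s2 s2 h" "h ` U2 \<subseteq> U2"
    and Tf: "\<And>v. v \<in> V1 \<Longrightarrow> T (f v) = h (T v)"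
  shows "quotient_trace s1 V1 U1 f = quotient_trace s2 V2 U2 h"
proof -
  interpret T: Vector_Spaces.linear s1 s2 T by fact
  obtain g where g: "g ` B \<subseteq> V1" "\<And>b. b \<in> B \<Longrightarrow> T (g b) = b" "quotient_basis s1 V1 U1 (g ` B)" "inj_on g B"
    using quotient_basis_transfer[OF T ker im sub(2,3) B] by blast
  have h2: "h ` V2 \<subseteq> V2" using im f(2) Tf[symmetric] by fastforce
  have fU: "f ` U1 \<subseteq> U1"
  proof safe
    fix u assume u: "u \<in> U1"
    then have "h (T u) \<in> U2" using ker[of u] \<open>U1 \<subseteq> V1\<close> h(2) by auto
    then show "f u \<in> U1" using Tf[of u] ker[of "f u"] u \<open>U1 \<subseteq> V1\<close> f(2) by (metis image_subset_iff subsetD)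
  qed
  have sumV: "(\<Sum>b\<in>B. s1 (c b) (g b)) \<in> V1" for c
    using g sub by (intro T.vs1.subspace_sum T.vs1.subspace_scale) auto
  have sumT: "T (\<Sum>b\<in>B. s1 (c b) (g b)) = (\<Sum>b\<in>B. s2 (c b) b)" for c
    using g by (auto simp: T.sum T.scale intro!: sum.cong)
  let ?C = "\<lambda>b. quotient_coord s2 U2 B (h (T b))"
  have BV: "B \<subseteq> V2" by (rule T.vs2.quotient_basisD[OF B])
  have "quotient_trace s1 V1 U1 f = (\<Sum>b\<in>g ` B. ?C b (T b))"
  proof (rule T.vs1.quotient_trace_matrix[OF g(3) sub(1,2) f fU, where C = "\<lambda>b b'. ?C b (T b')"])
    fix b assume "b \<in> g ` B"
    then have bV: "b \<in> V1" using g by auto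
    have "T (f b) \<in> V2" using im bV f by blast
    from T.vs2.quotient_coord[OF B this] Tf[OF bV]
    have "T (f b) - (\<Sum>b'\<in>B. s2 (?C b b') b') \<in> U2" by simp
    then have "T (f b - (\<Sum>b'\<in>B. s1 (?C b b') (g b'))) \<in> U2" by (simp add: T.diff sumT)
    moreover have "f b - (\<Sum>b'\<in>B. s1 (?C b b') (g b')) \<in> V1"
      using bV f(2) sumV sub by (intro T.vs1.subspace_diff) auto
    ultimately have "f b - (\<Sum>b'\<in>B. s1 (?C b b') (g b')) \<in> U1" using ker by blast
    then show "f b - (\<Sum>b'\<in>g ` B. s1 (?C b (T b')) b') \<in> U1"
      using g by (simp add: sum.reindex cong: sum.cong)
  qed
  also have "\<dots> = (\<Sum>b\<in>B. quotient_coord s2 U2 B (h b) b)"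
    using g by (simp add: sum.reindex cong: sum.cong)
  also have "\<dots> = quotient_trace s2 V2 U2 h"
    by (rule T.vs2.quotient_trace_of_basis[OF B sub(3,4) h(1) h2 h(2), symmetric])
  finally show ?thesis .
qed


section \<open>Permutation modules\<close>

abbreviation (input) pm_linear :: "(('x \<Rightarrow>\<^sub>0 'f::field) \<Rightarrow> ('y \<Rightarrow>\<^sub>0 'f)) \<Rightarrow> bool" where
  "pm_linear \<equiv> Vector_Spaces.linear pm_scale pm_scale"

abbreviation (input) unit_vector :: "'x \<Rightarrow> ('x \<Rightarrow>\<^sub>0 'f::field)" where
  "unit_vector x \<equiv> Poly_Mapping.single x 1"

lemma pm_scale_single [simp]: "pm_scale c (Poly_Mapping.single x d) = Poly_Mapping.single x (c * d)"
  by (rule poly_mapping_eqI) (simp add: lookup_single when_def)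

lemma unit_vector_eq_iff [simp]:
  "(unit_vector x :: 'x \<Rightarrow>\<^sub>0 'f::field) = unit_vector y \<longleftrightarrow> x = y"
  by (auto dest!: arg_cong[of _ _ keys])

lemma pm_expand:
  assumes "finite S" "keys p \<subseteq> S"
  shows "p = (\<Sum>x\<in>S. pm_scale (lookup p x) (unit_vector x))"
proof (rule poly_mapping_eqI)
  fix y
  have "lookup (\<Sum>x\<in>S. pm_scale (lookup p x) (unit_vector x)) y = (\<Sum>x\<in>S. if x = y then lookup p x else 0)"
    by (simp add: lookup_sum lookup_single when_def if_distrib cong: if_cong)
  also have "\<dots> = lookup p y" using assms by (auto simp: in_keys_iff)
  finally show "lookup p y = lookup (\<Sum>x\<in>S. pm_scale (lookup p x) (unit_vector x)) y" ..
qed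

lemma keys_pm_scale: "keys (pm_scale c p) \<subseteq> keys p"
  by (auto simp: in_keys_iff)

lemma subspace_keys: "pm.subspace {p. keys p \<subseteq> S}"
  unfolding pm.subspace_def using keys_add keys_pm_scale by (fastforce simp: subset_iff)

lemma span_unit_vectors: "pm.span (unit_vector ` S) = {p :: 'x \<Rightarrow>\<^sub>0 'f::field. keys p \<subseteq> S}"
proof (rule subset_antisym)
  show "pm.span (unit_vector ` S) \<subseteq> {p :: 'x \<Rightarrow>\<^sub>0 'f. keys p \<subseteq> S}"
    by (rule pm.span_minimal[OF _ subspace_keys]) auto
next
  show "{p :: 'x \<Rightarrow>\<^sub>0 'f. keys p \<subseteq> S} \<subseteq> pm.span (unit_vector ` S)"
  proof safe
    fix p :: "'x \<Rightarrow>\<^sub>0 'f" assume "keys p \<subseteq> S"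
    then have "(\<Sum>x\<in>keys p. pm_scale (lookup p x) (unit_vector x)) \<in> pm.span (unit_vector ` S)"
      by (intro pm.span_sum pm.span_scale pm.span_base) auto
    then show "p \<in> pm.span (unit_vector ` S)" using pm_expand[of "keys p" p] by simp
  qed
qed

lemma linear_extension_superset:
  assumes "vector_space sc" "finite S" "keys p \<subseteq> S"
  shows "linear_extension sc f p = (\<Sum>x\<in>S. sc (lookup p x) (f x))"
proof -
  interpret vector_space sc by fact
  show ?thesis unfolding linear_extension_def
    using assms by (intro sum.mono_neutral_left) (auto simp: in_keys_iff)
qed

lemma linear_linear_extension:
  assumes "vector_space sc"
  shows "Vector_Spaces.linear pm_scale sc (linear_extension sc f)"
proof -
  interpret vector_space sc by fact
  note sup = linear_extension_superset[OF assms]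
  show ?thesis
    unfolding Vector_Spaces.linear_iff
  proof (intro conjI allI)
    fix p q
    have "linear_extension sc f (p + q) = (\<Sum>x\<in>keys p \<union> keys q. sc (lookup (p + q) x) (f x))"
      by (rule sup) (auto simp: keys_add)
    also have "\<dots> = (\<Sum>x\<in>keys p \<union> keys q. sc (lookup p x) (f x)) + (\<Sum>x\<in>keys p \<union> keys q. sc (lookup q x) (f x))"
      by (simp add: lookup_add scale_left_distrib sum.distrib)
    finally show "linear_extension sc f (p + q) = linear_extension sc f p + linear_extension sc f q"
      by (simp add: sup[of "keys p \<union> keys q"])
  next
    fix c p
    have "linear_extension sc f (pm_scale c p) = (\<Sum>x\<in>keys p. sc (lookup (pm_scale c p) x) (f x))"
      by (rule sup) (auto simp: keys_pm_scale)
    then show "linear_extension sc f (pm_scale c p) = sc c (linear_extension sc f p)"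
      by (simp add: linear_extension_def scale_sum_right)
  qed unfold_locales
qed

lemma linear_extension_single [simp]:
  assumes "vector_space sc"
  shows "linear_extension sc f (Poly_Mapping.single x c) = sc c (f x)"
proof -
  interpret vector_space sc by fact
  show ?thesis by (simp add: linear_extension_def)
qed

lemma vector_space_pm: "vector_space pm_scale"
  by unfold_locales

lemmas pm_linear_extension = linear_linear_extension[OF vector_space_pm]
lemmas pm_linear_extension_single [simp] = linear_extension_single[OF vector_space_pm]

lemma linear_map_basis: "pm_linear (map_basis g)"
  unfolding map_basis_def by (rule pm_linear_extension)

global_interpretation map_basis: Vector_Spaces.linear pm_scale pm_scale "map_basis g" for g
  by (rule linear_map_basis)

lemmas [simp] = map_basis.zero

lemma map_basis_single [simp]: "map_basis g (Poly_Mapping.single x c) = Poly_Mapping.single (g x) c"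
  by (simp add: map_basis_def)

lemma linear_eq_on_basis:
  assumes f: "Vector_Spaces.linear pm_scale sc f" and g: "Vector_Spaces.linear pm_scale sc g"
    and eq: "\<And>x. x \<in> S \<Longrightarrow> f (unit_vector x) = g (unit_vector x)" and p: "keys p \<subseteq> S"
  shows "f p = g p"
proof -
  interpret f: Vector_Spaces.linear pm_scale sc f by fact
  interpret g: Vector_Spaces.linear pm_scale sc g by fact
  have "f p = (\<Sum>x\<in>keys p. sc (lookup p x) (f (unit_vector x)))"
    using pm_expand[of "keys p" p] by (metis (no_types, lifting) f.scale f.sum finite_keys order_refl sum.cong)
  also have "\<dots> = (\<Sum>x\<in>keys p. sc (lookup p x) (g (unit_vector x)))"
    using eq p by (intro sum.cong) auto
  also have "\<dots> = g p"
    using pm_expand[of "keys p" p] by (metis (no_types, lifting) g.scale g.sum finite_keys order_refl sum.cong)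
  finally show ?thesis .
qed

lemma linear_in_subspace:
  assumes f: "Vector_Spaces.linear pm_scale sc f" and V: "module.subspace sc V"
    and mem: "\<And>x. x \<in> S \<Longrightarrow> f (unit_vector x) \<in> V" and p: "keys p \<subseteq> S"
  shows "f p \<in> V"
proof -
  interpret f: Vector_Spaces.linear pm_scale sc f by fact
  have "f p = (\<Sum>x\<in>keys p. sc (lookup p x) (f (unit_vector x)))"
    using pm_expand[of "keys p" p] by (metis (no_types, lifting) f.scale f.sum finite_keys order_refl sum.cong)
  also have "\<dots> \<in> V"
    using mem p by (intro f.vs2.subspace_sum f.vs2.subspace_scale V) auto
  finally show ?thesis .
qed

lemma linear_comp:
  assumes "Vector_Spaces.linear s1 s2 f" "Vector_Spaces.linear s2 s3 g"
  shows "Vector_Spaces.linear s1 s3 (\<lambda>v. g (f v))"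
  using Vector_Spaces.linear_compose[OF assms] by (simp add: o_def)

lemma map_basis_comp: "map_basis g (map_basis h p) = map_basis (\<lambda>x. g (h x)) p"
  by (rule linear_eq_on_basis[OF linear_comp[OF linear_map_basis linear_map_basis] linear_map_basis _ subset_UNIV])
    simp

lemma map_basis_cong:
  assumes "\<And>x. x \<in> keys p \<Longrightarrow> g x = h x"
  shows "map_basis g p = map_basis h p"
  by (rule linear_eq_on_basis[OF linear_map_basis linear_map_basis, where S = "keys p"]) (simp_all add: assms)

lemma map_basis_ident: "(\<And>x. x \<in> keys p \<Longrightarrow> g x = x) \<Longrightarrow> map_basis g p = p"
  by (rule linear_eq_on_basis[OF linear_map_basis pm.linear_id[unfolded id_def], where S = "keys p"]) simp_all

lemma keys_map_basis: "keys (map_basis g p) \<subseteq> g ` keys p"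
proof -
  have "map_basis g p \<in> {q. keys q \<subseteq> g ` keys p}"
    by (rule linear_in_subspace[OF linear_map_basis subspace_keys _ order_refl]) simp
  then show ?thesis by simp
qed

lemma quotient_basis_unit_vectors:
  assumes "finite X"
  shows "quotient_basis pm_scale {p :: 'x \<Rightarrow>\<^sub>0 'f::field. keys p \<subseteq> X} {0} (unit_vector ` X)"
proof -
  have inj: "inj_on (unit_vector :: 'x \<Rightarrow> 'x \<Rightarrow>\<^sub>0 'f) X" by (simp add: inj_on_def)
  have 0: "u v = 0"
    if u: "(\<Sum>v\<in>unit_vector ` X. pm_scale (u v) v) = 0" and v: "v \<in> unit_vector ` X" for u and v :: "'x \<Rightarrow>\<^sub>0 'f"
  proof -
    obtain x where x: "x \<in> X" "v = unit_vector x" using v by auto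
    have "lookup (\<Sum>v\<in>unit_vector ` X. pm_scale (u v) v) x = (\<Sum>y\<in>X. if y = x then u (unit_vector y) else 0)"
      using inj by (simp add: sum.reindex lookup_sum lookup_single when_def if_distrib cong: if_cong)
    also have "\<dots> = u v" using x assms by simp
    finally show "u v = 0" using u by simp
  qed
  have "pm.independent (unit_vector ` X :: ('x \<Rightarrow>\<^sub>0 'f) set)"
    using 0 assms by (subst pm.dependent_finite) auto
  then show ?thesis
    by (rule pm.quotient_basis_of_independent[OF _ span_unit_vectors]) (use assms in simp)
qed

text \<open>
  The matrix of a permutation of the basis vectors has a 1 on the diagonal exactly at the fixed
  points.
\<close>

lemma trace_permutation_module:
  assumes "finite X" "g ` X \<subseteq> X"
  shows "quotient_trace pm_scale {p :: 'x \<Rightarrow>\<^sub>0 'f::field. keys p \<subseteq> X} {0} (map_basis g)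
    = of_nat (card {x\<in>X. g x = x})"
proof -
  have inj: "inj_on (unit_vector :: 'x \<Rightarrow> 'x \<Rightarrow>\<^sub>0 'f) X" by (simp add: inj_on_def)
  have "quotient_trace pm_scale {p :: 'x \<Rightarrow>\<^sub>0 'f. keys p \<subseteq> X} {0} (map_basis g)
     = (\<Sum>b\<in>(unit_vector ` X :: ('x \<Rightarrow>\<^sub>0 'f) set). if b = map_basis g b then 1 else 0)"
  proof (rule pm.quotient_trace_matrix[OF quotient_basis_unit_vectors[OF assms(1)] _ subspace_keys linear_map_basis,
        where C = "\<lambda>b b'. if b' = map_basis g b then 1 else 0"])
    show "map_basis g ` {p. keys p \<subseteq> X} \<subseteq> {p :: 'x \<Rightarrow>\<^sub>0 'f. keys p \<subseteq> X}"
      using assms(2) keys_map_basis by fastforce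
    fix b :: "'x \<Rightarrow>\<^sub>0 'f" assume "b \<in> unit_vector ` X"
    then have "map_basis g b \<in> unit_vector ` X" using assms(2) by auto
    then show "map_basis g b - (\<Sum>b'\<in>unit_vector ` X. pm_scale (if b' = map_basis g b then 1 else 0) b') \<in> {0}"
      using assms(1) by (simp add: if_distrib[of "\<lambda>c. pm_scale c _"] cong: if_cong)
  qed (use assms in \<open>auto simp: map_basis.zero\<close>)
  also have "\<dots> = (\<Sum>x\<in>X. if g x = x then 1 else 0)"
    using inj by (simp add: sum.reindex eq_commute)
  also have "\<dots> = of_nat (card {x\<in>X. g x = x})"
    using assms(1) by (simp add: sum.If_cases Int_def)
  finally show ?thesis .
qed

lemma ex_quotient_basis_pm:
  assumes "finite X" "pm.subspace V" "V \<subseteq> {p :: 'x \<Rightarrow>\<^sub>0 'f::field. keys p \<subseteq> X}"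
  obtains B where "quotient_basis pm_scale V {0} B"
  using pm.ex_quotient_basis[of V "unit_vector ` X" "{}"] assms
  by (auto simp: span_unit_vectors pm.independent_empty)

section \<open>Signed symmetrizers\<close>

locale perm_group =
  fixes C :: "('a \<Rightarrow> 'a) set" and S :: "'a set"
  assumes finite_S: "finite S"
    and permutes: "\<pi> \<in> C \<Longrightarrow> \<pi> permutes S"
    and id_in: "id \<in> C"
    and comp_in: "\<pi> \<in> C \<Longrightarrow> \<rho> \<in> C \<Longrightarrow> \<pi> \<circ> \<rho> \<in> C"
    and inv_in: "\<pi> \<in> C \<Longrightarrow> inv \<pi> \<in> C"
begin

lemma finite_C: "finite C"
  by (rule finite_subset[OF _ finite_permutations[OF finite_S]]) (auto dest: permutes)

lemma permutation: "\<pi> \<in> C \<Longrightarrow> permutation \<pi>"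
  using permutes finite_S permutation_permutes by blast

lemma sign_comp: "\<pi> \<in> C \<Longrightarrow> \<rho> \<in> C \<Longrightarrow> sign (\<pi> \<circ> \<rho>) = sign \<pi> * sign \<rho>"
  using permutation by (intro sign_compose) auto

lemma inv_cancel: "\<rho> \<in> C \<Longrightarrow> \<rho> \<circ> inv \<rho> = id" "\<rho> \<in> C \<Longrightarrow> inv \<rho> \<circ> \<rho> = id"
  using permutes permutes_inv_o by blast+

lemma bij_right: "\<rho> \<in> C \<Longrightarrow> bij_betw (\<lambda>\<pi>. \<pi> \<circ> \<rho>) C C"
  by (rule bij_betwI[where g = "\<lambda>\<pi>. \<pi> \<circ> inv \<rho>"])
    (auto simp: comp_in inv_in o_assoc[symmetric] inv_cancel)

lemma bij_left: "\<rho> \<in> C \<Longrightarrow> bij_betw (\<lambda>\<pi>. \<rho> \<circ> \<pi>) C C"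
  by (rule bij_betwI[where g = "\<lambda>\<pi>. inv \<rho> \<circ> \<pi>"])
    (auto simp: comp_in inv_in o_assoc inv_cancel)

end

text \<open>
  For the column stabilizer of a tableau \<open>t\<close> this is the signed column sum \<open>\<kappa>\<^sub>t\<close>. The action is a
  parameter since tabloids as well as sets of entries are acted upon.
\<close>

definition antisymmetrizer ::
    "('a \<Rightarrow> 'a) set \<Rightarrow> (('a \<Rightarrow> 'a) \<Rightarrow> 'x \<Rightarrow> 'x) \<Rightarrow> ('x \<Rightarrow>\<^sub>0 'f::field) \<Rightarrow> ('x \<Rightarrow>\<^sub>0 'f)" where
  "antisymmetrizer C act v = (\<Sum>\<pi>\<in>C. pm_scale (of_int (sign \<pi>)) (map_basis (act \<pi>) v))"

lemma pm_linear_sum: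
  assumes "\<And>i. i \<in> I \<Longrightarrow> pm_linear (f i)"
  shows "pm_linear (\<lambda>v. \<Sum>i\<in>I. pm_scale (c i) (f i v))"
proof -
  interpret vector_space_pair pm_scale pm_scale ..
  show ?thesis
    using assms by (intro linear_compose_sum ballI linear_compose_scale_right) auto
qed

lemma linear_antisymmetrizer: "pm_linear (antisymmetrizer C act)"
  unfolding antisymmetrizer_def by (intro pm_linear_sum linear_map_basis)

global_interpretation antisymmetrizer: Vector_Spaces.linear pm_scale pm_scale "antisymmetrizer C act" for C act
  by (rule linear_antisymmetrizer)

locale perm_group_action = perm_group C S for C :: "('a \<Rightarrow> 'a) set" and S :: "'a set" +
  fixes act :: "('a \<Rightarrow> 'a) \<Rightarrow> 'x \<Rightarrow> 'x"
  assumes act_comp: "act (\<pi> \<circ> \<rho>) x = act \<pi> (act \<rho> x)"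
begin

abbreviation \<kappa> :: "('x \<Rightarrow>\<^sub>0 'f::field_char_0) \<Rightarrow> 'x \<Rightarrow>\<^sub>0 'f" where
  "\<kappa> \<equiv> antisymmetrizer C act"

lemma act_o: "act (\<pi> \<circ> \<rho>) = (\<lambda>x. act \<pi> (act \<rho> x))"
  by (rule ext) (rule act_comp)

lemma sign_sq: "of_int (sign \<pi>) * (of_int (sign \<pi>) :: 'f::field_char_0) = 1"
  by (simp flip: of_int_mult)

lemma \<kappa>_absorb:
  assumes "\<rho> \<in> C"
  shows "\<kappa> (map_basis (act \<rho>) v) = pm_scale (of_int (sign \<rho>)) (\<kappa> v)"
proof -
  have "\<kappa> (map_basis (act \<rho>) v)
      = (\<Sum>\<pi>\<in>C. pm_scale (of_int (sign \<rho>)) (pm_scale (of_int (sign (\<pi> \<circ> \<rho>))) (map_basis (act (\<pi> \<circ> \<rho>)) v)))"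
    unfolding antisymmetrizer_def
    by (intro sum.cong refl)
      (simp add: sign_comp assms map_basis_comp act_o mult.left_commute sign_sq)
  also have "\<dots> = (\<Sum>\<pi>\<in>C. pm_scale (of_int (sign \<rho>)) (pm_scale (of_int (sign \<pi>)) (map_basis (act \<pi>) v)))"
    by (rule sum.reindex_bij_betw[OF bij_right[OF assms]])
  finally show ?thesis by (simp only: antisymmetrizer_def pm.scale_sum_right)
qed

lemma act_\<kappa>:
  assumes "\<rho> \<in> C"
  shows "map_basis (act \<rho>) (\<kappa> v) = pm_scale (of_int (sign \<rho>)) (\<kappa> v)"
proof -
  have "map_basis (act \<rho>) (\<kappa> v)
      = (\<Sum>\<pi>\<in>C. pm_scale (of_int (sign \<rho>)) (pm_scale (of_int (sign (\<rho> \<circ> \<pi>))) (map_basis (act (\<rho> \<circ> \<pi>)) v)))"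
    unfolding antisymmetrizer_def map_basis.sum map_basis.scale
    by (intro sum.cong refl)
      (simp add: sign_comp assms map_basis_comp act_o mult.assoc[symmetric] sign_sq)
  also have "\<dots> = (\<Sum>\<pi>\<in>C. pm_scale (of_int (sign \<rho>)) (pm_scale (of_int (sign \<pi>)) (map_basis (act \<pi>) v)))"
    by (rule sum.reindex_bij_betw[OF bij_left[OF assms]])
  finally show ?thesis by (simp only: antisymmetrizer_def pm.scale_sum_right)
qed

lemma \<kappa>_semi_invariant:
  assumes "\<And>\<pi>. \<pi> \<in> C \<Longrightarrow> map_basis (act \<pi>) v = pm_scale (of_int (sign \<pi>)) v"
  shows "\<kappa> v = pm_scale (of_nat (card C)) v"
proof -
  have "\<kappa> v = (\<Sum>\<pi>\<in>C. v)"
    unfolding antisymmetrizer_def using assms by (intro sum.cong refl) (simp add: sign_sq)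
  also have "\<dots> = (\<Sum>\<pi>\<in>C. pm_scale 1 v)" by simp
  also have "\<dots> = pm_scale (of_nat (card C)) v" by (simp only: pm.scale_sum_left[symmetric]) simp
  finally show ?thesis .
qed

lemma \<kappa>_\<kappa>: "\<kappa> (\<kappa> v) = pm_scale (of_nat (card C)) (\<kappa> v)"
  by (rule \<kappa>_semi_invariant) (rule act_\<kappa>)

text \<open>
  Absorbing the transposition reverses the sign of \<open>\<kappa>\<close> and, on the other hand, leaves \<open>X\<close> as it
  is.
\<close>

lemma \<kappa>_eq_0:
  assumes "Transposition.transpose x y \<in> C" "x \<noteq> y" "act (Transposition.transpose x y) X = X"
  shows "\<kappa> (unit_vector X) = (0 :: 'x \<Rightarrow>\<^sub>0 'f::field_char_0)"
proof -
  have "\<kappa> (unit_vector X :: 'x \<Rightarrow>\<^sub>0 'f) = \<kappa> (map_basis (act (Transposition.transpose x y)) (unit_vector X))"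
    by (simp add: assms(3))
  also have "\<dots> = pm_scale (of_int (-1)) (\<kappa> (unit_vector X))"
    using \<kappa>_absorb[OF assms(1)] assms(2) by (simp add: sign_swap_id del: map_basis_single)
  finally have *: "\<kappa> (unit_vector X :: 'x \<Rightarrow>\<^sub>0 'f) = pm_scale (-1) (\<kappa> (unit_vector X))" by simp
  show ?thesis
  proof (rule poly_mapping_eqI)
    fix z
    have "lookup (\<kappa> (unit_vector X)) z = - (lookup (\<kappa> (unit_vector X)) z :: 'f)"
      using arg_cong[OF *, of "\<lambda>p. lookup p z"] by simp
    then show "lookup (\<kappa> (unit_vector X)) z = lookup (0 :: 'x \<Rightarrow>\<^sub>0 'f) z" by simp
  qed
qed

end

section \<open>Tableaux\<close>

definition tab_row :: "nat list \<Rightarrow> (nat \<times> nat \<Rightarrow> nat) \<Rightarrow> nat \<Rightarrow> nat" where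
  "tab_row lam t x = fst (inv_into (boxes lam) t x)"

definition tab_col :: "nat list \<Rightarrow> (nat \<times> nat \<Rightarrow> nat) \<Rightarrow> nat \<Rightarrow> nat" where
  "tab_col lam t x = snd (inv_into (boxes lam) t x)"

lemma boxes_Sigma: "boxes lam = (SIGMA i:{..<length lam}. {..<lam ! i})"
  by (auto simp: boxes_def)

lemma finite_boxes: "finite (boxes lam)"
  by (simp add: boxes_Sigma)

lemma card_boxes: "card (boxes lam) = sum_list lam"
  by (simp add: boxes_Sigma sum_list_sum_nth atLeast0LessThan)

lemma ex_tableau: "\<exists>t. t \<in> tableaux lam"
  using finite_same_card_bij[of "boxes lam" "{1..sum_list lam}"]
  by (auto simp: tableaux_def finite_boxes card_boxes)

context
  fixes lam t assumes t: "t \<in> tableaux lam"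
begin

lemma tab_bij: "bij_betw t (boxes lam) {1..sum_list lam}"
  using t by (simp add: tableaux_def)

lemma tab_box:
  assumes "(i, j) \<in> boxes lam"
  shows "t (i, j) \<in> {1..sum_list lam}" "tab_row lam t (t (i, j)) = i" "tab_col lam t (t (i, j)) = j"
  using tab_bij assms bij_betwE[OF tab_bij]
  by (auto simp: tab_row_def tab_col_def bij_betw_def inv_into_f_f)

lemma tab_entry:
  assumes "x \<in> {1..sum_list lam}"
  shows "(tab_row lam t x, tab_col lam t x) \<in> boxes lam" "t (tab_row lam t x, tab_col lam t x) = x"
proof -
  have "x \<in> t ` boxes lam" using tab_bij assms by (simp add: bij_betw_def)
  then show "(tab_row lam t x, tab_col lam t x) \<in> boxes lam" "t (tab_row lam t x, tab_col lam t x) = x"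
    by (simp_all add: tab_row_def tab_col_def inv_into_into f_inv_into_f)
qed

lemma tab_entry_eqI:
  assumes "x \<in> {1..sum_list lam}" "y \<in> {1..sum_list lam}"
    "tab_row lam t x = tab_row lam t y" "tab_col lam t x = tab_col lam t y"
  shows "x = y"
  using tab_entry(2)[OF assms(1)] tab_entry(2)[OF assms(2)] assms(3,4) by metis

lemma length_tabloid: "length (tabloid lam t) = length lam"
  by (simp add: tabloid_def)

lemma tabloid_nth:
  assumes "i < length lam"
  shows "tabloid lam t ! i = {x \<in> {1..sum_list lam}. tab_row lam t x = i}"
proof -
  have "(\<lambda>j. t (i, j)) ` {..<lam ! i} = {x \<in> {1..sum_list lam}. tab_row lam t x = i}"
  proof (intro subset_antisym subsetI)
    fix x assume "x \<in> (\<lambda>j. t (i, j)) ` {..<lam ! i}"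
    then obtain j where "j < lam ! i" "x = t (i, j)" by auto
    then show "x \<in> {x \<in> {1..sum_list lam}. tab_row lam t x = i}"
      using tab_box[of i j] assms by (auto simp: boxes_def)
  next
    fix x assume x: "x \<in> {x \<in> {1..sum_list lam}. tab_row lam t x = i}"
    then have "(i, tab_col lam t x) \<in> boxes lam" "t (i, tab_col lam t x) = x"
      using tab_entry[of x] by auto
    then show "x \<in> (\<lambda>j. t (i, j)) ` {..<lam ! i}"
      by (intro image_eqI[of _ _ "tab_col lam t x"]) (auto simp: boxes_def)
  qed
  then show ?thesis using assms by (simp add: tabloid_def)
qed

lemma card_tabloid_nth:
  assumes "i < length lam"
  shows "card (tabloid lam t ! i) = lam ! i"
proof -
  have "inj_on (\<lambda>j. t (i, j)) {..<lam ! i}"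
    using tab_bij assms by (auto simp: bij_betw_def inj_on_def boxes_def)
  then show ?thesis using assms by (simp add: tabloid_def card_image)
qed

text \<open>
  In terms of the column index of an entry, closure under composition and inverses is evident.
\<close>

lemma column_stabilizer_eq:
  "column_stabilizer lam t = {\<pi>. \<pi> permutes {1..sum_list lam} \<and>
     (\<forall>x\<in>{1..sum_list lam}. tab_col lam t (\<pi> x) = tab_col lam t x)}"
proof (intro subset_antisym subsetI CollectI conjI ballI)
  fix \<pi> x assume \<pi>: "\<pi> \<in> column_stabilizer lam t" 
  then show "\<pi> permutes {1..sum_list lam}" by (simp add: column_stabilizer_def)
  assume x: "x \<in> {1..sum_list lam}"
  let ?i = "tab_row lam t x" and ?j = "tab_col lam t x"
  obtain i' where "(i', ?j) \<in> boxes lam" "\<pi> (t (?i, ?j)) = t (i', ?j)"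
    using \<pi> tab_entry(1)[OF x] by (auto simp: column_stabilizer_def)
  then show "tab_col lam t (\<pi> x) = tab_col lam t x"
    using tab_entry(2)[OF x] tab_box(3) by simp
next
  fix \<pi> assume \<pi>: "\<pi> \<in> {\<pi>. \<pi> permutes {1..sum_list lam} \<and>
     (\<forall>x\<in>{1..sum_list lam}. tab_col lam t (\<pi> x) = tab_col lam t x)}"
  have "\<exists>i'. (i', j) \<in> boxes lam \<and> \<pi> (t (i, j)) = t (i', j)" if ij: "(i, j) \<in> boxes lam" for i j
  proof -
    have y: "\<pi> (t (i, j)) \<in> {1..sum_list lam}"
      using \<pi> tab_box(1)[OF ij] by (simp only: mem_Collect_eq permutes_in_image)
    have "tab_col lam t (\<pi> (t (i, j))) = j" using \<pi> tab_box[OF ij] by auto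
    then show ?thesis using tab_entry[OF y] by metis
  qed
  then show "\<pi> \<in> column_stabilizer lam t" using \<pi> by (auto simp: column_stabilizer_def)
qed

lemma perm_group_column_stabilizer: "perm_group (column_stabilizer lam t) {1..sum_list lam}"
proof
  fix \<pi> assume \<pi>: "\<pi> \<in> column_stabilizer lam t"
  then have p: "\<pi> permutes {1..sum_list lam}" by (simp add: column_stabilizer_def)
  show "\<pi> permutes {1..sum_list lam}" by fact
  show "inv \<pi> \<in> column_stabilizer lam t"
    unfolding column_stabilizer_eq
  proof (intro CollectI conjI ballI permutes_inv p)
    fix x assume "x \<in> {1..sum_list lam}"
    then have "inv \<pi> x \<in> {1..sum_list lam}" using permutes_in_image[OF permutes_inv[OF p]] by simp
    then show "tab_col lam t (inv \<pi> x) = tab_col lam t x"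
      using \<pi> permutes_inverses(1)[OF p, of x] unfolding column_stabilizer_eq by force
  qed
  fix \<rho> assume \<rho>: "\<rho> \<in> column_stabilizer lam t"
  then have r: "\<rho> permutes {1..sum_list lam}" by (simp add: column_stabilizer_def)
  show "\<pi> \<circ> \<rho> \<in> column_stabilizer lam t"
    using \<pi> \<rho> permutes_compose[OF r p] permutes_in_image[OF r]
    unfolding column_stabilizer_eq by (auto simp del: atLeastAtMost_iff)
qed (auto simp: column_stabilizer_eq permutes_id)

lemma tableau_comp:
  assumes p: "\<pi> permutes {1..sum_list lam}"
  shows "\<pi> \<circ> t \<in> tableaux lam"
  using bij_betw_trans[OF tab_bij permutes_imp_bij[OF p]] by (simp add: tableaux_def)

end

lemma tabloid_comp: "tabloid lam (\<pi> \<circ> t) = map ((`) \<pi>) (tabloid lam t)"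
  by (simp add: tabloid_def image_image)

lemma tab_col_comp:
  assumes t: "t \<in> tableaux lam" and p: "\<pi> permutes {1..sum_list lam}" and x: "x \<in> {1..sum_list lam}"
  shows "tab_col lam (\<pi> \<circ> t) (\<pi> x) = tab_col lam t x"
  using tab_box(3)[OF tableau_comp[OF t p] tab_entry(1)[OF t x]] tab_entry(2)[OF t x] by simp

abbreviation act_tabloid :: "(nat \<Rightarrow> nat) \<Rightarrow> nat set list \<Rightarrow> nat set list" where
  "act_tabloid \<pi> \<equiv> map ((`) \<pi>)"

lemma polytabloid_eq: "polytabloid lam t
    = antisymmetrizer (column_stabilizer lam t) act_tabloid (unit_vector (tabloid lam t))"
  by (simp add: polytabloid_def antisymmetrizer_def tabloid_comp)

text \<open>
  Relabelling the entries of \<open>t\<close> by \<open>\<pi>\<close> conjugates the column stabilizer by \<open>\<pi>\<close>, which does not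
  change signs. So permutations send polytabloids to polytabloids, and Specht modules are stable.
\<close>

lemma column_stabilizer_conj:
  assumes t: "t \<in> tableaux lam" and p: "\<pi> permutes {1..sum_list lam}" and \<sigma>: "\<sigma> \<in> column_stabilizer lam t"
  shows "\<pi> \<circ> \<sigma> \<circ> inv \<pi> \<in> column_stabilizer lam (\<pi> \<circ> t)"
  unfolding column_stabilizer_eq[OF tableau_comp[OF t p]]
proof (intro CollectI conjI ballI)
  have s: "\<sigma> permutes {1..sum_list lam}" using \<sigma> by (simp add: column_stabilizer_def)
  show "\<pi> \<circ> \<sigma> \<circ> inv \<pi> permutes {1..sum_list lam}"
    by (intro permutes_compose p s permutes_inv)
  fix x assume x: "x \<in> {1..sum_list lam}"
  let ?y = "inv \<pi> x"
  have y: "?y \<in> {1..sum_list lam}" "\<pi> ?y = x"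
    using x permutes_in_image[OF permutes_inv[OF p]] permutes_inverses(1)[OF p] by blast+
  have "\<sigma> ?y \<in> {1..sum_list lam}" using y permutes_in_image[OF s] by blast
  then have "tab_col lam (\<pi> \<circ> t) (\<pi> (\<sigma> ?y)) = tab_col lam t ?y"
    using tab_col_comp[OF t p] \<sigma> y unfolding column_stabilizer_eq[OF t] by simp
  also have "\<dots> = tab_col lam (\<pi> \<circ> t) x"
    using tab_col_comp[OF t p y(1)] y(2) by simp
  finally show "tab_col lam (\<pi> \<circ> t) ((\<pi> \<circ> \<sigma> \<circ> inv \<pi>) x) = tab_col lam (\<pi> \<circ> t) x" by simp
qed

lemma bij_column_stabilizer_conj:
  assumes t: "t \<in> tableaux lam" and p: "\<pi> permutes {1..sum_list lam}"
  shows "bij_betw (\<lambda>\<sigma>. \<pi> \<circ> \<sigma> \<circ> inv \<pi>) (column_stabilizer lam t) (column_stabilizer lam (\<pi> \<circ> t))"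
proof (rule bij_betwI[where g = "\<lambda>\<sigma>. inv \<pi> \<circ> \<sigma> \<circ> \<pi>"])
  have c: "inv \<pi> \<circ> \<pi> = id" "\<pi> \<circ> inv \<pi> = id" using permutes_inv_o[OF p] by auto
  show "(\<lambda>\<sigma>. \<pi> \<circ> \<sigma> \<circ> inv \<pi>) \<in> column_stabilizer lam t \<rightarrow> column_stabilizer lam (\<pi> \<circ> t)"
    using column_stabilizer_conj[OF t p] by auto
  show "(\<lambda>\<sigma>. inv \<pi> \<circ> \<sigma> \<circ> \<pi>) \<in> column_stabilizer lam (\<pi> \<circ> t) \<rightarrow> column_stabilizer lam t"
    using column_stabilizer_conj[OF tableau_comp[OF t p] permutes_inv[OF p]] c permutes_inv_inv[OF p]
    by (auto simp: o_assoc)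
  show "inv \<pi> \<circ> (\<pi> \<circ> \<sigma> \<circ> inv \<pi>) \<circ> \<pi> = \<sigma>" "\<pi> \<circ> (inv \<pi> \<circ> \<sigma> \<circ> \<pi>) \<circ> inv \<pi> = \<sigma>" for \<sigma>
    using c by (simp_all add: fun_eq_iff)
qed

lemma act_polytabloid:
  assumes t: "t \<in> tableaux lam" and p: "\<pi> permutes {1..sum_list lam}"
  shows "map_basis (act_tabloid \<pi>) (polytabloid lam t) = (polytabloid lam (\<pi> \<circ> t) :: _ \<Rightarrow>\<^sub>0 'f::field)"
proof -
  interpret perm_group "column_stabilizer lam t" "{1..sum_list lam}"
    by (rule perm_group_column_stabilizer[OF t])
  have P: "permutation \<pi>" using p permutation_permutes by blast
  have "polytabloid lam (\<pi> \<circ> t) = (\<Sum>\<sigma>\<in>column_stabilizer lam t.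
      Poly_Mapping.single (tabloid lam ((\<pi> \<circ> \<sigma> \<circ> inv \<pi>) \<circ> (\<pi> \<circ> t))) (of_int (sign (\<pi> \<circ> \<sigma> \<circ> inv \<pi>)) :: 'f))"
    unfolding polytabloid_def by (rule sum.reindex_bij_betw[OF bij_column_stabilizer_conj[OF t p], symmetric])
  also have "\<dots> = (\<Sum>\<sigma>\<in>column_stabilizer lam t. map_basis (act_tabloid \<pi>) 
      (Poly_Mapping.single (tabloid lam (\<sigma> \<circ> t)) (of_int (sign \<sigma>))))"
  proof (intro sum.cong refl)
    fix \<sigma> assume \<sigma>: "\<sigma> \<in> column_stabilizer lam t"
    have "sign (\<pi> \<circ> \<sigma> \<circ> inv \<pi>) = sign \<pi> * sign \<sigma> * sign (inv \<pi>)"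
      using P permutation[OF \<sigma>] by (simp add: sign_compose permutation_compose permutation_inverse)
    also have "\<dots> = sign \<sigma>" using P by (simp add: sign_inverse mult.commute mult.left_commute)
    finally have 1: "sign (\<pi> \<circ> \<sigma> \<circ> inv \<pi>) = sign \<sigma>" .
    have 2: "(\<pi> \<circ> \<sigma> \<circ> inv \<pi>) \<circ> (\<pi> \<circ> t) = \<pi> \<circ> (\<sigma> \<circ> t)"
      using permutes_inverses(2)[OF p] by (simp add: fun_eq_iff)
    show "Poly_Mapping.single (tabloid lam ((\<pi> \<circ> \<sigma> \<circ> inv \<pi>) \<circ> (\<pi> \<circ> t))) (of_int (sign (\<pi> \<circ> \<sigma> \<circ> inv \<pi>)) :: 'f)
      = map_basis (act_tabloid \<pi>) (Poly_Mapping.single (tabloid lam (\<sigma> \<circ> t)) (of_int (sign \<sigma>)))"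
      unfolding 1 2 by (simp add: tabloid_comp[of lam \<pi>])
  qed
  finally show ?thesis by (simp add: polytabloid_def map_basis.sum)
qed

definition tabloids :: "nat list \<Rightarrow> nat set list set" where
  "tabloids lam = tabloid lam ` tableaux lam"

lemma finite_tabloids: "finite (tabloids lam)"
proof (rule finite_subset)
  show "tabloids lam \<subseteq> {xs. set xs \<subseteq> Pow {1..sum_list lam} \<and> length xs = length lam}"
    by (auto simp: tabloids_def length_tabloid set_conv_nth tabloid_nth)
qed (intro finite_lists_length_eq finite_Pow_iff[THEN iffD2] finite_atLeastAtMost)

lemma specht_subset: "specht_module lam \<subseteq> {p. keys p \<subseteq> tabloids lam}"
  unfolding specht_module_def
proof (rule pm.span_minimal[OF _ subspace_keys], safe)
  fix t assume t: "t \<in> tableaux lam"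
  show "x \<in> tabloids lam" if "x \<in> keys (polytabloid lam t)" for x
  proof -
    have "x \<in> (\<Union>\<pi>\<in>column_stabilizer lam t. {tabloid lam (\<pi> \<circ> t)})"
      using that keys_sum unfolding polytabloid_def by (fastforce split: if_splits)
    then show ?thesis using tableau_comp[OF t]
      by (auto simp: tabloids_def column_stabilizer_def)
  qed
qed

lemma subspace_specht: "pm.subspace (specht_module lam)"
  by (simp add: specht_module_def)

lemma act_specht:
  assumes p: "\<pi> permutes {1..sum_list lam}"
  shows "map_basis (act_tabloid \<pi>) ` specht_module lam \<subseteq> specht_module lam"
proof -
  have "map_basis (act_tabloid \<pi>) ` polytabloid lam ` tableaux lam \<subseteq> polytabloid lam ` tableaux lam"
    using act_polytabloid[OF _ p] tableau_comp[OF _ p] by fastforce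
  then show ?thesis
    unfolding specht_module_def map_basis.span_image[symmetric] by (rule pm.span_mono)
qed


section \<open>Linear independence of the irreducible characters\<close>

text \<open>
  An initial segment has the least sum among the sets of its size, since an element outside of it
  exceeds all its elements.
\<close>

lemma sum_initial_segment_le:
  fixes A D :: "nat set"
  assumes fin: "finite A" "finite D" and card: "card A = card D"
    and down: "\<And>i k. i \<in> D \<Longrightarrow> k \<le> i \<Longrightarrow> k \<in> D"
  shows "\<Sum>D \<le> \<Sum>A" and "\<Sum>A = \<Sum>D \<Longrightarrow> A = D"
proof -
  have "card (D - A) = card (A - D)"
    using card by (metis card_Diff_subset_Int card_gt_0_iff fin(1) fin(2) finite_Int inf_commute)
  then obtain h where h: "bij_betw h (D - A) (A - D)"
    using finite_same_card_bij[of "D - A" "A - D"] fin by auto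
  have less: "y < h y" if "y \<in> D - A" for y
    using bij_betwE[OF h] that down by (metis DiffD1 DiffD2 not_less)
  have A: "\<Sum>A = \<Sum>(A \<inter> D) + (\<Sum>y\<in>D - A. h y)"
    using sum.reindex_bij_betw[OF h, of "\<lambda>x. x"] sum.Int_Diff[OF fin(1), of "\<lambda>x. x" D] by simp
  have D: "\<Sum>D = \<Sum>(A \<inter> D) + \<Sum>(D - A)"
    using sum.Int_Diff[OF fin(2), of "\<lambda>x. x" A] by (simp add: Int_commute)
  show "\<Sum>D \<le> \<Sum>A"
    unfolding A D using less by (intro add_left_mono sum_mono) (simp add: less_imp_le)
  assume "\<Sum>A = \<Sum>D"
  then have "(\<Sum>y\<in>D - A. h y) = \<Sum>(D - A)" using A D by simp
  then have "D - A = {}"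
    using sum_strict_mono[of "D - A" "\<lambda>y. y" h] less fin by fastforce
  then have "D \<subseteq> A" by blast
  then show "A = D" using card_subset_eq[OF fin(1), of D] card by simp
qed

text \<open>
  The statistic \<open>n(\<lambda>) = \<Sum>\<^sub>i i \<lambda>\<^sub>i\<close> (rows counted from 0). It is strictly decreasing in the dominance order
  and serves in its place.
\<close>

definition row_weight :: "nat list \<Rightarrow> nat" where
  "row_weight lam = (\<Sum>b\<in>boxes lam. fst b)"

lemma row_weight_eq:
  assumes t: "t \<in> tableaux lam"
  shows "row_weight lam = (\<Sum>x\<in>{1..sum_list lam}. tab_row lam t x)"
proof -
  have "(\<Sum>x\<in>{1..sum_list lam}. tab_row lam t x) = (\<Sum>b\<in>boxes lam. tab_row lam t (t b))"
    by (rule sum.reindex_bij_betw[OF tab_bij[OF t], symmetric])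
  also have "\<dots> = (\<Sum>b\<in>boxes lam. fst b)"
    using tab_box(2)[OF t] by (intro sum.cong) auto
  finally show ?thesis by (simp add: row_weight_def)
qed

lemma boxes_down:
  assumes "mu \<turnstile>\<^sub>p N" "(i, j) \<in> boxes mu" "k \<le> i"
  shows "(k, j) \<in> boxes mu"
proof -
  have "mu ! i \<le> mu ! k" 
    using assms sorted_wrt_nth_less[of "(\<ge>)" mu k i] by (cases "k = i") (auto simp: is_partition_def boxes_def)
  then show ?thesis using assms by (auto simp: boxes_def)
qed

lemma boxes_first_column:
  assumes "mu \<turnstile>\<^sub>p N" "i < length mu"
  shows "(i, 0) \<in> boxes mu"
  using assms by (auto simp: is_partition_def boxes_def in_set_conv_nth intro: Suc_leI)

lemma transpose_in_column_stabilizer: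
  assumes t: "t \<in> tableaux mu" and xy: "x \<in> {1..sum_list mu}" "y \<in> {1..sum_list mu}"
    and col: "tab_col mu t x = tab_col mu t y"
  shows "Transposition.transpose x y \<in> column_stabilizer mu t"
  unfolding column_stabilizer_eq[OF t] using xy col
  by (auto simp: permutes_swap_id Transposition.transpose_def)

text \<open>
  The entries of a column of \<open>t\<close> lie in different rows of the tabloid of \<open>s\<close>. Hence these rows have
  at least the sum of \<open>0, 1, 2, \<dots>\<close>, which are the rows that the entries occupy in \<open>t\<close>. Summation over
  all columns gives \<open>row_weight mu \<le> row_weight lam\<close>, so there is equality in every column, and a
  permutation of each column carries the rows of \<open>s\<close> to those of \<open>t\<close>.
\<close>

lemma tabloid_in_column_orbit:
  assumes t: "t \<in> tableaux mu" and s: "s \<in> tableaux lam"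
    and mu: "mu \<turnstile>\<^sub>p N" and lam: "lam \<turnstile>\<^sub>p N"
    and weight: "row_weight lam \<le> row_weight mu"
    and inj: "\<And>x y. x \<in> {1..N} \<Longrightarrow> y \<in> {1..N} \<Longrightarrow> tab_col mu t x = tab_col mu t y \<Longrightarrow>
      tab_row lam s x = tab_row lam s y \<Longrightarrow> x = y"
  shows "lam = mu" "\<exists>\<pi>\<in>column_stabilizer mu t. tabloid lam s = act_tabloid \<pi> (tabloid mu t)"
proof -
  have N: "sum_list mu = N" "sum_list lam = N" using mu lam by (auto simp: is_partition_def)
  define \<rho> where "\<rho> = tab_row lam s"
  define r where "r = tab_row mu t"
  define c where "c = tab_col mu t"
  define X where "X j = {x \<in> {1..N}. c x = j}" for j
  note box = tab_box[OF t, folded r_def c_def, unfolded N]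
  note entry = tab_entry[OF t, folded r_def c_def, unfolded N]
  have finX: "finite (X j)" for j by (simp add: X_def)
  have inj_r: "inj_on r (X j)" for j
    using tab_entry_eqI[OF t] unfolding X_def c_def r_def N by (auto intro!: inj_onI)
  have inj_\<rho>: "inj_on \<rho> (X j)" for j
    using inj unfolding X_def c_def \<rho>_def by (auto intro!: inj_onI)
  have down: "k \<in> r ` X j" if "i \<in> r ` X j" "k \<le> i" for i j k
  proof -
    obtain x where x: "x \<in> {1..N}" "c x = j" "r x = i" using \<open>i \<in> r ` X j\<close> by (auto simp: X_def)
    then have "(i, j) \<in> boxes mu" using entry(1)[of x] by simp
    then have "(k, j) \<in> boxes mu" using boxes_down[OF mu] \<open>k \<le> i\<close> by blast
    then have "t (k, j) \<in> X j" "r (t (k, j)) = k" using box by (auto simp: X_def simp del: atLeastAtMost_iff)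
    then show ?thesis by force
  qed
  have cards: "card (\<rho> ` X j) = card (r ` X j)" for j by (simp add: card_image inj_r inj_\<rho>)
  have le: "(\<Sum>x\<in>X j. r x) \<le> (\<Sum>x\<in>X j. \<rho> x)" for j
    using sum_initial_segment_le(1)[OF _ _ cards[of j]] down finX
    by (simp add: sum.reindex inj_r inj_\<rho>)
  have image_eq: "\<rho> ` X j = r ` X j" if "(\<Sum>x\<in>X j. \<rho> x) = (\<Sum>x\<in>X j. r x)" for j
    using sum_initial_segment_le(2)[OF _ _ cards[of j]] down finX that
    by (simp add: sum.reindex inj_r inj_\<rho>)
  have total: "(\<Sum>j\<in>c ` {1..N}. \<Sum>x\<in>X j. f x) = (\<Sum>x\<in>{1..N}. f x)" for f :: "nat \<Rightarrow> nat"
    unfolding X_def by (rule sum.group) auto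
  have "(\<Sum>x\<in>{1..N}. \<rho> x) \<le> (\<Sum>x\<in>{1..N}. r x)"
    using weight unfolding row_weight_eq[OF s] row_weight_eq[OF t] N \<rho>_def r_def .
  moreover have "(\<Sum>j\<in>c ` {1..N}. \<Sum>x\<in>X j. r x) \<le> (\<Sum>j\<in>c ` {1..N}. \<Sum>x\<in>X j. \<rho> x)"
    by (intro sum_mono le)
  ultimately have eq: "(\<Sum>j\<in>c ` {1..N}. \<Sum>x\<in>X j. r x) = (\<Sum>j\<in>c ` {1..N}. \<Sum>x\<in>X j. \<rho> x)"
    unfolding total by (rule antisym[rotated])
  have image: "\<rho> ` X (c x) = r ` X (c x)" if "x \<in> {1..N}" for x
    using sum_mono_inv[OF eq le, of "c x"] that by (intro image_eq) simp
  have \<rho>_box: "(\<rho> x, c x) \<in> boxes mu" if x: "x \<in> {1..N}" for x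
  proof -
    have "\<rho> x \<in> r ` X (c x)" using image[OF x] x by (auto simp: X_def)
    then obtain y where "y \<in> {1..N}" "c y = c x" "\<rho> x = r y" by (auto simp: X_def)
    then show ?thesis using entry(1)[of y] by simp
  qed
  \<comment> \<open>An entry moves, within its column of \<open>t\<close>, to the row that it has in \<open>s\<close>.\<close>
  define \<pi> where "\<pi> x = (if x \<in> {1..N} then t (\<rho> x, c x) else x)" for x
  have \<pi>: "\<pi> x \<in> {1..N}" "r (\<pi> x) = \<rho> x" "c (\<pi> x) = c x" if "x \<in> {1..N}" for x
    using box[OF \<rho>_box[OF that]] that by (auto simp: \<pi>_def)
  have "inj_on \<pi> {1..N}"
  proof (rule inj_onI)
    fix x y assume xy: "x \<in> {1..N}" "y \<in> {1..N}" "\<pi> x = \<pi> y"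
    then have "\<rho> x = \<rho> y" "c x = c y" using \<pi>(2,3) by metis+
    then show "x = y" using inj xy(1,2) by (simp add: \<rho>_def c_def)
  qed
  then have "bij_betw \<pi> {1..N} {1..N}"
    using \<pi>(1) endo_inj_surj[of "{1..N}" \<pi>] by (auto simp: bij_betw_def simp del: atLeastAtMost_iff)
  then have p: "\<pi> permutes {1..N}" by (rule bij_imp_permutes) (simp only: \<pi>_def if_False)
  have \<pi>C: "\<pi> \<in> column_stabilizer mu t"
    using p \<pi>(3) unfolding column_stabilizer_eq[OF t] N c_def by simp
  have surj: "\<exists>x\<in>{1..N}. \<pi> x = y" if "y \<in> {1..N}" for y
    using permutes_image[OF p] that by (metis imageE)
  have s_box: "s (i, 0) \<in> {1..N}" "\<rho> (s (i, 0)) = i" if "i < length lam" for i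
    using tab_box[OF s boxes_first_column[OF lam that]] unfolding \<rho>_def N by auto
  have len: "length lam = length mu"
  proof (rule antisym; rule leI; rule notI)
    assume l: "length mu < length lam"
    from \<rho>_box[OF s_box(1)[OF l]] s_box(2)[OF l] show False by (simp add: boxes_def)
  next
    assume l: "length lam < length mu"
    note b = box[OF boxes_first_column[OF mu l]]
    obtain x where x: "x \<in> {1..N}" "\<pi> x = t (length lam, 0)" using surj[OF b(1)] by blast
    then have "\<rho> x = length lam" using \<pi>(2)[OF x(1)] b(2) by simp
    then show False using tab_entry(1)[OF s, of x] x(1) unfolding \<rho>_def N by (simp add: boxes_def)
  qed
  have nth: "\<pi> ` (tabloid lam s ! i) = tabloid mu t ! i" if i: "i < length mu" for i
  proof -
    have 1: "tabloid lam s ! i = {x \<in> {1..N}. \<rho> x = i}"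
      using tabloid_nth[OF s] i len unfolding \<rho>_def N by simp
    have 2: "tabloid mu t ! i = {x \<in> {1..N}. r x = i}"
      using tabloid_nth[OF t] i unfolding r_def N by simp
    show ?thesis unfolding 1 2
    proof (intro subset_antisym subsetI)
      fix y assume "y \<in> \<pi> ` {x \<in> {1..N}. \<rho> x = i}"
      then show "y \<in> {x \<in> {1..N}. r x = i}" using \<pi> by (auto simp del: atLeastAtMost_iff)
    next
      fix y assume y: "y \<in> {x \<in> {1..N}. r x = i}"
      then obtain x where "x \<in> {1..N}" "\<pi> x = y" using surj by blast
      then show "y \<in> \<pi> ` {x \<in> {1..N}. \<rho> x = i}" using \<pi>(2)[of x] y by auto
    qed
  qed
  have inj\<pi>: "inj \<pi>" using permutes_inj[OF p] .
  show "lam = mu"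
  proof (rule nth_equalityI[OF len])
    fix i assume i: "i < length lam"
    have "card (\<pi> ` (tabloid lam s ! i)) = lam ! i"
      using card_tabloid_nth[OF s i] inj\<pi> by (simp add: card_image inj_on_subset)
    then show "lam ! i = mu ! i"
      using nth[of i] card_tabloid_nth[OF t, of i] i len by simp
  qed
  have "act_tabloid \<pi> (tabloid lam s) = tabloid mu t"
    by (rule nth_equalityI) (simp_all add: length_tabloid[OF s] length_tabloid[OF t] len nth)
  then have "act_tabloid (inv \<pi>) (act_tabloid \<pi> (tabloid lam s)) = act_tabloid (inv \<pi>) (tabloid mu t)" by simp
  moreover have "act_tabloid (inv \<pi>) (act_tabloid \<pi> T) = T" for T
    using inj\<pi> by (simp add: image_image o_def cong: map_cong)
  ultimately show "\<exists>\<pi>\<in>column_stabilizer mu t. tabloid lam s = act_tabloid \<pi> (tabloid mu t)"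
    using perm_group.inv_in[OF perm_group_column_stabilizer[OF t] \<pi>C] by auto
qed

locale tableau =
  fixes mu :: "nat list" and N :: nat and t
  assumes mu: "mu \<turnstile>\<^sub>p N" and t: "t \<in> tableaux mu"
begin

lemma N: "sum_list mu = N" using mu by (simp add: is_partition_def)

abbreviation "C \<equiv> column_stabilizer mu t"

sublocale perm_group_action C "{1..N}" act_tabloid
  using perm_group_column_stabilizer[OF t]
  by (intro perm_group_action.intro perm_group_action_axioms.intro) (simp_all add: N image_image)

text \<open>
  If two entries share a column of \<open>t\<close> and a row of \<open>s\<close>, then their transposition kills the tabloid
  under \<open>\<kappa>\<close>. Otherwise the tabloid lies in the orbit of that of \<open>t\<close>, where \<open>\<kappa>\<close> produces the polytabloid
  up to sign.
\<close>

lemma \<kappa>_tabloid: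
  assumes lam: "lam \<turnstile>\<^sub>p N" and s: "s \<in> tableaux lam" and w: "row_weight lam \<le> row_weight mu"
  shows "\<kappa> (unit_vector (tabloid lam s)) = (0 :: _ \<Rightarrow>\<^sub>0 'f::field_char_0) \<or>
    (lam = mu \<and> \<kappa> (unit_vector (tabloid lam s)) \<in> pm.span {polytabloid mu t :: _ \<Rightarrow>\<^sub>0 'f})"
proof (cases "\<exists>x\<in>{1..N}. \<exists>y\<in>{1..N}. tab_col mu t x = tab_col mu t y \<and>
      tab_row lam s x = tab_row lam s y \<and> x \<noteq> y")
  case True
  then obtain x y where xy: "x \<in> {1..N}" "y \<in> {1..N}" "tab_col mu t x = tab_col mu t y"
      "tab_row lam s x = tab_row lam s y" "x \<noteq> y" by blast
  have "Transposition.transpose x y \<in> C"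
    using transpose_in_column_stabilizer[OF t] xy N by blast
  moreover have "act_tabloid (Transposition.transpose x y) (tabloid lam s) = tabloid lam s"
  proof (rule nth_equalityI)
    fix i assume "i < length (act_tabloid (Transposition.transpose x y) (tabloid lam s))"
    then have i: "i < length lam" by (simp add: length_tabloid[OF s])
    have "x \<in> tabloid lam s ! i \<longleftrightarrow> y \<in> tabloid lam s ! i"
      using tabloid_nth[OF s i] xy lam by (simp add: is_partition_def)
    then show "act_tabloid (Transposition.transpose x y) (tabloid lam s) ! i = tabloid lam s ! i"
      using i by (simp add: length_tabloid[OF s])
  qed simp
  ultimately show ?thesis using \<kappa>_eq_0 xy(5) by blast
next
  case False
  then obtain \<pi> where \<pi>: "lam = mu" "\<pi> \<in> C" "tabloid lam s = act_tabloid \<pi> (tabloid mu t)"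
    using tabloid_in_column_orbit[OF t s mu lam w] by blast
  have "\<kappa> (unit_vector (tabloid lam s) :: _ \<Rightarrow>\<^sub>0 'f) = pm_scale (of_int (sign \<pi>)) (polytabloid mu t)"
    using \<kappa>_absorb[OF \<pi>(2), of "unit_vector (tabloid mu t)"] by (simp add: \<pi>(3) polytabloid_eq)
  then show ?thesis using \<pi>(1) by (simp add: pm.span_scale pm.span_base)
qed

text \<open>
  A permutation that preserves columns and rows of \<open>t\<close> is the identity, so the tabloid of \<open>t\<close> itself
  has coefficient 1.
\<close>

lemma polytabloid_nonzero: "polytabloid mu t \<noteq> (0 :: _ \<Rightarrow>\<^sub>0 'f::field)"
proof -
  have *: "\<pi> = id" if \<pi>: "\<pi> \<in> C" and eq: "tabloid mu (\<pi> \<circ> t) = tabloid mu t" for \<pi>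
  proof
    fix x
    show "\<pi> x = id x"
    proof (cases "x \<in> {1..N}")
      case True
      note x = this[folded N]
      have y: "\<pi> x \<in> {1..sum_list mu}" using permutes_in_image[OF permutes[OF \<pi>]] True N by blast
      let ?i = "tab_row mu t x"
      have i: "?i < length mu" using tab_entry(1)[OF t x] by (simp add: boxes_def)
      have "x \<in> tabloid mu t ! ?i" using tabloid_nth[OF t i] x by simp
      then have "\<pi> x \<in> tabloid mu (\<pi> \<circ> t) ! ?i"
        using i length_tabloid[OF t] by (simp add: tabloid_comp)
      then have "tab_row mu t (\<pi> x) = tab_row mu t x" using tabloid_nth[OF t i] eq by simp
      moreover have "tab_col mu t (\<pi> x) = tab_col mu t x" using \<pi> x column_stabilizer_eq[OF t] by auto
      ultimately show ?thesis using tab_entry_eqI[OF t y x] by simp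
    next
      case False
      then show ?thesis using permutes_not_in[OF permutes[OF \<pi>]] by simp
    qed
  qed
  have "lookup (polytabloid mu t) (tabloid mu t) = (\<Sum>\<pi>\<in>C. if \<pi> = id then 1 else (0 :: 'f))"
    unfolding polytabloid_def lookup_sum
    by (intro sum.cong refl) (auto simp: lookup_single when_def sign_id dest: *)
  also have "\<dots> = 1" using finite_C id_in by simp
  finally show ?thesis by auto
qed

text \<open>
  The left-hand side is the trace of \<open>\<kappa>\<close> on the Specht module of \<open>lam\<close>. There \<open>\<kappa>\<close> is zero if \<open>lam\<close>
  differs from \<open>mu\<close>; otherwise its image is spanned by the polytabloid of \<open>t\<close>, which is an eigenvector
  for the eigenvalue \<open>card C\<close>.
\<close>

lemma signed_sum_irr_char:
  assumes lam: "lam \<turnstile>\<^sub>p N" and w: "row_weight lam \<le> row_weight mu"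
  shows "(\<Sum>\<pi>\<in>C. of_int (sign \<pi>) * irr_char lam \<pi>) = (if lam = mu then of_nat (card C) else (0 :: 'f::field_char_0))"
proof -
  let ?S = "specht_module lam :: (_ \<Rightarrow>\<^sub>0 'f) set"
  have Nl: "sum_list lam = N" using lam by (simp add: is_partition_def)
  obtain B where B: "quotient_basis pm_scale ?S {0} B"
    by (rule ex_quotient_basis_pm[OF finite_tabloids subspace_specht specht_subset])
  have pres: "map_basis (act_tabloid \<pi>) ` ?S \<subseteq> ?S" if "\<pi> \<in> C" for \<pi>
    using act_specht[of \<pi> lam] permutes[OF that] Nl by simp
  have L: "(map_basis (act_tabloid \<pi>)) ` {0 :: _ \<Rightarrow>\<^sub>0 'f} \<subseteq> {0}" for \<pi>
    by (simp add: map_basis_def linear_extension_def)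
  have "(\<Sum>\<pi>\<in>C. of_int (sign \<pi>) * irr_char lam \<pi>) = quotient_trace pm_scale ?S {0} \<kappa>"
    unfolding antisymmetrizer_def irr_char_def
    by (rule pm.quotient_trace_sum[OF B pm.subspace_single_0 subspace_specht finite_C linear_map_basis pres L, symmetric])
  also have "\<dots> = (if lam = mu then of_nat (card C) else 0)"
  proof (cases "lam = mu")
    case False
    have 0: "\<kappa> p = 0" if "p \<in> ?S" for p
    proof -
      have "\<kappa> p \<in> {0}"
      proof (rule linear_in_subspace[OF linear_antisymmetrizer pm.subspace_single_0])
        show "keys p \<subseteq> tabloids lam" using specht_subset that by blast
      qed (use \<kappa>_tabloid[OF lam _ w] False in \<open>auto simp: tabloids_def\<close>)
      then show ?thesis by simp
    qed
    have "quotient_trace pm_scale ?S {0} \<kappa> = (\<Sum>b\<in>B. 0)"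
      using 0 pm.quotient_basisD(2)[OF B] pm.subspace_0[OF subspace_specht]
      by (intro pm.quotient_trace_matrix[OF B _ subspace_specht linear_antisymmetrizer, where C = "\<lambda>_ _. 0"])
        (auto simp: antisymmetrizer.zero)
    then show ?thesis using False by simp
  next
    case True
    let ?e = "polytabloid mu t :: _ \<Rightarrow>\<^sub>0 'f"
    have e: "?e \<in> ?S" using t True by (auto simp: specht_module_def intro: pm.span_base)
    have "quotient_trace pm_scale ?S {0} \<kappa> = of_nat (card C)"
    proof (rule pm.trace_rank_one[OF subspace_specht _ _ e polytabloid_nonzero linear_antisymmetrizer])
      show "finite (unit_vector ` tabloids lam)" by (simp add: finite_tabloids)
      show "?S \<subseteq> pm.span (unit_vector ` tabloids lam)" using specht_subset by (simp add: span_unit_vectors)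
      show "\<kappa> ` ?S \<subseteq> pm.span {?e}"
      proof safe
        fix p assume "p \<in> ?S"
        then have k: "keys p \<subseteq> tabloids lam" using specht_subset by blast
        show "\<kappa> p \<in> pm.span {?e}"
        proof (rule linear_in_subspace[OF linear_antisymmetrizer pm.subspace_span _ k])
          fix x assume "x \<in> tabloids lam"
          then obtain s where "s \<in> tableaux lam" "x = tabloid lam s" by (auto simp: tabloids_def)
          then show "\<kappa> (unit_vector x) \<in> pm.span {?e}"
            using \<kappa>_tabloid[OF lam _ w, of s, where 'f = 'f] pm.span_zero by metis
        qed
      qed
      show "\<kappa> ?e = pm_scale (of_nat (card C)) ?e" unfolding polytabloid_eq by (rule \<kappa>_\<kappa>)
    qed
    then show ?thesis using True by simp
  qed
  finally show ?thesis .
qed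

end

text \<open>
  Among the shapes with nonzero coefficient let \<open>mu\<close> have the largest weight. The signed sum for \<open>mu\<close>
  then annihilates all other terms of the relation.
\<close>

lemma irr_chars_independent:
  fixes c :: "nat list \<Rightarrow> 'f::field_char_0"
  assumes 0: "\<And>\<sigma>. \<sigma> permutes {1..N} \<Longrightarrow> (\<Sum>lam | lam \<turnstile>\<^sub>p N. c lam * irr_char lam \<sigma>) = 0"
    and lam: "lam \<turnstile>\<^sub>p N"
  shows "c lam = 0"
proof (rule ccontr)
  assume "c lam \<noteq> 0"
  let ?A = "{lam. lam \<turnstile>\<^sub>p N \<and> c lam \<noteq> 0}"
  have A: "finite ?A" "?A \<noteq> {}"
    using finite_subset[OF _ finite_partitions[of N], of ?A] \<open>c lam \<noteq> 0\<close> lam by auto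
  then have "Max (row_weight ` ?A) \<in> row_weight ` ?A" by (intro Max_in) auto
  then obtain mu where mu: "mu \<in> ?A" "row_weight mu = Max (row_weight ` ?A)" by auto
  obtain t where t: "t \<in> tableaux mu" using ex_tableau by blast
  interpret tableau mu N t using mu(1) t by unfold_locales auto
  note mu_max = \<open>mu \<in> ?A\<close> \<open>row_weight mu = Max (row_weight ` ?A)\<close>
  have "0 = (\<Sum>\<pi>\<in>C. of_int (sign \<pi>) * (\<Sum>lam | lam \<turnstile>\<^sub>p N. c lam * irr_char lam \<pi>))"
    using 0 permutes by simp
  also have "\<dots> = (\<Sum>lam | lam \<turnstile>\<^sub>p N. c lam * (\<Sum>\<pi>\<in>C. of_int (sign \<pi>) * irr_char lam \<pi>))"
    by (simp add: sum_distrib_left mult.left_commute) (rule sum.swap)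
  also have "\<dots> = (\<Sum>lam | lam \<turnstile>\<^sub>p N. if lam = mu then c lam * of_nat (card C) else 0)"
  proof (intro sum.cong refl)
    fix lam assume l: "lam \<in> {lam. lam \<turnstile>\<^sub>p N}"
    show "c lam * (\<Sum>\<pi>\<in>C. of_int (sign \<pi>) * irr_char lam \<pi>) = (if lam = mu then c lam * of_nat (card C) else 0)"
    proof (cases "c lam = 0")
      case False
      then have "row_weight lam \<le> row_weight mu" unfolding mu_max(2) using A l by (intro Max_ge) auto
      then show ?thesis using l by (simp add: signed_sum_irr_char)
    qed auto
  qed
  also have "\<dots> = c mu * of_nat (card C)" using finite_partitions mu by simp
  finally show False using mu_max(1) finite_C id_in by (auto simp: card_eq_0_iff)
qed

text \<open>
  Linear independence is applied in the first factor, for fixed \<open>\<tau>\<close>, and then in the second.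
\<close>

lemma multiplicities_unique:
  fixes ch :: "(nat \<Rightarrow> nat) \<Rightarrow> (nat \<Rightarrow> nat) \<Rightarrow> 'f::field_char_0"
  assumes m: "multiplicities r k ch m" and m': "multiplicities r k ch m'"
    and "lam \<turnstile>\<^sub>p r" "mu \<turnstile>\<^sub>p k"
  shows "m lam mu = m' lam mu"
proof -
  let ?d = "\<lambda>lam mu. of_nat (m lam mu) - of_nat (m' lam mu) :: 'f"
  have "(\<Sum>mu | mu \<turnstile>\<^sub>p k. ?d lam mu * irr_char mu \<tau>) = 0" if \<tau>: "\<tau> permutes {1..k}" for \<tau>
  proof (rule irr_chars_independent[OF _ assms(3), where c = "\<lambda>lam. \<Sum>mu | mu \<turnstile>\<^sub>p k. ?d lam mu * irr_char mu \<tau>"])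
    fix \<sigma> assume \<sigma>: "\<sigma> permutes {1..r}"
    have "(\<Sum>lam | lam \<turnstile>\<^sub>p r. (\<Sum>mu | mu \<turnstile>\<^sub>p k. ?d lam mu * irr_char mu \<tau>) * irr_char lam \<sigma>)
      = (\<Sum>lam | lam \<turnstile>\<^sub>p r. \<Sum>mu | mu \<turnstile>\<^sub>p k. of_nat (m lam mu) * (irr_char lam \<sigma> * irr_char mu \<tau>))
       - (\<Sum>lam | lam \<turnstile>\<^sub>p r. \<Sum>mu | mu \<turnstile>\<^sub>p k. of_nat (m' lam mu) * (irr_char lam \<sigma> * irr_char mu \<tau>))"
      by (simp add: sum_distrib_right sum_distrib_left sum_subtractf[symmetric] algebra_simps)
    also have "\<dots> = ch \<sigma> \<tau> - ch \<sigma> \<tau>" using m m' \<sigma> \<tau> by (simp add: multiplicities_def)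
    finally show "(\<Sum>lam | lam \<turnstile>\<^sub>p r. (\<Sum>mu | mu \<turnstile>\<^sub>p k. ?d lam mu * irr_char mu \<tau>) * irr_char lam \<sigma>) = 0" by simp
  qed
  from irr_chars_independent[OF this assms(4)] have "?d lam mu = 0" .
  then show ?thesis by simp
qed

section \<open>The Boolean lattice\<close>

definition subset_space :: "nat set \<Rightarrow> nat \<Rightarrow> (nat set \<Rightarrow>\<^sub>0 'f::field) set" where
  "subset_space X k = {f. keys f \<subseteq> {A. A \<subseteq> X \<and> card A = k}}"

text \<open>
  If a set is read as the squarefree monomial in its elements, then \<open>down\<close> is the sum of all partial
  derivatives, and \<open>up X\<close> is multiplication by the sum of the variables in \<open>X\<close> modulo their squares.
\<close>

definition down :: "(nat set \<Rightarrow>\<^sub>0 'f::field) \<Rightarrow> (nat set \<Rightarrow>\<^sub>0 'f)" where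
  "down = linear_extension pm_scale (\<lambda>A. \<Sum>x\<in>A. unit_vector (A - {x}))"

definition up :: "nat set \<Rightarrow> (nat set \<Rightarrow>\<^sub>0 'f::field) \<Rightarrow> (nat set \<Rightarrow>\<^sub>0 'f)" where
  "up X = linear_extension pm_scale (\<lambda>A. \<Sum>x\<in>X - A. unit_vector (insert x A))"

global_interpretation down: Vector_Spaces.linear pm_scale pm_scale "down :: (nat set \<Rightarrow>\<^sub>0 'f::field) \<Rightarrow> _"
  unfolding down_def by (rule pm_linear_extension)

global_interpretation up: Vector_Spaces.linear pm_scale pm_scale "up X :: (nat set \<Rightarrow>\<^sub>0 'f::field) \<Rightarrow> _" for X
  unfolding up_def by (rule pm_linear_extension)

lemmas linear_down = down.linear_axioms
lemmas linear_up = up.linear_axioms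

lemma down_unit [simp]: "down (unit_vector A) = (\<Sum>x\<in>A. unit_vector (A - {x}))"
  by (simp add: down_def)

lemma up_unit [simp]: "up X (unit_vector A) = (\<Sum>x\<in>X - A. unit_vector (insert x A))"
  by (simp add: up_def)

lemma subspace_subset_space: "pm.subspace (subset_space X k)"
  unfolding subset_space_def by (rule subspace_keys)

lemma unit_in_subset_space [simp]: "unit_vector A \<in> subset_space X k \<longleftrightarrow> A \<subseteq> X \<and> card A = k"
  by (simp add: subset_space_def)

lemma linear_subset_spaceI:
  assumes "pm_linear f" "pm.subspace V" "\<And>A. A \<subseteq> X \<Longrightarrow> card A = k \<Longrightarrow> f (unit_vector A) \<in> V" "v \<in> subset_space X k"
  shows "f v \<in> V"
  by (rule linear_in_subspace[OF assms(1,2), where S = "{A. A \<subseteq> X \<and> card A = k}"])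
    (use assms(3,4) in \<open>auto simp: subset_space_def\<close>)

lemma down_subset_space:
  assumes X: "finite X" and v: "v \<in> subset_space X (Suc k)"
  shows "down v \<in> subset_space X k"
proof (rule linear_subset_spaceI[OF linear_down subspace_subset_space _ v])
  fix A assume A: "A \<subseteq> X" "card A = Suc k"
  then have "finite A" using X finite_subset by blast
  then show "down (unit_vector A) \<in> subset_space X k"
    using A by (auto intro!: pm.subspace_sum subspace_subset_space)
qed

lemma down_subset_space_0:
  assumes X: "finite X" and v: "v \<in> subset_space X 0"
  shows "down v = 0"
proof -
  have "down v \<in> {0}"
  proof (rule linear_subset_spaceI[OF linear_down pm.subspace_single_0 _ v])
    fix A assume A: "A \<subseteq> X" "card A = 0"
    then have "A = {}" using finite_subset[OF A(1) X] by simp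
    then show "down (unit_vector A) \<in> {0}" by simp
  qed
  then show ?thesis by simp
qed

lemma up_subset_space:
  assumes X: "finite X" and v: "v \<in> subset_space X k"
  shows "up X v \<in> subset_space X (Suc k)"
proof (rule linear_subset_spaceI[OF linear_up subspace_subset_space _ v])
  fix A assume A: "A \<subseteq> X" "card A = k"
  then have "finite A" using X finite_subset by blast
  then show "up X (unit_vector A) \<in> subset_space X (Suc k)"
    using A by (auto intro!: pm.subspace_sum subspace_subset_space)
qed

lemma subset_space_trivial:
  assumes X: "finite X" and k: "card X < k" and v: "v \<in> subset_space X k"
  shows "v = 0"
proof -
  have "\<not> (A \<subseteq> X \<and> card A = k)" for A using k card_mono[OF X, of A] by auto
  then have "keys v = {}" using v unfolding subset_space_def by blast
  then show ?thesis by simp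
qed

lemma sum_const_pm: "(\<Sum>x\<in>S. v) = pm_scale (of_nat (card S)) v"
proof -
  have "(\<Sum>x\<in>S. v) = (\<Sum>x\<in>S. pm_scale 1 v)" by simp
  also have "\<dots> = pm_scale (of_nat (card S)) v" by (simp only: pm.scale_sum_left[symmetric]) simp
  finally show ?thesis .
qed

text \<open>
  Removing and adding different elements commutes. What is left are the \<open>card (X - A)\<close> ways to add an
  element to \<open>A\<close> and take it away again, against the \<open>card A\<close> ways to do this in the opposite order.
  It is the commutation rule of the Lie algebra \<open>sl\<^sub>2\<close>.
\<close>

lemma down_up:
  fixes v :: "nat set \<Rightarrow>\<^sub>0 'f::field"
  assumes X: "finite X" and v: "v \<in> subset_space X k"
  shows "down (up X v) = up X (down v) + pm_scale (of_int (int (card X) - 2 * int k)) v"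
proof -
  let ?u = "unit_vector :: nat set \<Rightarrow> nat set \<Rightarrow>\<^sub>0 'f"
  have L: "pm_linear (\<lambda>v. down (up X v))" and 
    R: "pm_linear (\<lambda>v. up X (down v) + pm_scale (of_int (int (card X) - 2 * int k)) v)"
    unfolding Vector_Spaces.linear_iff
    by (simp_all add: vector_space_pm up.add up.scale down.add down.scale pm.scale_right_distrib mult.commute)
  show ?thesis
  proof (rule linear_eq_on_basis[OF L R, where S = "{A. A \<subseteq> X \<and> card A = k}"])
    show "keys v \<subseteq> {A. A \<subseteq> X \<and> card A = k}" using v by (simp add: subset_space_def)
    fix A assume "A \<in> {A. A \<subseteq> X \<and> card A = k}"
    then have A: "A \<subseteq> X" "card A = k" by auto
    have fin: "finite A" using A X finite_subset by blast
    let ?S = "\<Sum>y\<in>X - A. \<Sum>z\<in>A. ?u (insert y (A - {z}))"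
    have "down (up X (?u A)) = (\<Sum>y\<in>X - A. \<Sum>z\<in>insert y A. ?u (insert y A - {z}))"
      by (simp add: down.sum)
    also have "\<dots> = (\<Sum>y\<in>X - A. ?u A + (\<Sum>z\<in>A. ?u (insert y (A - {z}))))"
    proof (intro sum.cong refl)
      fix y assume y: "y \<in> X - A"
      have "(\<Sum>z\<in>A. ?u (insert y A - {z})) = (\<Sum>z\<in>A. ?u (insert y (A - {z})))"
        using y by (intro sum.cong refl arg_cong[of _ _ ?u]) auto
      then show "(\<Sum>z\<in>insert y A. ?u (insert y A - {z})) = ?u A + (\<Sum>z\<in>A. ?u (insert y (A - {z})))"
        using y fin by simp
    qed
    also have "\<dots> = pm_scale (of_nat (card (X - A))) (?u A) + ?S"
      by (simp only: sum.distrib sum_const_pm)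
    finally have 1: "down (up X (?u A)) = pm_scale (of_nat (card (X - A))) (?u A) + ?S" .
    have "up X (down (?u A)) = (\<Sum>z\<in>A. \<Sum>y\<in>X - (A - {z}). ?u (insert y (A - {z})))"
      by (simp add: up.sum)
    also have "\<dots> = (\<Sum>z\<in>A. ?u A + (\<Sum>y\<in>X - A. ?u (insert y (A - {z}))))"
    proof (intro sum.cong refl)
      fix z assume z: "z \<in> A"
      have "X - (A - {z}) = insert z (X - A)" "insert z (A - {z}) = A" using z A by auto
      then show "(\<Sum>y\<in>X - (A - {z}). ?u (insert y (A - {z}))) = ?u A + (\<Sum>y\<in>X - A. ?u (insert y (A - {z})))"
        using z X by simp
    qed
    also have "\<dots> = pm_scale (of_nat (card A)) (?u A) + ?S"
      by (simp only: sum.distrib sum_const_pm) (subst sum.swap, rule refl)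
    finally have 2: "up X (down (?u A)) = pm_scale (of_nat (card A)) (?u A) + ?S" .
    have 3: "of_nat (card (X - A)) = (of_nat (card A) + of_int (int (card X) - 2 * int k) :: 'f)"
      using A card_mono[OF X A(1)] by (simp add: card_Diff_subset[OF fin A(1)] of_nat_diff)
    show "down (up X (?u A)) = up X (down (?u A)) + pm_scale (of_int (int (card X) - 2 * int k)) (?u A)"
      unfolding 1 2 3 by (simp only: pm.scale_left_distrib ac_simps)
  qed
qed

lemma down_iterate:
  assumes X: "finite X" and v: "v \<in> subset_space X j" 
  shows "(m \<le> j \<longrightarrow> (down ^^ m) v \<in> subset_space X (j - m)) \<and> (j < m \<longrightarrow> (down ^^ m) v = 0)"
proof (induction m)
  case (Suc m)
  consider "Suc m \<le> j" | "m = j" | "j < m" by linarith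
  then show ?case
  proof cases
    case 1
    then have "(down ^^ m) v \<in> subset_space X (Suc (j - Suc m))" using Suc.IH by (simp add: Suc_diff_Suc)
    then show ?thesis using down_subset_space[OF X] 1 by simp
  next
    case 2
    then show ?thesis using Suc.IH down_subset_space_0[OF X] by simp
  next
    case 3
    then show ?thesis using Suc.IH by (simp add: down.zero)
  qed
qed (use v in auto)

lemma down_iterate_up:
  assumes X: "finite X" and v: "v \<in> subset_space X j"
  shows "(down ^^ Suc m) (up X v) = up X ((down ^^ Suc m) v)
    + pm_scale (of_int ((int m + 1) * (int (card X) - 2 * int j + int m))) ((down ^^ m) v)"
proof (induction m)
  case 0
  then show ?case using down_up[OF X v] by simp
next
  case (Suc m)
  let ?w = "(down ^^ Suc m) v" and ?N = "int (card X)"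
  have *: "down (up X ?w) = up X (down ?w) + pm_scale (of_int (?N - 2 * (int j - int m - 1))) ?w"
  proof (cases "Suc m \<le> j")
    case True
    then have "?w \<in> subset_space X (j - Suc m)" using down_iterate[OF X v] by blast
    from down_up[OF X this] True show ?thesis by (simp add: of_nat_diff)
  next
    case False
    then have "?w = 0" using down_iterate[OF X v, of "Suc m"] by simp
    then show ?thesis by (simp add: up.zero down.zero)
  qed
  have "(down ^^ Suc (Suc m)) (up X v) = down (up X ?w
      + pm_scale (of_int ((int m + 1) * (?N - 2 * int j + int m))) ((down ^^ m) v))"
    using Suc.IH by simp
  also have "\<dots> = up X (down ?w) + (pm_scale (of_int (?N - 2 * (int j - int m - 1))) ?w
      + pm_scale (of_int ((int m + 1) * (?N - 2 * int j + int m))) ?w)"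
    by (simp only: down.add down.scale * add.assoc) simp
  also have "pm_scale (of_int (?N - 2 * (int j - int m - 1))) ?w
      + pm_scale (of_int ((int m + 1) * (?N - 2 * int j + int m))) ?w
    = pm_scale (of_int ((int (Suc m) + 1) * (?N - 2 * int j + int (Suc m)))) ?w"
    unfolding pm.scale_left_distrib[symmetric] of_int_add[symmetric]
    by (rule arg_cong[of _ _ "\<lambda>z. pm_scale (of_int z) ?w"]) (simp add: algebra_simps)
  finally show ?case by simp
qed

text \<open>
  Induction on a power \<open>m\<close> of \<open>down\<close> that kills \<open>v\<close>: for a suitable \<open>\<alpha> \<noteq> 0\<close>, the next lower power kills
  \<open>down (up X v) - \<alpha> v\<close>, so this vector is in the image of \<open>down\<close>, and hence \<open>v\<close> is.
\<close>

lemma down_surjective: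
  fixes v :: "nat set \<Rightarrow>\<^sub>0 'f::field_char_0"
  assumes X: "finite X" and j: "2 * j < card X"
  shows "v \<in> subset_space X j \<Longrightarrow> v \<in> down ` subset_space X (Suc j)"
proof -
  have sub: "pm.subspace (down ` subset_space X (Suc j) :: (nat set \<Rightarrow>\<^sub>0 'f) set)"
    by (rule down.subspace_image[OF subspace_subset_space])
  have "(down ^^ m) v = 0 \<Longrightarrow> v \<in> subset_space X j \<Longrightarrow> v \<in> down ` subset_space X (Suc j)" for m and v :: "nat set \<Rightarrow>\<^sub>0 'f"
  proof (induction m arbitrary: v)
    case 0
    then show ?case using pm.subspace_0[OF sub] by simp
  next
    case (Suc m)
    \<comment> \<open>The scalar by which \<open>down (up X v)\<close> and \<open>v\<close> differ after \<open>m\<close> further steps down; it is positive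
      because \<open>2 j < card X\<close>.\<close>
    define \<alpha> :: 'f where "\<alpha> = of_int ((int m + 1) * (int (card X) - 2 * int j + int m))"
    have \<alpha>: "\<alpha> \<noteq> 0" using j unfolding \<alpha>_def of_int_eq_0_iff by auto
    have upv: "up X v \<in> subset_space X (Suc j)" using up_subset_space[OF X Suc.prems(2)] .
    let ?v = "down (up X v) - pm_scale \<alpha> v"
    have lin: "pm_linear ((down :: (nat set \<Rightarrow>\<^sub>0 'f) \<Rightarrow> _) ^^ m)"
    proof (induction m)
      case 0
      show ?case using pm.linear_id by (simp add: id_def)
    next
      case (Suc m)
      show ?case unfolding funpow.simps by (rule Vector_Spaces.linear_compose[OF Suc linear_down])
    qed
    interpret L: Vector_Spaces.linear pm_scale pm_scale "(down :: (nat set \<Rightarrow>\<^sub>0 'f) \<Rightarrow> _) ^^ m" by (rule lin)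
    have "(down ^^ m) ?v = (down ^^ Suc m) (up X v) - pm_scale \<alpha> ((down ^^ m) v)"
      by (simp add: L.diff L.scale funpow_swap1)
    also have "\<dots> = 0"
      using down_iterate_up[OF X Suc.prems(2), of m] Suc.prems(1) by (simp add: \<alpha>_def up.zero)
    finally have "(down ^^ m) ?v = 0" .
    moreover have "?v \<in> subset_space X j"
      by (intro pm.subspace_diff pm.subspace_scale subspace_subset_space down_subset_space[OF X upv] Suc.prems(2))
    ultimately have "?v \<in> down ` subset_space X (Suc j)" by (rule Suc.IH)
    then have "down (up X v) - ?v \<in> down ` subset_space X (Suc j)"
      by (rule pm.subspace_diff[OF sub imageI[OF upv]])
    then have "pm_scale \<alpha> v \<in> down ` subset_space X (Suc j)" by simp
    from pm.subspace_scale[OF sub this, of "inverse \<alpha>"] show ?case using \<alpha> by simp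
  qed
  then show "v \<in> subset_space X j \<Longrightarrow> v \<in> down ` subset_space X (Suc j)"
    using down_iterate[OF X, of v j "Suc j"] by blast
qed

text \<open>
  On the iterated images under \<open>up\<close> of a vector in the kernel, \<open>down\<close> inverts \<open>up\<close> up to scalars, which
  are negative integers here. So all these images are nonzero if the vector is, but there are no
  sets with more than \<open>card X\<close> elements.
\<close>

lemma down_injective:
  fixes v :: "nat set \<Rightarrow>\<^sub>0 'f::field_char_0"
  assumes X: "finite X" and k: "card X < 2 * k" and v: "v \<in> subset_space X k" and 0: "down v = 0"
  shows "v = 0"
proof -
  have mem: "(up X ^^ m) v \<in> subset_space X (k + m)" for m
    by (induction m) (use v up_subset_space[OF X] in auto)
  have step: "down ((up X ^^ Suc m) v) = pm_scale (of_int ((int m + 1) * (int (card X) - 2 * int k - int m))) ((up X ^^ m) v)" for m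
  proof (induction m)
    case 0
    show ?case using down_up[OF X v] \<open>down v = 0\<close> by (simp add: up.zero)
  next
    case (Suc m)
    let ?w = "(up X ^^ Suc m) v"
    have "down ((up X ^^ Suc (Suc m)) v) = up X (down ?w) + pm_scale (of_int (int (card X) - 2 * int (k + Suc m))) ?w"
      using down_up[OF X mem[of "Suc m"]] by simp
    also have "up X (down ?w) = pm_scale (of_int ((int m + 1) * (int (card X) - 2 * int k - int m))) ?w"
      unfolding Suc.IH up.scale by simp
    also have "\<dots> + pm_scale (of_int (int (card X) - 2 * int (k + Suc m))) ?w
       = pm_scale (of_int ((int (Suc m) + 1) * (int (card X) - 2 * int k - int (Suc m)))) ?w"
      unfolding pm.scale_left_distrib[symmetric] of_int_add[symmetric]
      by (rule arg_cong[of _ _ "\<lambda>z. pm_scale (of_int z) ?w"]) (simp add: algebra_simps)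
    finally show ?case .
  qed
  have "(up X ^^ m) v = 0 \<Longrightarrow> v = 0" for m
  proof (induction m)
    case (Suc m)
    have "pm_scale (of_int ((int m + 1) * (int (card X) - 2 * int k - int m)) :: 'f) ((up X ^^ m) v) = 0"
      using step[of m] Suc.prems by (simp add: down.zero)
    moreover have "(of_int ((int m + 1) * (int (card X) - 2 * int k - int m)) :: 'f) \<noteq> 0"
      unfolding of_int_eq_0_iff using k by auto
    ultimately show ?case using Suc.IH by (simp del: of_int_mult of_int_add of_int_diff)
  qed simp
  moreover have "(up X ^^ Suc (card X)) v = 0"
    by (rule subset_space_trivial[OF X _ mem]) simp
  ultimately show ?thesis by blast
qed


abbreviation mult_var :: "nat \<Rightarrow> (nat set \<Rightarrow>\<^sub>0 'f::field) \<Rightarrow> (nat set \<Rightarrow>\<^sub>0 'f)" where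
  "mult_var a \<equiv> map_basis (insert a)"

text \<open>
  In the language of monomials this is \<open>\<Prod>(x\<^sub>b - x\<^sub>a)\<close> over the pairs \<open>(a, b)\<close>. It is
  the polytabloid of a two-row tableau whose first columns are these pairs, if only the second
  row is recorded.
\<close>

fun pair_product :: "(nat \<times> nat) list \<Rightarrow> (nat set \<Rightarrow>\<^sub>0 'f::field)" where
  "pair_product [] = unit_vector {}"
| "pair_product ((a, b) # ps) = mult_var b (pair_product ps) - mult_var a (pair_product ps)"

definition entries :: "(nat \<times> nat) list \<Rightarrow> nat list" where
  "entries ps = map fst ps @ map snd ps"

lemma mult_var_subset_space:
  assumes X: "finite X" "a \<notin> X" and v: "v \<in> subset_space X k"
  shows "mult_var a v \<in> subset_space (insert a X) (Suc k)"
proof (rule linear_subset_spaceI[OF linear_map_basis subspace_subset_space _ v])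
  fix A assume A: "A \<subseteq> X" "card A = k"
  then have "finite A" "a \<notin> A" using X finite_subset by blast+
  then show "mult_var a (unit_vector A) \<in> subset_space (insert a X) (Suc k)"
    using A by auto
qed

lemma subset_space_mono: "X \<subseteq> X' \<Longrightarrow> subset_space X k \<subseteq> subset_space X' k"
  unfolding subset_space_def by blast

lemma pair_product_subset_space:
  "distinct (entries ps) \<Longrightarrow> (pair_product ps :: nat set \<Rightarrow>\<^sub>0 'f::field) \<in> subset_space (set (entries ps)) (length ps)"
proof (induction ps)
  case (Cons p ps)
  obtain a b where p: "p = (a, b)" by (cases p)
  have ab: "a \<notin> set (entries ps)" "b \<notin> set (entries ps)" "distinct (entries ps)" using Cons.prems by (auto simp: p entries_def)
  have "mult_var c (pair_product ps :: nat set \<Rightarrow>\<^sub>0 'f) \<in> subset_space (set (entries (p # ps))) (length (p # ps))" if "c \<in> {a, b}" for c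
  proof -
    have "mult_var c (pair_product ps :: nat set \<Rightarrow>\<^sub>0 'f) \<in> subset_space (insert c (set (entries ps))) (Suc (length ps))"
      using ab that by (intro mult_var_subset_space Cons.IH) auto
    moreover have "insert c (set (entries ps)) \<subseteq> set (entries (p # ps))" using that by (auto simp: p entries_def)
    ultimately show ?thesis using subset_space_mono by (metis length_Cons subsetD)
  qed
  then show ?case by (auto simp: p intro!: pm.subspace_diff[OF subspace_subset_space])
qed (simp add: entries_def)

text \<open>
  The product rule for the derivation \<open>down\<close>.
\<close>

lemma down_mult_var:
  assumes X: "finite X" "a \<notin> X" and v: "v \<in> subset_space X k"
  shows "down (mult_var a v) = v + mult_var a (down v)"
proof -
  have L: "pm_linear (\<lambda>v. down (mult_var a v))" "pm_linear (\<lambda>v. v + mult_var a (down v))"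
    unfolding Vector_Spaces.linear_iff
    by (simp_all add: vector_space_pm map_basis.add map_basis.scale down.add down.scale pm.scale_right_distrib)
  show ?thesis
  proof (rule linear_eq_on_basis[OF L, where S = "{A. A \<subseteq> X \<and> card A = k}"])
    show "keys v \<subseteq> {A. A \<subseteq> X \<and> card A = k}" using v by (simp add: subset_space_def)
    fix A assume A: "A \<in> {A. A \<subseteq> X \<and> card A = k}"
    have fin: "finite A" "a \<notin> A" using A X finite_subset by blast+
    have "(\<Sum>x\<in>A. unit_vector (insert a A - {x})) = (\<Sum>x\<in>A. mult_var a (unit_vector (A - {x})))"
      using fin by (intro sum.cong refl) (auto simp: insert_Diff_if)
    then show "down (mult_var a (unit_vector A)) = unit_vector A + mult_var a (down (unit_vector A))"
      using fin by (simp add: map_basis.sum)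
  qed
qed

lemma down_pair_product: "distinct (entries ps) \<Longrightarrow> down (pair_product ps) = (0 :: nat set \<Rightarrow>\<^sub>0 'f::field)"
proof (induction ps)
  case (Cons p ps)
  obtain a b where p: "p = (a, b)" by (cases p)
  have ab: "a \<notin> set (entries ps)" "b \<notin> set (entries ps)" "distinct (entries ps)" using Cons.prems by (auto simp: p entries_def)
  note mem = pair_product_subset_space[OF ab(3), where 'f = 'f]
  show ?case
    using Cons.IH[OF ab(3)] down_mult_var[OF _ ab(1) mem] down_mult_var[OF _ ab(2) mem]
    by (simp add: p down.diff map_basis.zero)
qed (simp add: down_def)

definition pair_products :: "nat set \<Rightarrow> nat \<Rightarrow> (nat set \<Rightarrow>\<^sub>0 'f::field) set" where
  "pair_products X k = pair_product ` {ps. length ps = k \<and> distinct (entries ps) \<and> set (entries ps) \<subseteq> X}"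

lemma pair_products_mono: "X \<subseteq> X' \<Longrightarrow> pair_products X k \<subseteq> pair_products X' k"
  unfolding pair_products_def by blast

text \<open>
  A squarefree polynomial has degree at most one in the variable \<open>x\<close>.
\<close>

lemma subset_space_split:
  fixes f :: "nat set \<Rightarrow>\<^sub>0 'f::field"
  assumes X: "finite X" "x \<notin> X" and f: "f \<in> subset_space (insert x X) (Suc k)"
  obtains g h where "g \<in> subset_space X (Suc k)" "h \<in> subset_space X k" "f = g + mult_var x h"
proof -
  let ?S = "(\<lambda>(g, h). g + mult_var x h) ` (subset_space X (Suc k) \<times> subset_space X k) :: (nat set \<Rightarrow>\<^sub>0 'f) set"
  have "pm.subspace ?S"
  proof (rule pm.subspaceI)
    show "0 \<in> ?S"
      by (rule image_eqI[of _ _ "(0, 0)"]) (auto simp: map_basis.zero pm.subspace_0 subspace_subset_space)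
    fix u assume "u \<in> ?S"
    then obtain g h where u: "g \<in> subset_space X (Suc k)" "h \<in> subset_space X k" "u = g + mult_var x h" by auto
    show "pm_scale c u \<in> ?S" for c
      by (rule image_eqI[of _ _ "(pm_scale c g, pm_scale c h)"])
        (auto simp: u map_basis.scale pm.scale_right_distrib intro!: pm.subspace_scale[OF subspace_subset_space])
    fix v assume "v \<in> ?S"
    then obtain g' h' where v: "g' \<in> subset_space X (Suc k)" "h' \<in> subset_space X k" "v = g' + mult_var x h'" by auto
    show "u + v \<in> ?S"
      by (rule image_eqI[of _ _ "(g + g', h + h')"])
        (auto simp: u v map_basis.add algebra_simps intro!: pm.subspace_add[OF subspace_subset_space])
  qed
  then have "f \<in> ?S"
  proof (rule linear_subset_spaceI[OF pm.linear_id[unfolded id_def] _ _ f])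
    fix A assume A: "A \<subseteq> insert x X" "card A = Suc k"
    have fin: "finite A" using A X finite_subset[OF A(1)] by simp
    show "unit_vector A \<in> ?S"
    proof (cases "x \<in> A")
      case True
      then show ?thesis
        using A X fin
        by (intro image_eqI[of _ _ "(0, unit_vector (A - {x}))"])
          (auto simp: insert_absorb pm.subspace_0[OF subspace_subset_space])
    next
      case False
      then show ?thesis
        using A by (intro image_eqI[of _ _ "(unit_vector A, 0)"])
          (auto simp: map_basis.zero pm.subspace_0[OF subspace_subset_space])
    qed
  qed
  then show thesis using that by auto
qed

lemma keys_disjoint_sum_0:
  fixes p q :: "'x \<Rightarrow>\<^sub>0 'f::field"
  assumes "keys p \<subseteq> S" "keys q \<subseteq> T" "S \<inter> T = {}" "p + q = 0"
  shows "p = 0" "q = 0"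
proof -
  have "q = - p" using assms(4) by (simp add: eq_neg_iff_add_eq_0 add.commute)
  then have "keys p = keys q" by simp
  with assms(1-3) have "keys p = {}" "keys q = {}" by blast+
  then show "p = 0" "q = 0" by simp_all
qed

lemma mult_var_eq_0:
  assumes X: "x \<notin> X" and v: "v \<in> subset_space X k" and 0: "mult_var x v = 0"
  shows "v = 0"
proof -
  have "v = map_basis (\<lambda>A. A - {x}) (mult_var x v)"
    unfolding map_basis_comp using X v
    by (intro map_basis_ident[symmetric]) (auto simp: subset_space_def)
  then show ?thesis using 0 by (simp add: map_basis_def linear_extension_def)
qed

text \<open>
  Induction on the set of variables. Write \<open>f = g + x h\<close> with a new variable \<open>x\<close>. Then \<open>h\<close> is in the
  kernel as well, hence a combination of products of \<open>k - 1\<close> pairs. Each of them leaves some old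
  variable \<open>z\<close> unused, as \<open>2 k \<le> card X + 1\<close>, and can be multiplied by \<open>x - z\<close> instead of \<open>x\<close>. Subtracting
  the result from \<open>f\<close> eliminates \<open>x\<close>, and the induction hypothesis applies, except when \<open>X\<close> has only
  \<open>2 k - 1\<close> elements; but then \<open>down\<close> is injective.
\<close>

lemma kernel_down_pair_products:
  assumes "finite X" "2 * k \<le> card X" "f \<in> subset_space X k" "down f = (0 :: nat set \<Rightarrow>\<^sub>0 'f::field_char_0)"
  shows "f \<in> pm.span (pair_products X k)"
  using assms
proof (induction X arbitrary: f k rule: finite_induct)
  have base: "f \<in> pm.span (pair_products X 0)" if "f \<in> subset_space X 0" "finite X" for f :: "nat set \<Rightarrow>\<^sub>0 'f" and X
  proof (rule linear_subset_spaceI[OF pm.linear_id[unfolded id_def] pm.subspace_span _ that(1)])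
    fix A assume "A \<subseteq> X" "card A = 0"
    then have "A = {}" using finite_subset[OF _ that(2)] by auto
    moreover have "pair_product [] \<in> (pair_products X 0 :: (nat set \<Rightarrow>\<^sub>0 'f) set)"
      unfolding pair_products_def by (intro imageI) (simp add: entries_def)
    ultimately show "unit_vector A \<in> pm.span (pair_products X 0 :: (nat set \<Rightarrow>\<^sub>0 'f) set)" by (simp add: pm.span_base)
  qed
  {
    case empty
    then show ?case using base by simp
  next
    case (insert x X)
    show ?case
    proof (cases k)
      case 0
      then show ?thesis using base insert by simp
    next
      case (Suc k')
      note f = insert.prems(2)[unfolded Suc]
      obtain g h where g: "g \<in> subset_space X (Suc k')" and h: "h \<in> subset_space X k'" and fgh: "f = g + mult_var x h"
        by (rule subset_space_split[OF insert.hyps f])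
      have "down h = 0"
      proof (cases k')
        case 0
        then show ?thesis using h down_subset_space_0[OF insert.hyps(1)] by simp
      next
        case k': (Suc k'')
        have dh: "down h \<in> subset_space X k''" using down_subset_space[OF insert.hyps(1)] h k' by simp
        have sum0: "(down g + h) + mult_var x (down h) = 0"
          using insert.prems(3) by (simp add: fgh down.add down_mult_var[OF insert.hyps h] add.assoc)
        have keys1: "keys (down g + h) \<subseteq> {A. x \<notin> A}"
        proof -
          have "down g + h \<in> subset_space X k'"
            using down_subset_space[OF insert.hyps(1) g] h by (intro pm.subspace_add[OF subspace_subset_space])
          then show ?thesis using insert.hyps(2) by (auto simp: subset_space_def)
        qed
        have keys2: "keys (mult_var x (down h)) \<subseteq> {A. x \<in> A}"
          using keys_map_basis[of "insert x" "down h"] by auto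
        have "mult_var x (down h) = 0" by (rule keys_disjoint_sum_0(2)[OF keys1 keys2 _ sum0]) auto
        then show ?thesis by (rule mult_var_eq_0[OF insert.hyps(2) dh])
      qed
      moreover have card: "2 * k' + 1 \<le> card X" using insert.prems(1) insert.hyps Suc by simp
      ultimately have hspan: "h \<in> pm.span (pair_products X k')"
        using insert.IH[OF _ h] by simp
      let ?PP = "pair_products (insert x X) (Suc k') :: (nat set \<Rightarrow>\<^sub>0 'f) set"
      \<comment> \<open>The part of \<open>f\<close> that contains \<open>x\<close> is matched by a combination \<open>q\<close> of pair products.\<close>
      let ?good = "\<lambda>h q. q \<in> pm.span ?PP \<and> q - mult_var x h \<in> subset_space X (Suc k')"
      have "\<exists>q. ?good h q"
        using hspan
      proof (induction rule: pm.span_induct_alt)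
        case base
        show ?case
          by (rule exI[of _ 0]) (simp add: pm.span_zero map_basis.zero pm.subspace_0[OF subspace_subset_space])
      next
        case (step c p h)
        then obtain ps where ps: "p = pair_product ps" "length ps = k'" "distinct (entries ps)" "set (entries ps) \<subseteq> X"
          by (auto simp: pair_products_def)
        have "card (set (entries ps)) = 2 * k'" using distinct_card[OF ps(3)] ps(2) by (simp add: entries_def)
        then have "set (entries ps) \<noteq> X" using card by auto
        then obtain z where z: "z \<in> X" "z \<notin> set (entries ps)" using ps(4) by blast
        have x: "x \<notin> set (entries ps)" "x \<noteq> z" using ps(4) insert.hyps z by auto
        let ?q = "pair_product ((z, x) # ps) :: nat set \<Rightarrow>\<^sub>0 'f"
        have "?q \<in> ?PP"
          unfolding pair_products_def using ps z x by (intro imageI) (auto simp: entries_def)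
        moreover have "?q - mult_var x p \<in> subset_space X (Suc k')"
        proof -
          have "insert z (set (entries ps)) \<subseteq> X" using z ps by auto
          then have "mult_var z p \<in> subset_space X (Suc k')"
            using mult_var_subset_space[OF _ z(2) pair_product_subset_space[OF ps(3)]] subset_space_mono ps(1,2) by blast
          moreover have "?q - mult_var x p = - mult_var z p" by (simp add: ps(1))
          ultimately show ?thesis using pm.subspace_neg[OF subspace_subset_space] by metis
        qed
        ultimately have q: "?good p ?q" by (simp add: pm.span_base)
        obtain q' where q': "?good h q'" using step by blast
        have eq: "pm_scale c ?q + q' - mult_var x (pm_scale c p + h)
            = pm_scale c (?q - mult_var x p) + (q' - mult_var x h)"
          by (simp only: map_basis.add map_basis.scale pm.scale_right_diff_distrib) (simp only: algebra_simps)
        have "?good (pm_scale c p + h) (pm_scale c ?q + q')"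
        proof
          show "pm_scale c ?q + q' \<in> pm.span ?PP"
            by (rule pm.span_add[OF pm.span_scale[OF conjunct1[OF q]] conjunct1[OF q']])
          show "pm_scale c ?q + q' - mult_var x (pm_scale c p + h) \<in> subset_space X (Suc k')"
            unfolding eq by (rule pm.subspace_add[OF subspace_subset_space 
              pm.subspace_scale[OF subspace_subset_space conjunct2[OF q]] conjunct2[OF q']])
        qed
        then show ?case by blast
      qed
      then obtain q where q: "q \<in> pm.span ?PP" "q - mult_var x h \<in> subset_space X (Suc k')" by blast
      have "down q = 0"
        using q(1)
      proof (rule pm.span_induct)
        show "pm.subspace {q. down q = (0 :: nat set \<Rightarrow>\<^sub>0 'f)}"
          by (rule down.subspace_kernel)
      qed (auto simp: pair_products_def down_pair_product)
      then have d: "down (f - q) = 0" using insert.prems(3) by (simp add: down.diff)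
      have "f - q = g - (q - mult_var x h)" by (simp add: fgh)
      then have mem: "f - q \<in> subset_space X (Suc k')"
        using g q(2) by (simp only: pm.subspace_diff[OF subspace_subset_space])
      have "f - q \<in> pm.span ?PP"
      proof (cases "2 * Suc k' \<le> card X")
        case True
        then have "f - q \<in> pm.span (pair_products X (Suc k'))" using insert.IH mem d by blast
        then show ?thesis using pm.span_mono[OF pair_products_mono[of X "insert x X"]] by blast
      next
        case False
        then have "f - q = 0" using down_injective[OF insert.hyps(1) _ mem d] by simp
        then show ?thesis by (simp add: pm.span_zero)
      qed
      then have "f - q + q \<in> pm.span ?PP" using q(1) by (rule pm.span_add)
      then show ?thesis using Suc by simp
    qed
  }
qed


section \<open>The Specht modules of two-row partitions\<close>

abbreviation act_set :: "(nat \<Rightarrow> nat) \<Rightarrow> nat set \<Rightarrow> nat set" where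
  "act_set \<pi> \<equiv> (`) \<pi>"

lemma down_act:
  assumes \<pi>: "inj \<pi>"
  shows "down (map_basis (act_set \<pi>) v) = map_basis (act_set \<pi>) (down v)"
proof (rule linear_eq_on_basis[OF linear_comp[OF linear_map_basis linear_down] linear_comp[OF linear_down linear_map_basis]
    _ subset_UNIV])
  fix A
  have "(\<Sum>x\<in>\<pi> ` A. unit_vector (\<pi> ` A - {x})) = (\<Sum>x\<in>A. unit_vector (\<pi> ` (A - {x})) :: nat set \<Rightarrow>\<^sub>0 'a)"
    using \<pi> by (subst sum.reindex) (auto simp: image_set_diff intro: inj_on_subset)
  then show "down (map_basis (act_set \<pi>) (unit_vector A)) = map_basis (act_set \<pi>) (down (unit_vector A) :: nat set \<Rightarrow>\<^sub>0 'a)"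
    by (simp add: map_basis.sum)
qed

lemma pair_product_act: "map_basis (act_set \<pi>) (pair_product ps) = pair_product (map (map_prod \<pi> \<pi>) ps)"
proof (induction ps)
  case (Cons p ps)
  obtain a b where p: "p = (a, b)" by (cases p)
  have *: "map_basis (act_set \<pi>) (mult_var c v) = mult_var (\<pi> c) (map_basis (act_set \<pi>) v)" for c and v :: "nat set \<Rightarrow>\<^sub>0 'a"
    by (simp add: map_basis_comp)
  show ?case using Cons.IH by (simp add: p map_basis.diff *)
qed simp

lemma pair_product_flip:
  "i < length ps \<Longrightarrow> pair_product (ps[i := prod.swap (ps ! i)]) = - pair_product ps"
proof (induction ps arbitrary: i)
  case (Cons p ps)
  obtain a b where p: "p = (a, b)" by (cases p)
  show ?case
  proof (cases i)
    case 0
    then show ?thesis by (simp add: p)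
  next
    case (Suc j)
    then show ?thesis using Cons by (simp add: p map_basis.neg)
  qed
qed simp

abbreviation two_row_tableau :: "nat list \<Rightarrow> nat list \<Rightarrow> nat \<times> nat \<Rightarrow> nat" where
  "two_row_tableau xs ys \<equiv> \<lambda>(i, j). if i = 0 then xs ! j else ys ! j"

lemma two_row_tableau:
  assumes "distinct (xs @ ys)" "set (xs @ ys) = {1..length xs + length ys}"
  shows "two_row_tableau xs ys \<in> tableaux [length xs, length ys]"
    and "tabloid [length xs, length ys] (two_row_tableau xs ys) = [set xs, set ys]"
proof -
  have boxes: "boxes [length xs, length ys] = {0} \<times> {..<length xs} \<union> {1} \<times> {..<length ys}"
    by (auto simp: boxes_def less_Suc_eq nth_Cons')
  have "bij_betw (two_row_tableau xs ys) (boxes [length xs, length ys]) {1..length xs + length ys}"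
    unfolding bij_betw_def
  proof
    have "two_row_tableau xs ys ` boxes [length xs, length ys] = (\<lambda>j. xs ! j) ` {..<length xs} \<union> (\<lambda>j. ys ! j) ` {..<length ys}"
      unfolding boxes image_Un by (intro arg_cong2[of _ _ _ _ "(\<union>)"]) (force simp: image_iff)+
    also have "\<dots> = set (xs @ ys)"
    proof -
      have "(\<lambda>j. zs ! j) ` {..<length zs} = set zs" for zs :: "nat list" by (auto simp: set_conv_nth)
      then show ?thesis by simp
    qed
    finally show "two_row_tableau xs ys ` boxes [length xs, length ys] = {1..length xs + length ys}"
      using assms(2) by simp
    show "inj_on (two_row_tableau xs ys) (boxes [length xs, length ys])"
      using assms(1) unfolding boxes
      by (auto simp: inj_on_def nth_eq_iff_index_eq) (metis IntI empty_iff nth_mem)+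
  qed
  then show "two_row_tableau xs ys \<in> tableaux [length xs, length ys]" by (simp add: tableaux_def)
  show "tabloid [length xs, length ys] (two_row_tableau xs ys) = [set xs, set ys]"
    by (auto simp: tabloid_def set_conv_nth)
qed

locale two_row =
  fixes N k :: nat
  assumes k: "1 \<le> k" "2 * k \<le> N"
begin

abbreviation "shape \<equiv> [N - k, k]"

lemma shape: "shape \<turnstile>\<^sub>p N" and sum_shape: "sum_list shape = N"
  using k by (auto simp: is_partition_def)

lemma tabloids_shape: "tabloids shape = (\<lambda>A. [{1..N} - A, A]) ` {A. A \<subseteq> {1..N} \<and> card A = k}"
proof (intro subset_antisym subsetI)
  fix T assume "T \<in> tabloids shape"
  then obtain t where t: "t \<in> tableaux shape" "T = tabloid shape t" by (auto simp: tabloids_def)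
  have len: "length T = 2" using length_tabloid[OF t(1)] t(2) by simp
  have T1: "T ! 1 = {x \<in> {1..N}. tab_row shape t x = 1}" and T0: "T ! 0 = {x \<in> {1..N}. tab_row shape t x = 0}"
    using tabloid_nth[OF t(1), of 1] tabloid_nth[OF t(1), of 0] t(2) sum_shape by auto
  have row: "tab_row shape t x = 0 \<or> tab_row shape t x = 1" if "x \<in> {1..N}" for x
    using tab_entry(1)[OF t(1), of x] that sum_shape by (auto simp: boxes_def less_Suc_eq)
  have "T ! 0 = {1..N} - T ! 1" unfolding T0 T1 using row by force
  moreover obtain a b where "T = [a, b]" using len by (auto simp: length_Suc_conv numeral_2_eq_2)
  ultimately have "T = [{1..N} - T ! 1, T ! 1]" by simp
  moreover have "card (T ! 1) = k" using card_tabloid_nth[OF t(1), of 1] t(2) by simp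
  moreover have "T ! 1 \<subseteq> {1..N}" unfolding T1 by blast
  ultimately show "T \<in> (\<lambda>A. [{1..N} - A, A]) ` {A. A \<subseteq> {1..N} \<and> card A = k}" by blast
next
  fix T assume "T \<in> (\<lambda>A. [{1..N} - A, A]) ` {A. A \<subseteq> {1..N} \<and> card A = k}"
  then obtain A where A: "A \<subseteq> {1..N}" "card A = k" "T = [{1..N} - A, A]" by auto
  have fin: "finite A" using A(1) finite_subset by blast
  define xs ys where "xs = sorted_list_of_set ({1..N} - A)" and "ys = sorted_list_of_set A"
  have xy: "set xs = {1..N} - A" "set ys = A" "distinct xs" "distinct ys" "length xs = N - k" "length ys = k"
    using A fin by (auto simp: xs_def ys_def card_Diff_subset)
  have "distinct (xs @ ys)" "set (xs @ ys) = {1..length xs + length ys}"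
    using xy A k by (auto simp: )
  note T = two_row_tableau[OF this, unfolded xy(5,6)]
  have "[set xs, set ys] \<in> tabloids shape"
    unfolding T(2)[symmetric] tabloids_def by (rule imageI[OF T(1)])
  then show "T \<in> tabloids shape" by (simp only: xy A(3))
qed

lemma column_pair:
  assumes t: "t \<in> tableaux shape" and x: "x \<in> {1..N}" and y: "y \<in> {1..N}"
    and col: "tab_col shape t x = tab_col shape t y" and ne: "x \<noteq> y"
  shows "\<exists>j<k. {x, y} = {t (0, j), t (1, j)}"
proof -
  note ex = tab_entry[OF t, of x, unfolded sum_shape, OF x] and ey = tab_entry[OF t, of y, unfolded sum_shape, OF y]
  have ne': "tab_row shape t x \<noteq> tab_row shape t y" using ex ey col ne by metis
  have rows: "tab_row shape t x < 2" "tab_row shape t y < 2" using ex(1) ey(1) by (auto simp: boxes_def)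
  consider "tab_row shape t x = 0" "tab_row shape t y = 1" | "tab_row shape t x = 1" "tab_row shape t y = 0"
    using ne' rows by linarith
  then show ?thesis
  proof cases
    case 1
    then have "tab_col shape t y < k" using ey(1) by (auto simp: boxes_def)
    then show ?thesis using 1 ex(2) ey(2) col by (intro exI[of _ "tab_col shape t y"]) auto
  next
    case 2
    then have "tab_col shape t x < k" using ex(1) by (auto simp: boxes_def)
    then show ?thesis using 2 ex(2) ey(2) col by (intro exI[of _ "tab_col shape t x"]) auto
  qed
qed

lemma second_column_entry:
  assumes j: "j < k"
  shows "(0, j) \<in> boxes shape" "(1, j) \<in> boxes shape"
  using k j by (auto simp: boxes_def)

lemma perm_group_action_sets:
  "t \<in> tableaux shape \<Longrightarrow> perm_group_action (column_stabilizer shape t) {1..N} act_set"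
  using perm_group_column_stabilizer[of t shape] sum_shape
  by (intro perm_group_action.intro perm_group_action_axioms.intro) (simp_all add: image_image)

text \<open>
  A tabloid of a two-row shape is determined by its second row. After this identification the
  Specht module becomes the following space.
\<close>

definition specht_subsets :: "(nat set \<Rightarrow>\<^sub>0 'f::field) set" where
  "specht_subsets = {f \<in> subset_space {1..N} k. down f = 0}"

lemma subspace_specht_subsets: "pm.subspace specht_subsets"
  unfolding pm.subspace_def specht_subsets_def
  by (auto simp: down.add down.scale down.zero intro: pm.subspace_0 pm.subspace_add pm.subspace_scale subspace_subset_space)

lemma act_snd: "T \<in> tabloids shape \<Longrightarrow> act_tabloid \<pi> T ! 1 = act_set \<pi> (T ! 1)"
  by (auto simp: tabloids_def length_tabloid)

lemma second_row_\<kappa>: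
  assumes p: "keys p \<subseteq> tabloids shape"
  shows "map_basis (\<lambda>T. T ! 1) (antisymmetrizer (column_stabilizer shape t) act_tabloid p)
    = antisymmetrizer (column_stabilizer shape t) act_set (map_basis (\<lambda>T. T ! 1) p)"
proof -
  show ?thesis
    unfolding antisymmetrizer_def map_basis.sum map_basis.scale map_basis_comp
  proof (rule sum.cong[OF refl])
    fix \<pi> assume "\<pi> \<in> column_stabilizer shape t"
    have "map_basis (\<lambda>T. act_tabloid \<pi> T ! 1) p = map_basis (\<lambda>T. act_set \<pi> (T ! 1)) p"
      by (rule map_basis_cong) (use p act_snd in blast)
    then show "pm_scale (of_int (sign \<pi>)) (map_basis (\<lambda>T. act_tabloid \<pi> T ! 1) p)
      = pm_scale (of_int (sign \<pi>)) (map_basis (\<lambda>T. act_set \<pi> (T ! 1)) p)" by simp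
  qed
qed

lemma down_\<kappa>: "down (antisymmetrizer (column_stabilizer shape t) act_set v)
    = antisymmetrizer (column_stabilizer shape t) act_set (down v)"
proof -
  have "inj \<pi>" if "\<pi> \<in> column_stabilizer shape t" for \<pi>
    using that permutes_inj by (auto simp: column_stabilizer_def)
  then show ?thesis
    unfolding antisymmetrizer_def down.sum down.scale by (intro sum.cong refl) (simp add: down_act)
qed

text \<open>
  The polytabloid is \<open>\<kappa>\<close> of the set \<open>A\<close> in the second row, and \<open>\<kappa>\<close> commutes with \<open>down\<close>. Once an element
  is removed from \<open>A\<close>, both entries of its column lie outside of the set, so their transposition
  fixes the set and \<open>\<kappa>\<close> kills it.
\<close>

lemma polytabloid_in_kernel:
  assumes t: "t \<in> tableaux shape"
  shows "map_basis (\<lambda>T. T ! 1) (polytabloid shape t :: _ \<Rightarrow>\<^sub>0 'f::field_char_0) \<in> specht_subsets"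
proof -
  interpret C: perm_group_action "column_stabilizer shape t" "{1..N}" act_set
    by (rule perm_group_action_sets[OF t])
  have T: "tabloid shape t \<in> tabloids shape" using t by (auto simp: tabloids_def)
  then obtain A where A: "A \<subseteq> {1..N}" "card A = k" "tabloid shape t ! 1 = A" by (auto simp: tabloids_shape)
  have A': "A = (\<lambda>j. t (1, j)) ` {..<k}" using A(3) by (auto simp: tabloid_def)
  have eq: "map_basis (\<lambda>T. T ! 1) (polytabloid shape t :: _ \<Rightarrow>\<^sub>0 'f) = C.\<kappa> (unit_vector A)"
    unfolding polytabloid_eq using second_row_\<kappa>[of "unit_vector (tabloid shape t) :: _ \<Rightarrow>\<^sub>0 'f"] T A(3) by simp
  have "C.\<kappa> (unit_vector (A - {x}) :: _ \<Rightarrow>\<^sub>0 'f) = 0" if x: "x \<in> A" for x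
  proof -
    obtain j where j: "j < k" "x = t (1, j)" using x A' by auto
    note b = second_column_entry[OF j(1)]
    let ?y = "t (0, j)"
    have cx: "tab_col shape t x = tab_col shape t ?y" using tab_box(3)[OF t b(1)] tab_box(3)[OF t b(2)] j(2) by simp
    have y: "?y \<notin> A"
    proof
      assume "?y \<in> A"
      then have "tab_row shape t ?y = 1" using tabloid_nth[OF t, of 1] A(3) by auto
      then show False using tab_box(2)[OF t b(1)] by simp
    qed
    have ne: "x \<noteq> ?y" using x y by auto
    have "Transposition.transpose x ?y \<in> column_stabilizer shape t"
      by (rule transpose_in_column_stabilizer[OF t _ _ cx]) (use tab_box(1)[OF t b(1)] tab_box(1)[OF t b(2)] j(2) in auto)
    moreover have "act_set (Transposition.transpose x ?y) (A - {x}) = A - {x}"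
      using y by (intro transpose_image_eq) auto
    ultimately show ?thesis by (intro C.\<kappa>_eq_0) (use ne in auto)
  qed
  then have "down (C.\<kappa> (unit_vector A :: _ \<Rightarrow>\<^sub>0 'f)) = 0"
    unfolding down_\<kappa> by (simp add: antisymmetrizer.sum)
  moreover have "C.\<kappa> (unit_vector A :: _ \<Rightarrow>\<^sub>0 'f) \<in> subset_space {1..N} k"
    unfolding antisymmetrizer_def
  proof (intro pm.subspace_sum pm.subspace_scale subspace_subset_space)
    fix \<pi> assume "\<pi> \<in> column_stabilizer shape t"
    then have p: "\<pi> permutes {1..N}" using C.permutes by blast
    have "\<pi> ` A \<subseteq> {1..N}" using A(1) permutes_image[OF p] by blast
    moreover have "card (\<pi> ` A) = k" using A(2) permutes_inj[OF p] by (simp add: card_image inj_on_subset)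
    ultimately show "map_basis (act_set \<pi>) (unit_vector A) \<in> subset_space {1..N} k" by simp
  qed
  ultimately show ?thesis unfolding eq specht_subsets_def by simp
qed

lemma pair_product_transpose:
  assumes d: "distinct (entries ps)" and j: "j < length ps" and ps: "ps ! j = (a, b)"
  shows "map_basis (act_set (Transposition.transpose a b)) (pair_product ps) = - pair_product ps"
proof -
  have "map (map_prod (Transposition.transpose a b) (Transposition.transpose a b)) ps = ps[j := prod.swap (ps ! j)]"
  proof (rule nth_equalityI)
    fix i assume "i < length (map (map_prod (Transposition.transpose a b) (Transposition.transpose a b)) ps)"
    then have i: "i < length ps" by simp
    obtain c e where ce: "ps ! i = (c, e)" by (cases "ps ! i")
    show "map (map_prod (Transposition.transpose a b) (Transposition.transpose a b)) ps ! i = ps[j := prod.swap (ps ! j)] ! i"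
    proof (cases "i = j")
      case True
      then show ?thesis using i ps by simp
    next
      case False
      have D: "distinct (map fst ps)" "distinct (map snd ps)" "fst ` set ps \<inter> snd ` set ps = {}" using d by (auto simp: entries_def)
      have "c \<noteq> a" using nth_eq_iff_index_eq[OF D(1), of i j] i j False ce ps by auto
      moreover have "e \<noteq> b" using nth_eq_iff_index_eq[OF D(2), of i j] i j False ce ps by auto
      moreover have "(c, e) \<in> set ps" "(a, b) \<in> set ps" using i j ce ps by (metis nth_mem)+
      then have "c \<noteq> b" "e \<noteq> a" using D(3) by force+
      ultimately show ?thesis using i ce False by simp
    qed
  qed simp
  then show ?thesis using pair_product_flip[OF j] by (simp add: pair_product_act)
qed

text \<open>
  The columns have at most two entries, so the column stabilizer consists of products of swaps of
  pairs. Peeling off one swap reduces the number of points that \<open>\<pi>\<close> moves, and changes both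
  sides by a sign.
\<close>

lemma pair_product_sign:
  fixes ps :: "(nat \<times> nat) list"
  assumes t: "t \<in> tableaux shape" and d: "distinct (entries ps)" and len: "length ps = k"
    and tps: "\<And>j. j < k \<Longrightarrow> ps ! j = (t (0, j), t (1, j))"
    and \<pi>: "\<pi> \<in> column_stabilizer shape t"
  shows "map_basis (act_set \<pi>) (pair_product ps) = pm_scale (of_int (sign \<pi>)) (pair_product ps :: _ \<Rightarrow>\<^sub>0 'f::field_char_0)"
proof -
  interpret C: perm_group "column_stabilizer shape t" "{1..N}"
    using perm_group_column_stabilizer[OF t] sum_shape by simp
  show ?thesis using \<pi>
  proof (induction "card {x \<in> {1..N}. \<pi> x \<noteq> x}" arbitrary: \<pi> rule: less_induct)
    case less
    note p = C.permutes[OF less.prems]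
    show ?case
    proof (cases "\<exists>x\<in>{1..N}. \<pi> x \<noteq> x")
      case False
      then have "\<pi> = id" using permutes_not_in[OF p] by fastforce
      then show ?thesis by (simp add: sign_id map_basis_ident)
    next
      case True
      then obtain x where x: "x \<in> {1..N}" "\<pi> x \<noteq> x" by blast
      let ?y = "\<pi> x" and ?\<tau> = "Transposition.transpose x (\<pi> x)"
      have y: "?y \<in> {1..N}" "\<pi> ?y \<in> {1..N}" using x(1) permutes_in_image[OF p] by blast+
      have col: "tab_col shape t (\<pi> z) = tab_col shape t z" if "z \<in> {1..N}" for z
        using less.prems that column_stabilizer_eq[OF t] sum_shape by auto
      obtain j where j: "j < k" "{x, ?y} = {t (0, j), t (1, j)}"
        using column_pair[OF t x(1) y(1) col[OF x(1), symmetric]] x(2) by metis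
      have \<tau>: "?\<tau> \<in> column_stabilizer shape t"
        using transpose_in_column_stabilizer[OF t] x(1) y(1) col[OF x(1)] sum_shape by simp
      have neg: "map_basis (act_set ?\<tau>) (pair_product ps) = - (pair_product ps :: _ \<Rightarrow>\<^sub>0 'f)"
      proof -
        have "?\<tau> = Transposition.transpose (t (0, j)) (t (1, j))"
          using j(2) by (auto simp: doubleton_eq_iff transpose_commute)
        then show ?thesis using pair_product_transpose[OF d _ tps[OF j(1)]] j(1) len by simp
      qed
      define \<pi>' where "\<pi>' = ?\<tau> \<circ> \<pi>"
      have \<pi>'C: "\<pi>' \<in> column_stabilizer shape t" unfolding \<pi>'_def by (rule C.comp_in[OF \<tau> less.prems])
      have \<pi>: "\<pi> = ?\<tau> \<circ> \<pi>'" by (simp add: \<pi>'_def fun_eq_iff)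
      \<comment> \<open>The column of \<open>x\<close> has no third entry, so \<open>\<pi>\<close> swaps \<open>x\<close> with its image.\<close>
      have yx: "\<pi> ?y = x"
      proof (rule ccontr)
        assume ne: "\<pi> ?y \<noteq> x"
        have "\<pi> ?y \<noteq> ?y" using x(2) permutes_inj[OF p] by (auto simp: inj_eq)
        moreover have "tab_col shape t (\<pi> ?y) = tab_col shape t x" using col[OF y(1)] col[OF x(1)] by simp
        then obtain i where i: "i < k" "{\<pi> ?y, x} = {t (0, i), t (1, i)}"
          using column_pair[OF t y(2) x(1)] ne by blast
        have "tab_col shape t x = i"
          using i(2) tab_box(3)[OF t second_column_entry(1)[OF i(1)]] tab_box(3)[OF t second_column_entry(2)[OF i(1)]] by (auto simp: doubleton_eq_iff)
        moreover have "tab_col shape t x = j"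
          using j(2) tab_box(3)[OF t second_column_entry(1)[OF j(1)]] tab_box(3)[OF t second_column_entry(2)[OF j(1)]] by (auto simp: doubleton_eq_iff)
        ultimately show False using i(2) j(2) x(2) by (auto simp: doubleton_eq_iff)
      qed
      have "{z \<in> {1..N}. \<pi>' z \<noteq> z} \<subset> {z \<in> {1..N}. \<pi> z \<noteq> z}"
      proof
        show "{z \<in> {1..N}. \<pi>' z \<noteq> z} \<subseteq> {z \<in> {1..N}. \<pi> z \<noteq> z}"
          using x(2) yx by (auto simp: \<pi>'_def Transposition.transpose_def split: if_splits)
        have "\<pi>' x = x" by (simp add: \<pi>'_def)
        then show "{z \<in> {1..N}. \<pi>' z \<noteq> z} \<noteq> {z \<in> {1..N}. \<pi> z \<noteq> z}" using x by blast
      qed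
      then have "card {z \<in> {1..N}. \<pi>' z \<noteq> z} < card {z \<in> {1..N}. \<pi> z \<noteq> z}"
        by (intro psubset_card_mono) auto
      from less.hyps[OF this \<pi>'C]
      have IH: "map_basis (act_set \<pi>') (pair_product ps) = pm_scale (of_int (sign \<pi>')) (pair_product ps :: _ \<Rightarrow>\<^sub>0 'f)" .
      have "map_basis (act_set \<pi>) (pair_product ps :: _ \<Rightarrow>\<^sub>0 'f) = map_basis (act_set ?\<tau>) (map_basis (act_set \<pi>') (pair_product ps))"
        by (simp add: map_basis_comp image_image \<pi>'_def)
      also have "\<dots> = pm_scale (of_int (sign \<pi>')) (- pair_product ps)" by (simp only: IH map_basis.scale neg)
      also have "sign \<pi>' = - sign \<pi>"
        unfolding \<pi>'_def C.sign_comp[OF \<tau> less.prems] using x(2) by (simp add: sign_swap_id)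
      finally show ?thesis by simp
    qed
  qed
qed

text \<open>
  By its behaviour under the column stabilizer, a pair product is a multiple of its own image
  under \<open>\<kappa>\<close>, and \<open>\<kappa>\<close> maps everything to multiples of the polytabloid.
\<close>

lemma pair_product_in_image:
  assumes pp: "v \<in> pair_products {1..N} k"
  shows "v \<in> map_basis (\<lambda>T. T ! 1) ` (specht_module shape :: (_ \<Rightarrow>\<^sub>0 'f::field_char_0) set)"
proof -
  obtain ps where ps: "v = pair_product ps" "length ps = k" "distinct (entries ps)" "set (entries ps) \<subseteq> {1..N}"
    using pp by (auto simp: pair_products_def)
  \<comment> \<open>The first row lists the first components of the pairs, then all unused entries.\<close>
  define ds where "ds = sorted_list_of_set ({1..N} - set (entries ps))"
  define xs ys where "xs = map fst ps @ ds" and "ys = map snd ps"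
  have ds: "set ds = {1..N} - set (entries ps)" "distinct ds" by (simp_all add: ds_def)
  have set: "set (xs @ ys) = {1..N}" using ds ps(4) by (auto simp: xs_def ys_def entries_def)
  have dist: "distinct (xs @ ys)" using ds ps(3) by (auto simp: xs_def ys_def entries_def)
  have "length (xs @ ys) = N" using distinct_card[OF dist] set by simp
  then have len: "length ys = k" "length xs = N - k" "length xs + length ys = N" using ps(2) by (auto simp: ys_def)
  define t where "t = two_row_tableau xs ys"
  have t: "t \<in> tableaux shape" using two_row_tableau(1)[OF dist] set len by (simp add: t_def)
  have tps: "ps ! j = (t (0, j), t (1, j))" if "j < k" for j
    using that ps(2) by (simp add: t_def xs_def ys_def nth_append)
  interpret T: tableau shape N t using shape t by unfold_locales
  interpret C: perm_group_action "column_stabilizer shape t" "{1..N}" act_set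
    by (rule perm_group_action_sets[OF t])
  let ?S = "map_basis (\<lambda>A. [{1..N} - A, A]) :: _ \<Rightarrow> _ \<Rightarrow>\<^sub>0 'f" and ?R = "map_basis (\<lambda>T. T ! 1) :: (nat set list \<Rightarrow>\<^sub>0 'f) \<Rightarrow> _"
  have v: "v \<in> subset_space {1..N} k"
    using pair_product_subset_space[OF ps(3)] subset_space_mono[OF ps(4)] ps(1,2) by blast
  have keysS: "keys (?S v) \<subseteq> tabloids shape"
  proof -
    have "keys v \<subseteq> {A. A \<subseteq> {1..N} \<and> card A = k}" using v by (simp only: subset_space_def mem_Collect_eq)
    from order_trans[OF keys_map_basis image_mono[OF this]] show ?thesis unfolding tabloids_shape .
  qed
  have "T.\<kappa> (?S v) \<in> pm.span {polytabloid shape t}"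
  proof (rule linear_in_subspace[OF linear_antisymmetrizer pm.subspace_span _ keysS])
    fix T assume "T \<in> tabloids shape"
    then obtain s where s: "s \<in> tableaux shape" "T = tabloid shape s" by (auto simp: tabloids_def)
    from T.\<kappa>_tabloid[OF shape s(1) order_refl, where 'f = 'f]
    show "T.\<kappa> (unit_vector T) \<in> pm.span {polytabloid shape t :: _ \<Rightarrow>\<^sub>0 'f}"
      unfolding s(2) by (elim disjE conjE) (simp_all only: pm.span_zero)
  qed
  also have "\<dots> \<subseteq> specht_module shape"
    unfolding specht_module_def using t by (intro pm.span_mono) auto
  finally have mem: "T.\<kappa> (?S v) \<in> specht_module shape" .
  have "?R (T.\<kappa> (?S v)) = C.\<kappa> (?R (?S v))" by (rule second_row_\<kappa>[OF keysS])
  also have "?R (?S v) = v" unfolding map_basis_comp by (rule map_basis_ident) simp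
  also have "C.\<kappa> v = pm_scale (of_nat (card (column_stabilizer shape t))) v"
    unfolding ps(1) by (rule C.\<kappa>_semi_invariant) (rule pair_product_sign[OF t ps(3,2) tps])
  finally have eq: "?R (T.\<kappa> (?S v)) = pm_scale (of_nat (card (column_stabilizer shape t))) v" .
  have "card (column_stabilizer shape t) \<noteq> 0" using T.finite_C T.id_in by auto
  then have "v = ?R (pm_scale (inverse (of_nat (card (column_stabilizer shape t)))) (T.\<kappa> (?S v)))"
    unfolding map_basis.scale eq by simp
  then show ?thesis using pm.subspace_scale[OF subspace_specht mem] by blast
qed

lemma specht_image: "map_basis (\<lambda>T. T ! 1) ` specht_module shape = (specht_subsets :: (_ \<Rightarrow>\<^sub>0 'f::field_char_0) set)"
proof -
  let ?R = "map_basis (\<lambda>T. T ! 1) :: (nat set list \<Rightarrow>\<^sub>0 'f) \<Rightarrow> _"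
  show ?thesis
  proof (intro subset_antisym subsetI)
    fix v assume "v \<in> ?R ` specht_module shape"
    moreover have "pm.span (?R ` polytabloid shape ` tableaux shape) \<subseteq> specht_subsets"
      using polytabloid_in_kernel by (intro pm.span_minimal[OF _ subspace_specht_subsets]) auto
    ultimately show "v \<in> specht_subsets"
      unfolding specht_module_def map_basis.span_image[symmetric] by blast
  next
    fix v :: "nat set \<Rightarrow>\<^sub>0 'f" assume "v \<in> specht_subsets"
    then have "v \<in> pm.span (pair_products {1..N} k)"
      using k by (intro kernel_down_pair_products) (auto simp: specht_subsets_def)
    also have "\<dots> \<subseteq> ?R ` specht_module shape"
      using pair_product_in_image by (intro pm.span_minimal map_basis.subspace_image subspace_specht) blast
    finally show "v \<in> ?R ` specht_module shape" .
  qed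
qed


lemma irr_char_two_row:
  assumes \<sigma>: "\<sigma> permutes {1..N}"
  shows "irr_char shape \<sigma> = quotient_trace pm_scale specht_subsets {0 :: _ \<Rightarrow>\<^sub>0 'f::field_char_0} (map_basis (act_set \<sigma>))"
proof -
  let ?R = "map_basis (\<lambda>T. T ! 1) :: (nat set list \<Rightarrow>\<^sub>0 'f) \<Rightarrow> _"
  have inj: "v = map_basis (\<lambda>A. [{1..N} - A, A]) (?R v)" if "v \<in> specht_module shape" for v
  proof -
    have "keys v \<subseteq> tabloids shape" using that specht_subset by blast
    then show ?thesis unfolding map_basis_comp
      by (intro map_basis_ident[symmetric]) (auto simp: tabloids_shape)
  qed
  have fin: "finite {A. A \<subseteq> {1..N} \<and> card A = k}" by simp
  have "(specht_subsets :: (_ \<Rightarrow>\<^sub>0 'f) set) \<subseteq> {p. keys p \<subseteq> {A. A \<subseteq> {1..N} \<and> card A = k}}"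
    by (auto simp: specht_subsets_def subset_space_def)
  then obtain B where B: "quotient_basis pm_scale (specht_subsets :: (_ \<Rightarrow>\<^sub>0 'f) set) {0} B"
    by (rule ex_quotient_basis_pm[OF fin subspace_specht_subsets])
  show ?thesis
    unfolding irr_char_def
  proof (rule quotient_trace_transfer[OF linear_map_basis _ specht_image pm.subspace_single_0 subspace_specht pm.subspace_single_0
      subspace_specht_subsets _ B
      linear_map_basis _ linear_map_basis])
    show "?R v \<in> {0} \<longleftrightarrow> v \<in> {0}" if "v \<in> specht_module shape" for v
      using inj[OF that] by auto
    show "map_basis (act_tabloid \<sigma>) ` specht_module shape \<subseteq> specht_module shape"
      using act_specht[of \<sigma> shape] \<sigma> sum_shape by simp
    show "?R (map_basis (act_tabloid \<sigma>) v) = map_basis (act_set \<sigma>) (?R v)" if "v \<in> specht_module shape" for v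
    proof -
      have "keys v \<subseteq> tabloids shape" using that specht_subset by blast
      then show ?thesis unfolding map_basis_comp using act_snd by (intro map_basis_cong) blast
    qed
  qed (auto simp: map_basis.zero pm.subspace_0[OF subspace_specht])
qed

end

definition fixed_subsets :: "nat \<Rightarrow> nat \<Rightarrow> (nat \<Rightarrow> nat) \<Rightarrow> nat set set" where
  "fixed_subsets N k \<sigma> = {A. A \<subseteq> {1..N} \<and> card A = k \<and> \<sigma> ` A = A}"

lemma act_subset_space:
  assumes \<sigma>: "\<sigma> permutes {1..N}"
  shows "map_basis (act_set \<sigma>) ` subset_space {1..N} k \<subseteq> subset_space {1..N} k"
proof safe
  fix v :: "nat set \<Rightarrow>\<^sub>0 'a" assume v: "v \<in> subset_space {1..N} k"
  show "map_basis (act_set \<sigma>) v \<in> subset_space {1..N} k"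
  proof (rule linear_subset_spaceI[OF linear_map_basis subspace_subset_space _ v])
    fix A assume A: "A \<subseteq> {1..N}" "card A = k"
    have "\<sigma> ` A \<subseteq> {1..N}" using A(1) permutes_image[OF \<sigma>] by blast
    moreover have "card (\<sigma> ` A) = k" using A(2) card_image[OF inj_on_subset[OF permutes_inj[OF \<sigma>] subset_UNIV]] by simp
    ultimately show "map_basis (act_set \<sigma>) (unit_vector A) \<in> subset_space {1..N} k" by simp
  qed
qed

lemma trace_subset_space:
  assumes \<sigma>: "\<sigma> permutes {1..N}"
  shows "quotient_trace pm_scale (subset_space {1..N} k :: (_ \<Rightarrow>\<^sub>0 'f::field) set) {0} (map_basis (act_set \<sigma>))
    = of_nat (card (fixed_subsets N k \<sigma>))"
proof -
  have "act_set \<sigma> ` {A. A \<subseteq> {1..N} \<and> card A = k} \<subseteq> {A. A \<subseteq> {1..N} \<and> card A = k}"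
    using permutes_image[OF \<sigma>] card_image[OF inj_on_subset[OF permutes_inj[OF \<sigma>] subset_UNIV]] by auto
  then show ?thesis
    unfolding subset_space_def
    by (subst trace_permutation_module) (auto simp: fixed_subsets_def intro!: arg_cong[of _ _ card])
qed

text \<open>
  The \<open>k\<close>-subsets modulo the kernel of \<open>down\<close>, which is the Specht module, are isomorphic to the
  \<open>(k - 1)\<close>-subsets, and traces are additive.
\<close>

lemma fixed_subsets_step:
  assumes k: "1 \<le> k" "2 * k \<le> N" and \<sigma>: "\<sigma> permutes {1..N}"
  shows "of_nat (card (fixed_subsets N k \<sigma>))
    = of_nat (card (fixed_subsets N (k - 1) \<sigma>)) + (irr_char [N - k, k] \<sigma> :: 'f::field_char_0)"
proof -
  interpret two_row N k using k by unfold_locales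
  let ?M = "\<lambda>k. subset_space {1..N} k :: (nat set \<Rightarrow>\<^sub>0 'f) set" and ?f = "map_basis (act_set \<sigma>) :: _ \<Rightarrow> (nat set \<Rightarrow>\<^sub>0 'f)"
  let ?S = "specht_subsets :: (nat set \<Rightarrow>\<^sub>0 'f) set"
  have k': "k = Suc (k - 1)" using k by simp
  have inj: "inj \<sigma>" using permutes_inj[OF \<sigma>] .
  have im: "down ` ?M k = ?M (k - 1)"
  proof (intro subset_antisym subsetI)
    show "v \<in> ?M (k - 1)" if "v \<in> down ` ?M k" for v
      using that down_subset_space[of "{1..N}" _ "k - 1"] k' by auto
    show "v \<in> down ` ?M k" if "v \<in> ?M (k - 1)" for v
      using that down_surjective[of "{1..N}" "k - 1" v] k k' by auto
  qed
  note subS = subspace_specht_subsets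
  have SM: "?S \<subseteq> ?M k" by (auto simp: specht_subsets_def)
  have fM: "?f ` ?M j \<subseteq> ?M j" for j by (rule act_subset_space[OF \<sigma>])
  have fd: "down (?f v) = ?f (down v)" for v by (rule down_act[OF inj])
  have fS: "?f ` ?S \<subseteq> ?S"
  proof safe
    fix v assume "v \<in> ?S"
    then have v: "v \<in> ?M k" "down v = 0" by (auto simp: specht_subsets_def)
    then show "?f v \<in> ?S" using fM[of k] fd by (auto simp: specht_subsets_def map_basis.zero)
  qed
  have fin: "finite {A. A \<subseteq> {1..N} \<and> card A = j}" for j by simp
  have B1: "quotient_basis pm_scale (?M (k - 1)) {0} (unit_vector ` {A. A \<subseteq> {1..N} \<and> card A = k - 1})"
    unfolding subset_space_def by (rule quotient_basis_unit_vectors[OF fin])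
  have ker: "down v \<in> {0} \<longleftrightarrow> v \<in> ?S" if "v \<in> ?M k" for v
    using that by (simp add: specht_subsets_def)
  obtain B2 where B2: "quotient_basis pm_scale (?M k) ?S B2"
    by (rule quotient_basis_transfer[OF linear_down ker im subspace_subset_space pm.subspace_single_0 B1])
  obtain B3 where B3: "quotient_basis pm_scale ?S {0} B3"
    by (rule ex_quotient_basis_pm[OF fin subS, of k]) (use SM in \<open>auto simp: subset_space_def\<close>)
  have "of_nat (card (fixed_subsets N k \<sigma>)) = quotient_trace pm_scale (?M k) {0} ?f"
    by (rule trace_subset_space[OF \<sigma>, symmetric])
  also have "\<dots> = quotient_trace pm_scale (?M k) ?S ?f + quotient_trace pm_scale ?S {0} ?f"
    by (rule pm.quotient_trace_add[OF B2 B3 pm.subspace_single_0 subS subspace_subset_space _ SM linear_map_basis fM fS])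
      (auto simp: map_basis.zero pm.subspace_0[OF subS])
  also have "quotient_trace pm_scale (?M k) ?S ?f = quotient_trace pm_scale (?M (k - 1)) {0} ?f"
    by (rule quotient_trace_transfer[OF linear_down ker im subS subspace_subset_space pm.subspace_single_0
      subspace_subset_space SM B1 linear_map_basis fM linear_map_basis _ fd]) (auto simp: map_basis.zero)
  finally show ?thesis unfolding trace_subset_space[OF \<sigma>] irr_char_two_row[OF \<sigma>] .
qed

text \<open>
  All columns have length one, so there is only one polytabloid and every permutation fixes it.
\<close>

lemma irr_char_one_row:
  assumes \<sigma>: "\<sigma> permutes {1..N}"
  shows "irr_char (one_row N) \<sigma> = (1 :: 'f::field)"
proof -
  define T where "T = (if N = 0 then [] else [{1..N}])"
  let ?e = "unit_vector T :: nat set list \<Rightarrow>\<^sub>0 'f"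
  have N: "sum_list (one_row N) = N" by (simp add: one_row_def)
  have len: "length (one_row N) \<le> 1" by (simp add: one_row_def)
  have row: "tab_row (one_row N) t x = 0" if "t \<in> tableaux (one_row N)" "x \<in> {1..N}" for t x
    using tab_entry(1)[OF that(1), of x] that(2) N len by (auto simp: boxes_def)
  have tabloid: "tabloid (one_row N) t = T" if t: "t \<in> tableaux (one_row N)" for t
  proof (cases "N = 0")
    case False
    have "tabloid (one_row N) t ! 0 = {1..N}"
      using tabloid_nth[OF t, of 0] row[OF t] N False by (auto simp: one_row_def)
    moreover have "length (tabloid (one_row N) t) = 1" using length_tabloid[OF t] False by (simp add: one_row_def)
    ultimately show ?thesis using False by (auto simp: T_def length_Suc_conv)
  qed (simp add: T_def tabloid_def one_row_def)
  have C: "column_stabilizer (one_row N) t = {id}" if t: "t \<in> tableaux (one_row N)" for t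
  proof -
    interpret perm_group "column_stabilizer (one_row N) t" "{1..N}"
      using perm_group_column_stabilizer[OF t] N by simp
    have "\<pi> = id" if \<pi>: "\<pi> \<in> column_stabilizer (one_row N) t" for \<pi>
    proof
      fix x
      show "\<pi> x = id x"
      proof (cases "x \<in> {1..N}")
        case True
        then have "\<pi> x \<in> {1..N}" using permutes_in_image[OF permutes[OF \<pi>]] by blast
        then have "\<pi> x = x"
          using tab_entry_eqI[OF t] row[OF t] \<pi> True unfolding column_stabilizer_eq[OF t] N by simp
        then show ?thesis by simp
      qed (use permutes_not_in[OF permutes[OF \<pi>]] in simp)
    qed
    then show ?thesis using id_in by blast
  qed
  have poly: "polytabloid (one_row N) t = ?e" if t: "t \<in> tableaux (one_row N)" for t
    unfolding polytabloid_def C[OF t] using tabloid[OF t] by (simp add: sign_id)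
  have "polytabloid (one_row N) ` tableaux (one_row N) = {?e}"
    using poly ex_tableau[of "one_row N"] by (auto simp: image_iff)
  then have S: "specht_module (one_row N) = pm.span {?e}" by (simp add: specht_module_def)
  have e0: "?e \<noteq> 0" by (auto dest!: arg_cong[of _ _ keys])
  have fe: "map_basis (map ((`) \<sigma>)) ?e = ?e"
    using permutes_image[OF \<sigma>] by (simp add: T_def)
  show ?thesis
    unfolding irr_char_def S
  proof (rule pm.trace_rank_one[OF pm.subspace_span, of "{?e}" "{?e}" ?e])
    show "map_basis (map ((`) \<sigma>)) ` pm.span {?e} \<subseteq> pm.span {?e}"
      by (simp only: map_basis.span_image[symmetric] image_insert image_empty fe)
    show "map_basis (map ((`) \<sigma>)) ?e = pm_scale 1 ?e" by (simp only: fe pm.scale_one)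
  qed (use e0 in \<open>auto intro: linear_map_basis pm.span_base\<close>)
qed

definition two_rows :: "nat \<Rightarrow> nat \<Rightarrow> nat list" where
  "two_rows N j = (if j = 0 then one_row N else [N - j, j])"

lemma fixed_subsets_0: "fixed_subsets N 0 \<sigma> = {{}}"
  by (auto simp: fixed_subsets_def finite_subset[OF _ finite_atLeastAtMost])

lemma card_fixed_subsets:
  assumes \<sigma>: "\<sigma> permutes {1..N}"
  shows "2 * k \<le> N \<Longrightarrow> of_nat (card (fixed_subsets N k \<sigma>)) = (\<Sum>j\<le>k. irr_char (two_rows N j) \<sigma> :: 'f::field_char_0)"
proof (induction k)
  case 0
  then show ?case by (simp add: fixed_subsets_0 two_rows_def irr_char_one_row[OF \<sigma>])
next
  case (Suc k)
  then show ?case using fixed_subsets_step[OF _ _ \<sigma>, of "Suc k", where 'f = 'f] by (simp add: two_rows_def)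
qed

lemma fixed_subsets_complement:
  assumes \<sigma>: "\<sigma> permutes {1..N}" and k: "k \<le> N"
  shows "card (fixed_subsets N (N - k) \<sigma>) = card (fixed_subsets N k \<sigma>)"
proof -
  have inj: "inj \<sigma>" using permutes_inj[OF \<sigma>] .
  have *: "{1..N} - A \<in> fixed_subsets N (N - j) \<sigma>" if "A \<in> fixed_subsets N j \<sigma>" for A j
  proof -
    have A: "A \<subseteq> {1..N}" "card A = j" "\<sigma> ` A = A" using that by (auto simp: fixed_subsets_def)
    have "\<sigma> ` ({1..N} - A) = {1..N} - A"
      using A(3) permutes_image[OF \<sigma>] by (simp only: image_set_diff[OF inj])
    then show ?thesis using A finite_subset[OF A(1)] by (simp add: fixed_subsets_def card_Diff_subset)
  qed
  have "bij_betw (\<lambda>A. {1..N} - A) (fixed_subsets N k \<sigma>) (fixed_subsets N (N - k) \<sigma>)"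
  proof (rule bij_betwI[where g = "\<lambda>A. {1..N} - A"])
    show "(\<lambda>A. {1..N} - A) \<in> fixed_subsets N k \<sigma> \<rightarrow> fixed_subsets N (N - k) \<sigma>" using * by blast
    show "(\<lambda>A. {1..N} - A) \<in> fixed_subsets N (N - k) \<sigma> \<rightarrow> fixed_subsets N k \<sigma>" using *[of _ "N - k"] k by auto
  qed (auto simp: fixed_subsets_def)
  then show ?thesis by (rule bij_betw_same_card[symmetric])
qed

lemma card_fixed_subsets':
  assumes \<sigma>: "\<sigma> permutes {1..N}" and k: "k \<le> N"
  shows "of_nat (card (fixed_subsets N k \<sigma>)) = (\<Sum>j\<le>min k (N - k). irr_char (two_rows N j) \<sigma> :: 'f::field_char_0)"
proof (cases "2 * k \<le> N")
  case True
  then have "min k (N - k) = k" by simp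
  then show ?thesis by (simp add: card_fixed_subsets[OF \<sigma> True])
next
  case False
  then have "2 * (N - k) \<le> N" "min k (N - k) = N - k" using k by auto
  then show ?thesis
    using card_fixed_subsets[OF \<sigma>, of "N - k", where 'f = 'f] fixed_subsets_complement[OF \<sigma> k] by simp
qed

text \<open>
  The character of \<open>two_rows N j\<close> occurs for the subset sizes \<open>k\<close> with \<open>j \<le> k \<le> N - j\<close>.
\<close>

lemma card_all_fixed_subsets:
  assumes \<sigma>: "\<sigma> permutes {1..N}"
  shows "of_nat (card {A. A \<subseteq> {1..N} \<and> \<sigma> ` A = A})
    = (\<Sum>j\<le>N div 2. of_nat (N - 2 * j + 1) * irr_char (two_rows N j) \<sigma> :: 'f::field_char_0)"
proof -
  have U: "{A. A \<subseteq> {1..N} \<and> \<sigma> ` A = A} = (\<Union>k\<le>N. fixed_subsets N k \<sigma>)"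
    using card_mono[of "{1..N}"] by (fastforce simp: fixed_subsets_def)
  have fin: "finite (fixed_subsets N k \<sigma>)" for k
    by (rule finite_subset[of _ "Pow {1..N}"]) (auto simp: fixed_subsets_def)
  have "card {A. A \<subseteq> {1..N} \<and> \<sigma> ` A = A} = (\<Sum>k\<le>N. card (fixed_subsets N k \<sigma>))"
    unfolding U using fin by (intro card_UN_disjoint) (auto simp: fixed_subsets_def)
  then have "of_nat (card {A. A \<subseteq> {1..N} \<and> \<sigma> ` A = A})
    = (\<Sum>k\<le>N. \<Sum>j\<le>min k (N - k). irr_char (two_rows N j) \<sigma> :: 'f)"
    by (simp add: card_fixed_subsets'[OF \<sigma>])
  also have "\<dots> = (\<Sum>k\<le>N. \<Sum>j\<le>N div 2. if j \<le> k \<and> k \<le> N - j then irr_char (two_rows N j) \<sigma> else 0)"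
  proof (rule sum.cong[OF refl])
    fix k assume "k \<in> {..N}"
    then have "{j. j \<le> N div 2 \<and> j \<le> k \<and> k \<le> N - j} = {..min k (N - k)}" by auto
    then show "(\<Sum>j\<le>min k (N - k). irr_char (two_rows N j) \<sigma> :: 'f)
      = (\<Sum>j\<le>N div 2. if j \<le> k \<and> k \<le> N - j then irr_char (two_rows N j) \<sigma> else 0)"
      by (simp add: sum.inter_filter[symmetric])
  qed
  also have "\<dots> = (\<Sum>j\<le>N div 2. \<Sum>k\<le>N. if j \<le> k \<and> k \<le> N - j then irr_char (two_rows N j) \<sigma> else 0)"
    by (rule sum.swap)
  also have "\<dots> = (\<Sum>j\<le>N div 2. of_nat (N - 2 * j + 1) * irr_char (two_rows N j) \<sigma>)"
  proof (intro sum.cong refl)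
    fix j assume "j \<in> {..N div 2}"
    then have j: "2 * j \<le> N" by auto
    then have "{k. k \<le> N \<and> j \<le> k \<and> k \<le> N - j} = {j..N - j}" by auto
    then have "(\<Sum>k\<le>N. if j \<le> k \<and> k \<le> N - j then irr_char (two_rows N j) \<sigma> else (0 :: 'f))
      = (\<Sum>k\<in>{j..N - j}. irr_char (two_rows N j) \<sigma>)"
      by (simp add: sum.inter_filter[symmetric])
    also have "\<dots> = of_nat (card {j..N - j}) * irr_char (two_rows N j) \<sigma>" by (rule sum_constant)
    also have "card {j..N - j} = N - 2 * j + 1" using j by simp
    finally show "(\<Sum>k\<le>N. if j \<le> k \<and> k \<le> N - j then irr_char (two_rows N j) \<sigma> else (0 :: 'f))
      = of_nat (N - 2 * j + 1) * irr_char (two_rows N j) \<sigma>" .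
  qed
  finally show ?thesis .
qed

section \<open>Evaluating monomials in the upper triangular matrices\<close>

definition ut :: "'f::field \<Rightarrow> 'f \<Rightarrow> 'f \<Rightarrow> 'f^2^2" where
  "ut p q c = (\<chi> i j. if i = 1 then (if j = 1 then p else c) else (if j = 1 then 0 else q))"

lemma ut_nth [simp]:
  "ut p q c $ 1 $ 1 = p" "ut p q c $ 2 $ 2 = q" "ut p q c $ 1 $ 2 = c" "ut p q c $ 2 $ 1 = 0"
  by (simp_all add: ut_def)

lemma matrix2_eq_iff: "A = B \<longleftrightarrow> A $ 1 $ 1 = B $ 1 $ 1 \<and> A $ 1 $ 2 = B $ 1 $ 2 \<and> A $ 2 $ 1 = B $ 2 $ 1 \<and> A $ 2 $ 2 = B $ 2 $ 2"
  for A B :: "'a^2^2"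
  by (auto simp: vec_eq_iff forall_2)

lemma ut_eq_iff [simp]: "ut p q c = ut p' q' c' \<longleftrightarrow> p = p' \<and> q = q' \<and> c = c'"
  by (auto simp: matrix2_eq_iff)

lemma ut_0 [simp]: "ut 0 0 0 = 0"
  by (simp add: matrix2_eq_iff)

lemma ut_mult [simp]: "ut p q c ** ut p' q' c' = ut (p * p') (q * q') (p * c' + c * q')"
  by (simp add: matrix2_eq_iff matrix_matrix_mult_def sum_2)

lemma ut_add [simp]: "ut p q c + ut p' q' c' = ut (p + p') (q + q') (c + c')"
  by (simp add: matrix2_eq_iff)

lemma matrix_scale_nth [simp]: "matrix_scale r A $ i $ j = r * A $ i $ j"
  by (simp add: matrix_scale_def map_matrix_def)

lemma ut_scale [simp]: "matrix_scale r (ut p q c) = ut (r * p) (r * q) (r * c)"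
  by (simp add: matrix2_eq_iff)

lemma vector_space_matrix_scale: "vector_space matrix_scale"
  by unfold_locales (simp_all add: matrix2_eq_iff algebra_simps)

lemma ut_diagonal: "matrix_scale p (matrix_unit 1 1) + matrix_scale q (matrix_unit 2 2) = ut p q 0"
  by (simp add: matrix2_eq_iff matrix_unit_def axis_def)

lemma UT2_component_0: "UT2_component 0 = {ut p q 0 | p q. True}"
  by (simp add: UT2_component_def ut_diagonal)

lemma UT2_component_1: "UT2_component 1 = {ut 0 0 c | c. True}"
proof -
  have "matrix_scale c (matrix_unit 1 2) = ut 0 0 c" for c :: 'a
    by (simp add: matrix2_eq_iff matrix_unit_def axis_def)
  then show ?thesis by (simp add: UT2_component_def)
qed

lemma diagonal_algebra_eq: "diagonal_algebra = {ut p q 0 | p q. True}"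
  by (simp add: diagonal_algebra_def ut_diagonal)

locale UT2_D_setup =
  fixes sc :: "'f::field_char_0 \<Rightarrow> 'w::ring_1 \<Rightarrow> 'w"
    and W :: "bit \<Rightarrow> 'w set"
    and \<phi> :: "'w \<Rightarrow> 'f^2^2"
    and B :: "'w set"
  assumes W: "Z2_graded_algebra sc W" and \<phi>: "graded_hom_onto_D sc W \<phi>"
    and spanB: "module.span sc B = UNIV"
begin

definition \<phi>1 :: "'w \<Rightarrow> 'f" where "\<phi>1 w = \<phi> w $ 1 $ 1"
definition \<phi>2 :: "'w \<Rightarrow> 'f" where "\<phi>2 w = \<phi> w $ 2 $ 2"

lemma \<phi>_eq: "\<phi> w = ut (\<phi>1 w) (\<phi>2 w) 0"
proof -
  have "\<phi> w \<in> diagonal_algebra" using \<phi> by (auto simp: graded_hom_onto_D_def)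
  then show ?thesis by (auto simp: diagonal_algebra_eq \<phi>1_def \<phi>2_def)
qed

lemma \<phi>_linear: "Vector_Spaces.linear sc matrix_scale \<phi>"
  using \<phi> by (simp add: graded_hom_onto_D_def)

lemma \<phi>1_add: "\<phi>1 (v + w) = \<phi>1 v + \<phi>1 w" and \<phi>2_add: "\<phi>2 (v + w) = \<phi>2 v + \<phi>2 w"
  and \<phi>1_scale: "\<phi>1 (sc c w) = c * \<phi>1 w" and \<phi>2_scale: "\<phi>2 (sc c w) = c * \<phi>2 w"
  and \<phi>1_0: "\<phi>1 0 = 0" and \<phi>2_0: "\<phi>2 0 = 0"
proof -
  interpret Vector_Spaces.linear sc matrix_scale \<phi> by (rule \<phi>_linear)
  show "\<phi>1 (v + w) = \<phi>1 v + \<phi>1 w" "\<phi>2 (v + w) = \<phi>2 v + \<phi>2 w" "\<phi>1 (sc c w) = c * \<phi>1 w" "\<phi>2 (sc c w) = c * \<phi>2 w"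
    "\<phi>1 0 = 0" "\<phi>2 0 = 0"
    by (simp_all add: \<phi>1_def \<phi>2_def add scale zero)
qed

lemma \<phi>_onto: "\<exists>w. \<phi>1 w = p \<and> \<phi>2 w = q"
proof -
  have "ut p q 0 \<in> range \<phi>" using \<phi> by (auto simp: graded_hom_onto_D_def diagonal_algebra_eq)
  then obtain w where "ut p q 0 = \<phi> w" by blast
  then show ?thesis by (intro exI[of _ w]) (simp add: \<phi>_eq)
qed

lemma ex_basis_nonzero: "\<exists>c\<in>B. \<phi>1 c \<noteq> 0" "\<exists>c\<in>B. \<phi>2 c \<noteq> 0"
proof -
  interpret W: Z2_graded_algebra sc W by (rule W)
  obtain w where w: "\<phi>1 w = 1" "\<phi>2 w = 1" using \<phi>_onto by blast
  have all: "w \<in> W.span B" for w using spanB by simp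
  show "\<exists>c\<in>B. \<phi>1 c \<noteq> 0"
  proof (rule ccontr)
    assume *: "\<not> (\<exists>c\<in>B. \<phi>1 c \<noteq> 0)"
    have "\<phi>1 w = 0"
      using all[of w] by (induction rule: W.span_induct_alt) (use * in \<open>auto simp: \<phi>1_0 \<phi>1_add \<phi>1_scale\<close>)
    then show False using w by simp
  qed
  show "\<exists>c\<in>B. \<phi>2 c \<noteq> 0"
  proof (rule ccontr)
    assume *: "\<not> (\<exists>c\<in>B. \<phi>2 c \<noteq> 0)"
    have "\<phi>2 w = 0"
      using all[of w] by (induction rule: W.span_induct_alt) (use * in \<open>auto simp: \<phi>2_0 \<phi>2_add \<phi>2_scale\<close>)
    then show False using w by simp
  qed
qed

definition word_\<phi>1 :: "(gvar \<times> 'w) list \<Rightarrow> 'f" where "word_\<phi>1 us = prod_list (map (\<phi>1 \<circ> snd) us)"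
definition word_\<phi>2 :: "(gvar \<times> 'w) list \<Rightarrow> 'f" where "word_\<phi>2 us = prod_list (map (\<phi>2 \<circ> snd) us)"

definition graded_substitution :: "(gvar \<Rightarrow> 'f^2^2) \<Rightarrow> bool" where
  "graded_substitution s \<longleftrightarrow> (\<forall>i. s (Y i) \<in> UT2_component 0 \<and> s (Z i) \<in> UT2_component 1)"

definition substitution :: "(nat \<Rightarrow> 'f) \<Rightarrow> (nat \<Rightarrow> 'f) \<Rightarrow> (nat \<Rightarrow> 'f) \<Rightarrow> gvar \<Rightarrow> 'f^2^2" where
  "substitution \<alpha> \<beta> \<gamma> u = (case u of Y i \<Rightarrow> ut (\<alpha> i) (\<beta> i) 0 | Z i \<Rightarrow> ut 0 0 (\<gamma> i))"

lemma graded_substitution_iff: "graded_substitution s \<longleftrightarrow> (\<exists>\<alpha> \<beta> \<gamma>. s = substitution \<alpha> \<beta> \<gamma>)"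
proof
  assume s: "graded_substitution s"
  have "s (Y i) = ut (s (Y i) $ 1 $ 1) (s (Y i) $ 2 $ 2) 0 \<and> s (Z i) = ut 0 0 (s (Z i) $ 1 $ 2)" for i
  proof -
    obtain p q c where "s (Y i) = ut p q 0" "s (Z i) = ut 0 0 c"
      using s unfolding graded_substitution_def UT2_component_0 UT2_component_1 by blast
    then show ?thesis by simp
  qed
  then have "s u = substitution (\<lambda>i. s (Y i) $ 1 $ 1) (\<lambda>i. s (Y i) $ 2 $ 2) (\<lambda>i. s (Z i) $ 1 $ 2) u" for u
    by (cases u) (simp_all add: substitution_def)
  then show "\<exists>\<alpha> \<beta> \<gamma>. s = substitution \<alpha> \<beta> \<gamma>" by blast
qed (auto simp: graded_substitution_def substitution_def UT2_component_0 UT2_component_1)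

context
  fixes \<alpha> \<beta> \<gamma> :: "nat \<Rightarrow> 'f"
begin

text \<open>
  The entries of the matrix that is substituted for a variable.
\<close>

fun diag1 :: "gvar \<Rightarrow> 'f" where "diag1 (Y i) = \<alpha> i" | "diag1 (Z i) = 0"
fun diag2 :: "gvar \<Rightarrow> 'f" where "diag2 (Y i) = \<beta> i" | "diag2 (Z i) = 0"
fun corner :: "gvar \<Rightarrow> 'f" where "corner (Y i) = 0" | "corner (Z i) = \<gamma> i"

lemma substitution_ut: "substitution \<alpha> \<beta> \<gamma> u = ut (diag1 u) (diag2 u) (corner u)"
  by (cases u) (simp_all add: substitution_def)

fun word_corner :: "(gvar \<times> 'w) list \<Rightarrow> 'f" where
  "word_corner [] = 0"
| "word_corner ((u, w) # us) = diag1 u * \<phi>1 w * word_corner us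
     + corner u * \<phi>2 w * (word_\<phi>2 us * prod_list (map (diag2 \<circ> fst) us))"

text \<open>
  The diagonal entries are multiplicative. In the corner, the first letter contributes either its
  upper left entry, times the corner of the remaining word, or its own corner, times the lower right
  entry of the remaining word.
\<close>

lemma eval_word_UT2:
  "us \<noteq> [] \<Longrightarrow> eval_word (UT2_D \<phi>) (substitution \<alpha> \<beta> \<gamma>) us
    = ut (word_\<phi>1 us * prod_list (map (diag1 \<circ> fst) us)) (word_\<phi>2 us * prod_list (map (diag2 \<circ> fst) us)) (word_corner us)"
proof (induction us)
  case (Cons x us)
  obtain u w where x: "x = (u, w)" by (cases x)
  show ?case
  proof (cases us)
    case Nil
    then show ?thesis by (simp add: x UT2_D_def substitution_ut \<phi>_eq[of w] word_\<phi>1_def word_\<phi>2_def algebra_simps)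
  next
    case (Cons y ys)
    then have "eval_word (UT2_D \<phi>) (substitution \<alpha> \<beta> \<gamma>) (x # us)
      = (substitution \<alpha> \<beta> \<gamma> u ** \<phi> w) ** eval_word (UT2_D \<phi>) (substitution \<alpha> \<beta> \<gamma>) us"
      by (simp add: x UT2_D_def)
    also have "eval_word (UT2_D \<phi>) (substitution \<alpha> \<beta> \<gamma>) us
      = ut (word_\<phi>1 us * prod_list (map (diag1 \<circ> fst) us)) (word_\<phi>2 us * prod_list (map (diag2 \<circ> fst) us)) (word_corner us)"
      using Cons.IH Cons by blast
    also have "(substitution \<alpha> \<beta> \<gamma> u ** \<phi> w) ** \<dots> = ut (word_\<phi>1 (x # us) * prod_list (map (diag1 \<circ> fst) (x # us)))
        (word_\<phi>2 (x # us) * prod_list (map (diag2 \<circ> fst) (x # us))) (word_corner (x # us))"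
      by (simp add: x substitution_ut[of u] \<phi>_eq[of w] word_\<phi>1_def word_\<phi>2_def algebra_simps)
    finally show ?thesis .
  qed
qed simp

lemma eval_monomial_UT2:
  "us \<noteq> [] \<Longrightarrow> eval_monomial (UT2_D \<phi>) (substitution \<alpha> \<beta> \<gamma>) (w0, us)
    = ut (\<phi>1 w0 * word_\<phi>1 us * prod_list (map (diag1 \<circ> fst) us)) (\<phi>2 w0 * word_\<phi>2 us * prod_list (map (diag2 \<circ> fst) us))
        (\<phi>1 w0 * word_corner us)"
  by (simp add: eval_monomial_def eval_word_UT2) (simp add: UT2_D_def \<phi>_eq[of w0] algebra_simps)

lemma diag_0: "Z i \<in> fst ` set us \<Longrightarrow> prod_list (map (diag1 \<circ> fst) us) = 0"
   "Z i \<in> fst ` set us \<Longrightarrow> prod_list (map (diag2 \<circ> fst) us) = 0"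
  by (force simp: prod_list_zero_iff)+

lemma diag_Y:
  assumes "distinct (map fst us)" "fst ` set us = Y ` V"
  shows "prod_list (map (diag1 \<circ> fst) us) = (\<Prod>i\<in>V. \<alpha> i)" "prod_list (map (diag2 \<circ> fst) us) = (\<Prod>i\<in>V. \<beta> i)"
proof -
  have inj: "inj_on Y V" by (simp add: inj_on_def)
  have "prod_list (map f (map fst us)) = (\<Prod>i\<in>V. f (Y i))" for f :: "gvar \<Rightarrow> 'f"
    using prod.distinct_set_conv_list[OF assms(1), of f] assms(2) by (simp add: prod.reindex[OF inj])
  from this[of diag1] this[of diag2]
  show "prod_list (map (diag1 \<circ> fst) us) = (\<Prod>i\<in>V. \<alpha> i)" "prod_list (map (diag2 \<circ> fst) us) = (\<Prod>i\<in>V. \<beta> i)"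
    by simp_all
qed

lemma word_corner_two:
  "distinct (map fst us) \<Longrightarrow> Z i \<in> fst ` set us \<Longrightarrow> Z j \<in> fst ` set us \<Longrightarrow> i \<noteq> j \<Longrightarrow> word_corner us = 0"
proof (induction us)
  case (Cons x us)
  obtain u w where x: "x = (u, w)" by (cases x)
  show ?case
  proof (cases u)
    case (Y l)
    then show ?thesis using Cons by (auto simp: x)
  next
    case (Z l)
    then have "Z i \<in> fst ` set us \<or> Z j \<in> fst ` set us" using Cons.prems by (auto simp: x)
    then show ?thesis using Z diag_0(2) by (auto simp: x)
  qed
qed simp

end

text \<open>
  If only one variable in a word has degree one, then the corner of its value is \<open>coef\<close> times a
  product of entries of the \<open>y\<close>'s that depends on nothing but \<open>before\<close>, the set of the indices to the
  left of this variable.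
\<close>

fun before :: "(gvar \<times> 'w) list \<Rightarrow> nat set" where
  "before [] = {}"
| "before ((Y i, w) # us) = insert i (before us)"
| "before ((Z i, w) # us) = {}"

fun coef :: "(gvar \<times> 'w) list \<Rightarrow> 'f" where
  "coef [] = 0"
| "coef ((Y i, w) # us) = \<phi>1 w * coef us"
| "coef ((Z i, w) # us) = \<phi>2 w * word_\<phi>2 us"

lemma before_subset: "before us \<subseteq> {i. Y i \<in> fst ` set us}"
  by (induction us rule: before.induct) auto

lemma word_corner_one:
  "distinct (map fst us) \<Longrightarrow> fst ` set us = Y ` V \<union> {Z 1} \<Longrightarrow> finite V \<Longrightarrow>
    word_corner \<alpha> \<beta> \<gamma> us = coef us * (\<gamma> 1 * (\<Prod>i\<in>before us. \<alpha> i) * (\<Prod>i\<in>V - before us. \<beta> i))"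
proof (induction us arbitrary: V)
  case (Cons x us)
  obtain u w where x: "x = (u, w)" by (cases x)
  have d: "distinct (map fst us)" "u \<notin> fst ` set us" using Cons.prems(1) by (auto simp: x)
  have ins: "insert u (fst ` set us) = Y ` V \<union> {Z 1}" using Cons.prems(2) by (simp add: x)
  show ?case
  proof (cases u)
    case (Y l)
    have l: "l \<in> V" using ins Y by auto
    have set: "fst ` set us = Y ` (V - {l}) \<union> {Z 1}"
    proof -
      have "fst ` set us = insert u (fst ` set us) - {u}" using d(2) by simp
      also have "\<dots> = (Y ` V \<union> {Z 1}) - {Y l}" by (subst ins) (simp only: Y)
      also have "\<dots> = Y ` (V - {l}) \<union> {Z 1}" by auto
      finally show ?thesis .
    qed
    have IH: "word_corner \<alpha> \<beta> \<gamma> us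
        = coef us * (\<gamma> 1 * (\<Prod>i\<in>before us. \<alpha> i) * (\<Prod>i\<in>(V - {l}) - before us. \<beta> i))"
      using Cons.IH[OF d(1) set] Cons.prems(3) by simp
    have lb: "l \<notin> before us" using before_subset[of us] d(2) Y by auto
    have "finite (before us)"
      by (rule finite_subset[OF before_subset]) (auto intro!: finite_subset[OF _ Cons.prems(3)] simp: set)
    moreover have "V - insert l (before us) = V - {l} - before us" by blast
    ultimately show ?thesis using lb by (simp add: x Y IH algebra_simps)
  next
    case (Z l)
    then have l: "l = 1" using ins by auto
    have set: "fst ` set us = Y ` V"
    proof -
      have "fst ` set us = insert u (fst ` set us) - {u}" using d(2) by simp
      also have "\<dots> = (Y ` V \<union> {Z 1}) - {Z 1}" by (subst ins) (simp only: Z l)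
      also have "\<dots> = Y ` V" by auto
      finally show ?thesis .
    qed
    show ?thesis by (simp add: x Z l diag_Y(2)[OF d(1) set] algebra_simps)
  qed
qed auto

section \<open>Multilinear identities and the cocharacters as permutation characters\<close>

abbreviation "P r k \<equiv> multilinear_space B r k :: ('w gmonomial \<Rightarrow>\<^sub>0 'f) set"
abbreviation "M r k \<equiv> multilinear_monomials B r k"
abbreviation "I \<equiv> graded_W_identities B (UT2_D \<phi>)"

lemma P_eq: "P r k = {p. keys p \<subseteq> M r k}"
  by (simp add: multilinear_space_def span_unit_vectors)

lemma P_I: "p \<in> P r k \<Longrightarrow> p \<in> I \<longleftrightarrow> (\<forall>\<alpha> \<beta> \<gamma>. substitute (UT2_D \<phi>) (substitution \<alpha> \<beta> \<gamma>) p = 0)"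
proof -
  assume "p \<in> P r k"
  then have "p \<in> free_W_algebra B"
    by (auto simp: P_eq free_W_algebra_def span_unit_vectors multilinear_monomials_def)
  moreover have "component (UT2_D \<phi>) = UT2_component" by (simp add: UT2_D_def)
  ultimately have "p \<in> I \<longleftrightarrow> (\<forall>s. graded_substitution s \<longrightarrow> substitute (UT2_D \<phi>) s p = 0)"
    by (simp add: graded_W_identities_def graded_substitution_def)
  then show ?thesis unfolding graded_substitution_iff by blast
qed

lemma linear_substitute: "Vector_Spaces.linear pm_scale matrix_scale (substitute (UT2_D \<phi>) s)"
proof -
  have "smult (UT2_D \<phi>) = matrix_scale" by (simp add: UT2_D_def)
  then show ?thesis unfolding substitute_def using linear_linear_extension[OF vector_space_matrix_scale] by metis
qed

lemma substitute_unit: "substitute (UT2_D \<phi>) s (unit_vector m) = eval_monomial (UT2_D \<phi>) s m"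
proof -
  interpret vector_space "matrix_scale :: 'f \<Rightarrow> _" by (rule vector_space_matrix_scale)
  have "smult (UT2_D \<phi>) = matrix_scale" by (simp add: UT2_D_def)
  then show ?thesis by (simp add: substitute_def linear_extension_def)
qed

lemma subspace_P: "pm.subspace (P r k)"
  by (simp add: multilinear_space_def)

lemma subspace_P_I: "pm.subspace (P r k \<inter> I)"
proof (rule pm.subspaceI)
  interpret S: Vector_Spaces.linear pm_scale matrix_scale "substitute (UT2_D \<phi>) s" for s by (rule linear_substitute)
  note [simp] = S.zero S.add S.scale
  show "0 \<in> P r k \<inter> I" using pm.subspace_0[OF subspace_P] by (auto simp: P_I)
  show "u + v \<in> P r k \<inter> I" if "u \<in> P r k \<inter> I" "v \<in> P r k \<inter> I" for u v
    using that pm.subspace_add[OF subspace_P, of u r k v] by (auto simp: P_I)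
  show "pm_scale c u \<in> P r k \<inter> I" if "u \<in> P r k \<inter> I" for c u
    using that pm.subspace_scale[OF subspace_P, of u r k c] S.vs2.scale_zero_right by (auto simp: P_I)
qed

lemma permute_monomial_M:
  assumes \<sigma>: "\<sigma> permutes {1..r}" and \<tau>: "\<tau> permutes {1..k}" and m: "m \<in> M r k"
  shows "permute_monomial \<sigma> \<tau> m \<in> M r k"
proof -
  obtain w0 us where m': "m = (w0, us)" by (cases m)
  have inj: "inj (permute_var \<sigma> \<tau>)"
  proof (rule injI)
    fix x y show "permute_var \<sigma> \<tau> x = permute_var \<sigma> \<tau> y \<Longrightarrow> x = y"
      using permutes_inj[OF \<sigma>] permutes_inj[OF \<tau>] by (cases x; cases y) (auto simp: inj_eq)
  qed
  let ?us = "map (map_prod (permute_var \<sigma> \<tau>) id) us"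
  have fst: "map fst ?us = map (permute_var \<sigma> \<tau>) (map fst us)" by simp
  have "set (map fst ?us) = permute_var \<sigma> \<tau> ` (Y ` {1..r} \<union> Z ` {1..k})"
    unfolding fst set_map using m by (simp add: m' multilinear_monomials_def)
  also have "\<dots> = Y ` \<sigma> ` {1..r} \<union> Z ` \<tau> ` {1..k}" by (simp add: image_Un image_image)
  also have "\<dots> = Y ` {1..r} \<union> Z ` {1..k}" by (simp only: permutes_image[OF \<sigma>] permutes_image[OF \<tau>])
  finally have "fst ` set ?us = Y ` {1..r} \<union> Z ` {1..k}" by (simp only: set_map)
  moreover have "distinct (map fst ?us)"
    unfolding fst distinct_map using m inj by (auto simp: m' multilinear_monomials_def distinct_map intro: inj_on_subset)
  moreover have "snd ` set ?us = snd ` set us" by (force simp: image_image)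
  ultimately show ?thesis
    using m by (simp add: m' multilinear_monomials_def gmonomials_def permute_monomial_def)
qed

lemma permute_P:
  assumes \<sigma>: "\<sigma> permutes {1..r}" and \<tau>: "\<tau> permutes {1..k}"
  shows "map_basis (permute_monomial \<sigma> \<tau>) ` P r k \<subseteq> P r k"
proof safe
  fix p assume "p \<in> P r k"
  then have "permute_monomial \<sigma> \<tau> ` keys p \<subseteq> M r k" using permute_monomial_M[OF \<sigma> \<tau>] by (auto simp: P_eq)
  then show "map_basis (permute_monomial \<sigma> \<tau>) p \<in> P r k"
    unfolding P_eq using order_trans[OF keys_map_basis] by blast
qed

text \<open>
  A map \<open>T\<close> as in the assumptions identifies the multilinear space modulo identities with a
  permutation module.
\<close>

lemma cocharacter_eq_fixed_points:
  fixes T :: "('w gmonomial \<Rightarrow>\<^sub>0 'f) \<Rightarrow> ('x \<Rightarrow>\<^sub>0 'f)"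
  assumes \<sigma>: "\<sigma> permutes {1..r}" and \<tau>: "\<tau> permutes {1..k}"
    and T: "pm_linear T" and ker: "\<And>p. p \<in> P r k \<Longrightarrow> T p = 0 \<longleftrightarrow> p \<in> I"
    and im: "T ` P r k = {q. keys q \<subseteq> X}" and X: "finite X" "g ` X \<subseteq> X"
    and Tg: "\<And>m. m \<in> M r k \<Longrightarrow> T (unit_vector (permute_monomial \<sigma> \<tau> m)) = map_basis g (T (unit_vector m))"
  shows "graded_cocharacter B (UT2_D \<phi>) r k \<sigma> \<tau> = of_nat (card {x\<in>X. g x = x})"
proof -
  have "graded_cocharacter B (UT2_D \<phi>) r k \<sigma> \<tau> = quotient_trace pm_scale {q :: 'x \<Rightarrow>\<^sub>0 'f. keys q \<subseteq> X} {0} (map_basis g)"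
    unfolding graded_cocharacter_def
  proof (rule quotient_trace_transfer[OF T _ im subspace_P_I subspace_P pm.subspace_single_0 subspace_keys _
      quotient_basis_unit_vectors[OF X(1)] linear_map_basis permute_P[OF \<sigma> \<tau>] linear_map_basis])
    show "T p \<in> {0} \<longleftrightarrow> p \<in> P r k \<inter> I" if "p \<in> P r k" for p using that ker by simp
    show "T (map_basis (permute_monomial \<sigma> \<tau>) p) = map_basis g (T p)" if "p \<in> P r k" for p
    proof (rule linear_eq_on_basis[OF linear_comp[OF linear_map_basis T] linear_comp[OF T linear_map_basis]])
      show "keys p \<subseteq> M r k" using that by (simp add: P_eq)
    qed (simp add: Tg)
  qed auto
  then show ?thesis using trace_permutation_module[OF X, where 'f = 'f] by simp
qed

lemma unit_in_P: "m \<in> M r k \<Longrightarrow> unit_vector m \<in> P r k"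
  by (simp add: P_eq)

section \<open>No variable of degree one\<close>

text \<open>
  Without variables of degree one, a monomial is recorded by the scalars that its coefficients
  contribute to the upper left (\<open>True\<close>) and to the lower right entry (\<open>False\<close>).
\<close>

definition diag_coeffs :: "('w gmonomial \<Rightarrow>\<^sub>0 'f) \<Rightarrow> (bool \<Rightarrow>\<^sub>0 'f)" where
  "diag_coeffs = linear_extension pm_scale (\<lambda>(w0, us).
     Poly_Mapping.single True (\<phi>1 w0 * word_\<phi>1 us) + Poly_Mapping.single False (\<phi>2 w0 * word_\<phi>2 us))"

lemma linear_diag_coeffs: "pm_linear diag_coeffs"
  unfolding diag_coeffs_def by (rule pm_linear_extension)

lemma diag_coeffs_unit: "diag_coeffs (unit_vector (w0, us)) = Poly_Mapping.single True (\<phi>1 w0 * word_\<phi>1 us) + Poly_Mapping.single False (\<phi>2 w0 * word_\<phi>2 us)"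
  by (simp add: diag_coeffs_def)

definition diag_value :: "'f \<Rightarrow> 'f \<Rightarrow> (bool \<Rightarrow>\<^sub>0 'f) \<Rightarrow> 'f^2^2" where
  "diag_value x y q = ut (lookup q True * x) (lookup q False * y) 0"

lemma linear_diag_value: "Vector_Spaces.linear pm_scale matrix_scale (diag_value x y)"
  unfolding Vector_Spaces.linear_iff diag_value_def
  by (simp add: vector_space_pm vector_space_matrix_scale lookup_add algebra_simps)

lemma substitute_0:
  assumes "p \<in> P r 0"
  shows "substitute (UT2_D \<phi>) (substitution \<alpha> \<beta> \<gamma>) p = diag_value (\<Prod>i\<in>{1..r}. \<alpha> i) (\<Prod>i\<in>{1..r}. \<beta> i) (diag_coeffs p)"
proof (rule linear_eq_on_basis[OF linear_substitute linear_comp[OF linear_diag_coeffs linear_diag_value], where S = "M r 0"])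
  show "keys p \<subseteq> M r 0" using assms by (simp add: P_eq)
  fix m assume m: "m \<in> M r 0"
  obtain w0 us where m': "m = (w0, us)" by (cases m)
  have us: "us \<noteq> []" "distinct (map fst us)" "fst ` set us = Y ` {1..r}"
    using m by (auto simp: m' multilinear_monomials_def gmonomials_def)
  have c: "word_corner \<alpha> \<beta> \<gamma> vs = 0" if "fst ` set vs \<subseteq> range Y" for vs :: "(gvar \<times> 'w) list"
    using that by (induction vs) auto
  have c': "word_corner \<alpha> \<beta> \<gamma> us = 0" using us(3) by (intro c) auto
  show "substitute (UT2_D \<phi>) (substitution \<alpha> \<beta> \<gamma>) (unit_vector m)
      = diag_value (\<Prod>i\<in>{1..r}. \<alpha> i) (\<Prod>i\<in>{1..r}. \<beta> i) (diag_coeffs (unit_vector m))"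
    by (simp add: substitute_unit m' eval_monomial_UT2[OF us(1)] diag_coeffs_unit diag_value_def lookup_add lookup_single
      diag_Y[OF us(2,3)] c' del: One_nat_def)
qed

lemma diag_coeffs_eq_0_iff:
  assumes p: "p \<in> P r 0"
  shows "diag_coeffs p = 0 \<longleftrightarrow> p \<in> I"
proof
  assume "diag_coeffs p = 0"
  then show "p \<in> I" using p by (simp add: P_I substitute_0 diag_value_def)
next
  assume "p \<in> I"
  then have "substitute (UT2_D \<phi>) (substitution (\<lambda>_. 1) (\<lambda>_. 1) (\<lambda>_. 0)) p = 0" using P_I[OF p] by blast
  then have "ut (lookup (diag_coeffs p) True) (lookup (diag_coeffs p) False) 0 = ut 0 0 0" using p by (simp add: substitute_0 diag_value_def)
  then have "lookup (diag_coeffs p) True = 0 \<and> lookup (diag_coeffs p) False = 0" by (simp only: ut_eq_iff)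
  then have "lookup (diag_coeffs p) x = 0" for x by (cases x) auto
  then show "diag_coeffs p = 0" by (intro poly_mapping_eqI) simp
qed

text \<open>
  It suffices to vary the leftmost coefficient \<open>w\<close>, since \<open>(\<phi>1 w, \<phi>2 w)\<close> takes all values; the other
  coefficients are equal to a basis element \<open>c\<close> on which the relevant one of \<open>\<phi>1\<close> and \<open>\<phi>2\<close> does
  not vanish. The general \<open>w\<close> is reached by linearity from the basis.
\<close>

lemma image_diag_coeffs:
  assumes r: "r \<ge> 1"
  shows "diag_coeffs ` P r 0 = {q. keys q \<subseteq> UNIV}"
proof -
  interpret W: Z2_graded_algebra sc W by (rule W)
  interpret T: Vector_Spaces.linear pm_scale pm_scale diag_coeffs by (rule linear_diag_coeffs)
  have sub: "pm.subspace (diag_coeffs ` P r 0)" by (rule T.subspace_image[OF subspace_P])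
  have *: "Poly_Mapping.single True (\<phi>1 w * \<phi>1 c ^ r) + Poly_Mapping.single False (\<phi>2 w * \<phi>2 c ^ r) \<in> diag_coeffs ` P r 0"
    if c: "c \<in> B" for c w
  proof -
    let ?us = "map (\<lambda>i. (Y i, c)) [1..<Suc r]"
    have us: "word_\<phi>1 ?us = \<phi>1 c ^ r" "word_\<phi>2 ?us = \<phi>2 c ^ r"
      by (simp_all add: word_\<phi>1_def word_\<phi>2_def o_def map_replicate_const prod_list_replicate del: upt_Suc)
    have "w \<in> W.span B" using spanB by simp
    then show ?thesis
    proof (induction rule: W.span_induct_alt)
      case base
      show ?case using pm.subspace_0[OF sub] by (simp add: \<phi>1_0 \<phi>2_0)
    next
      case (step x w w')
      have "(w, ?us) \<in> M r 0"
        using r step(1) c by (auto simp: multilinear_monomials_def gmonomials_def distinct_map inj_on_def image_image)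
      then have "diag_coeffs (unit_vector (w, ?us)) \<in> diag_coeffs ` P r 0" by (intro imageI unit_in_P)
      then have "pm_scale x (diag_coeffs (unit_vector (w, ?us))) + (Poly_Mapping.single True (\<phi>1 w' * \<phi>1 c ^ r) 
          + Poly_Mapping.single False (\<phi>2 w' * \<phi>2 c ^ r)) \<in> diag_coeffs ` P r 0"
        by (rule pm.subspace_add[OF sub pm.subspace_scale[OF sub] step(2)])
      moreover have "pm_scale x (diag_coeffs (unit_vector (w, ?us))) + (Poly_Mapping.single True (\<phi>1 w' * \<phi>1 c ^ r) 
          + Poly_Mapping.single False (\<phi>2 w' * \<phi>2 c ^ r))
         = Poly_Mapping.single True (\<phi>1 (sc x w + w') * \<phi>1 c ^ r) + Poly_Mapping.single False (\<phi>2 (sc x w + w') * \<phi>2 c ^ r)"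
        unfolding diag_coeffs_unit us
        by (rule poly_mapping_eqI) (simp add: lookup_add lookup_single when_def \<phi>1_add \<phi>2_add \<phi>1_scale \<phi>2_scale algebra_simps)
      ultimately show ?case by simp
    qed
  qed
  have units: "unit_vector x \<in> diag_coeffs ` P r 0" for x
  proof (cases x)
    case True
    obtain c where c: "c \<in> B" "\<phi>1 c \<noteq> 0" using ex_basis_nonzero by blast
    \<comment> \<open>The inverse compensates for the other \<open>r\<close> coefficients.\<close>
    obtain w where "\<phi>1 w = inverse (\<phi>1 c ^ r)" "\<phi>2 w = 0" using \<phi>_onto by blast
    with *[OF c(1), of w] c True show ?thesis by simp
  next
    case False
    obtain c where c: "c \<in> B" "\<phi>2 c \<noteq> 0" using ex_basis_nonzero by blast
    obtain w where "\<phi>2 w = inverse (\<phi>2 c ^ r)" "\<phi>1 w = 0" using \<phi>_onto by blast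
    with *[OF c(1), of w] c False show ?thesis by simp
  qed
  have "{q. keys q \<subseteq> UNIV} \<subseteq> diag_coeffs ` P r 0"
    unfolding span_unit_vectors[symmetric] by (rule pm.span_minimal[OF _ sub]) (use units in auto)
  then show ?thesis by auto
qed

lemma cocharacter_no_z:
  assumes r: "r \<ge> 1" and \<sigma>: "\<sigma> permutes {1..r}" and \<tau>: "\<tau> permutes {1..0}"
  shows "graded_cocharacter B (UT2_D \<phi>) r 0 \<sigma> \<tau> = 2"
proof -
  have "graded_cocharacter B (UT2_D \<phi>) r 0 \<sigma> \<tau> = of_nat (card {x \<in> (UNIV :: bool set). id x = x})"
  proof (rule cocharacter_eq_fixed_points[OF \<sigma> \<tau> linear_diag_coeffs diag_coeffs_eq_0_iff image_diag_coeffs[OF r]])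
    fix m :: "'w gmonomial"
    obtain w0 us where m: "m = (w0, us)" by (cases m)
    have "word_\<phi>1 (map (map_prod (permute_var \<sigma> \<tau>) id) us) = word_\<phi>1 us" "word_\<phi>2 (map (map_prod (permute_var \<sigma> \<tau>) id) us) = word_\<phi>2 us"
      by (simp_all add: word_\<phi>1_def word_\<phi>2_def o_def)
    then show "diag_coeffs (unit_vector (permute_monomial \<sigma> \<tau> m)) = map_basis id (diag_coeffs (unit_vector m))"
      by (simp add: m diag_coeffs_unit permute_monomial_def map_basis_ident)
  qed auto
  then show ?thesis by simp
qed

section \<open>One variable of degree one\<close>

text \<open>
  With one variable of degree one, a monomial is recorded by the set of the \<open>y\<close>'s in front of that
  variable, with the scalar that its coefficients contribute to the corner.
\<close>

definition corner_coeffs :: "('w gmonomial \<Rightarrow>\<^sub>0 'f) \<Rightarrow> (nat set \<Rightarrow>\<^sub>0 'f)" where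
  "corner_coeffs = linear_extension pm_scale (\<lambda>(w0, us). Poly_Mapping.single (before us) (\<phi>1 w0 * coef us))"

lemma linear_corner_coeffs: "pm_linear corner_coeffs"
  unfolding corner_coeffs_def by (rule pm_linear_extension)

lemma corner_coeffs_unit: "corner_coeffs (unit_vector (w0, us)) = Poly_Mapping.single (before us) (\<phi>1 w0 * coef us)"
  by (simp add: corner_coeffs_def)

definition corner_value :: "(nat set \<Rightarrow> 'f) \<Rightarrow> (nat set \<Rightarrow>\<^sub>0 'f) \<Rightarrow> 'f^2^2" where
  "corner_value f = linear_extension matrix_scale (\<lambda>S. ut 0 0 (f S))"

lemma linear_corner_value: "Vector_Spaces.linear pm_scale matrix_scale (corner_value f)"
  unfolding corner_value_def by (rule linear_linear_extension[OF vector_space_matrix_scale])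

lemma multilinear_one_z:
  assumes "(w0, us) \<in> M r 1"
  shows "us \<noteq> []" "distinct (map fst us)" "fst ` set us = Y ` {1..r} \<union> {Z 1}"
  using assms by (auto simp: multilinear_monomials_def gmonomials_def)

lemma substitute_1:
  assumes "p \<in> P r 1"
  shows "substitute (UT2_D \<phi>) (substitution \<alpha> \<beta> \<gamma>) p
    = corner_value (\<lambda>S. \<gamma> 1 * (\<Prod>i\<in>S. \<alpha> i) * (\<Prod>i\<in>{1..r} - S. \<beta> i)) (corner_coeffs p)"
proof (rule linear_eq_on_basis[OF linear_substitute linear_comp[OF linear_corner_coeffs linear_corner_value], where S = "M r 1"])
  show "keys p \<subseteq> M r 1" using assms by (simp add: P_eq)
  fix m assume m: "m \<in> M r 1"
  obtain w0 us where m': "m = (w0, us)" by (cases m)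
  note us = multilinear_one_z[OF m[unfolded m']]
  have Z: "Z 1 \<in> fst ` set us" using us(3) by auto
  show "substitute (UT2_D \<phi>) (substitution \<alpha> \<beta> \<gamma>) (unit_vector m)
      = corner_value (\<lambda>S. \<gamma> 1 * (\<Prod>i\<in>S. \<alpha> i) * (\<Prod>i\<in>{1..r} - S. \<beta> i)) (corner_coeffs (unit_vector m))"
    unfolding substitute_unit m' eval_monomial_UT2[OF us(1)] corner_coeffs_unit corner_value_def
      linear_extension_single[OF vector_space_matrix_scale] diag_0[OF Z] word_corner_one[OF us(2,3) finite_atLeastAtMost]
    by simp
qed

lemma keys_corner_coeffs: "p \<in> P r 1 \<Longrightarrow> keys (corner_coeffs p) \<subseteq> Pow {1..r}"
proof -
  assume "p \<in> P r 1"
  then have k: "keys p \<subseteq> M r 1" by (simp add: P_eq)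
  have "corner_coeffs p \<in> {q. keys q \<subseteq> Pow {1..r}}"
  proof (rule linear_in_subspace[OF linear_corner_coeffs subspace_keys _ k])
    fix m assume m: "m \<in> M r 1"
    obtain w0 us where m': "m = (w0, us)" by (cases m)
    have "before us \<subseteq> {1..r}" using before_subset[of us] multilinear_one_z(3)[OF m[unfolded m']] by auto
    then show "corner_coeffs (unit_vector m) \<in> {q. keys q \<subseteq> Pow {1..r}}" by (simp add: m' corner_coeffs_unit)
  qed
  then show ?thesis by simp
qed

text \<open>
  Substituting the indicator function of \<open>S\<close> for the upper and that of its complement for the lower
  diagonal entries isolates the coefficient at \<open>S\<close>.
\<close>

lemma corner_coeffs_eq_0_iff:
  assumes p: "p \<in> P r 1"
  shows "corner_coeffs p = 0 \<longleftrightarrow> p \<in> I"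
proof
  interpret E: Vector_Spaces.linear pm_scale matrix_scale "corner_value f" for f by (rule linear_corner_value)
  assume "corner_coeffs p = 0"
  then show "p \<in> I" using p by (simp add: P_I substitute_1 E.zero)
next
  assume I: "p \<in> I"
  show "corner_coeffs p = 0"
  proof (rule poly_mapping_eqI)
    fix S
    show "lookup (corner_coeffs p) S = lookup 0 S"
    proof (cases "S \<subseteq> {1..r}")
      case False
      then show ?thesis using keys_corner_coeffs[OF p] by (auto simp: in_keys_iff)
    next
      case True
      let ?\<alpha> = "\<lambda>i. if i \<in> S then 1 else 0 :: 'f" and ?\<beta> = "\<lambda>i. if i \<in> S then 0 else 1 :: 'f"
      let ?f = "\<lambda>S'. 1 * (\<Prod>i\<in>S'. ?\<alpha> i) * (\<Prod>i\<in>{1..r} - S'. ?\<beta> i)"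
      have f: "?f S' = (if S' = S then 1 else 0)" if S': "S' \<subseteq> {1..r}" for S'
      proof (cases "S' = S")
        case True
        have "(\<Prod>i\<in>S. ?\<alpha> i) = 1" "(\<Prod>i\<in>{1..r} - S. ?\<beta> i) = 1" by (auto intro: prod.neutral)
        then show ?thesis using True by simp
      next
        case False
        have fin: "finite S'" using S' finite_subset by blast
        consider i where "i \<in> S'" "i \<notin> S" | i where "i \<in> S" "i \<notin> S'" using False by blast
        then have "(\<Prod>i\<in>S'. ?\<alpha> i) = 0 \<or> (\<Prod>i\<in>{1..r} - S'. ?\<beta> i) = 0"
        proof cases
          case 1
          then show ?thesis using fin by (auto simp: prod_zero_iff)
        next
          case 2
          then show ?thesis using \<open>S \<subseteq> {1..r}\<close> by (auto simp: prod_zero_iff)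
        qed
        then show ?thesis using False by auto
      qed
      have "corner_value ?f (corner_coeffs p) = substitute (UT2_D \<phi>) (substitution ?\<alpha> ?\<beta> (\<lambda>_. 1)) p"
        by (rule substitute_1[OF p, symmetric])
      also have "\<dots> = 0" using I P_I[OF p] by blast
      also have "corner_value ?f (corner_coeffs p) = (\<Sum>S'\<in>Pow {1..r}. matrix_scale (lookup (corner_coeffs p) S') (ut 0 0 (?f S')))"
        unfolding corner_value_def by (rule linear_extension_superset[OF vector_space_matrix_scale _ keys_corner_coeffs[OF p]]) simp
      also have "\<dots> = (\<Sum>S'\<in>Pow {1..r}. if S' = S then ut 0 0 (lookup (corner_coeffs p) S) else 0)"
      proof (rule sum.cong[OF refl])
        fix S' assume "S' \<in> Pow {1..r}"
        then have "S' \<subseteq> {1..r}" by simp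
        from f[OF this] show "matrix_scale (lookup (corner_coeffs p) S') (ut 0 0 (?f S'))
          = (if S' = S then ut 0 0 (lookup (corner_coeffs p) S) else 0)"
          by (simp only: ut_scale) simp
      qed
      also have "\<dots> = ut 0 0 (lookup (corner_coeffs p) S)" using True by simp
      finally have "ut 0 0 (lookup (corner_coeffs p) S) = ut 0 0 0" by simp
      then show ?thesis by (simp only: ut_eq_iff lookup_zero)
    qed
  qed
qed

text \<open>
  The monomial with the \<open>y\<close>'s of \<open>S\<close>, then \<open>z\<close>, then the other \<open>y\<close>'s is mapped to a multiple of \<open>S\<close>. The
  multiple is nonzero if \<open>\<phi>1\<close> does not vanish on the coefficients before \<open>z\<close> and \<open>\<phi>2\<close> not on
  those after it.
\<close>

lemma image_corner_coeffs: "corner_coeffs ` P r 1 = {q. keys q \<subseteq> Pow {1..r}}"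
proof (intro subset_antisym)
  show "corner_coeffs ` P r 1 \<subseteq> {q. keys q \<subseteq> Pow {1..r}}" using keys_corner_coeffs by blast
  interpret T: Vector_Spaces.linear pm_scale pm_scale corner_coeffs by (rule linear_corner_coeffs)
  have sub: "pm.subspace (corner_coeffs ` P r 1)" by (rule T.subspace_image[OF subspace_P])
  obtain c where c: "c \<in> B" "\<phi>1 c \<noteq> 0" using ex_basis_nonzero by blast
  obtain c' where c': "c' \<in> B" "\<phi>2 c' \<noteq> 0" using ex_basis_nonzero by blast
  have "unit_vector S \<in> corner_coeffs ` P r 1" if S: "S \<subseteq> {1..r}" for S
  proof -
    define xs ys where "xs = sorted_list_of_set S" and "ys = sorted_list_of_set ({1..r} - S)"
    have xs: "set xs = S" "distinct xs" "set ys = {1..r} - S" "distinct ys"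
      using finite_subset[OF S] by (simp_all add: xs_def ys_def)
    define us where "us = map (\<lambda>i. (Y i, c)) xs @ (Z 1, c') # map (\<lambda>i. (Y i, c')) ys"
    have vars: "map fst us = map Y xs @ Z 1 # map Y ys" by (simp add: us_def o_def)
    have "distinct (map fst us)" unfolding vars using xs by (auto simp: distinct_map inj_on_def)
    moreover have "set (map fst us) = Y ` {1..r} \<union> Z ` {1..1}" unfolding vars using xs S by auto
    moreover have "(c, us) \<in> gmonomials B" using c c' by (auto simp: gmonomials_def us_def)
    ultimately have "(c, us) \<in> M r 1" by (simp add: multilinear_monomials_def)
    then have "corner_coeffs (unit_vector (c, us)) \<in> corner_coeffs ` P r 1" by (intro imageI unit_in_P)
    then have "Poly_Mapping.single (before us) (\<phi>1 c * coef us) \<in> corner_coeffs ` P r 1" by (simp only: corner_coeffs_unit)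
    moreover have "before (map (\<lambda>i. (Y i, c)) zs @ (Z 1, c') # vs) = set zs" for zs vs by (induction zs) auto
    then have "before us = S" using xs by (simp add: us_def)
    moreover have "coef (map (\<lambda>i. (Y i, c)) zs @ (Z 1, c') # vs) = \<phi>1 c ^ length zs * (\<phi>2 c' * word_\<phi>2 vs)" for zs vs
      by (induction zs) auto
    then have "coef us \<noteq> 0" using c c' by (simp add: us_def word_\<phi>2_def prod_list_zero_iff image_iff)
    ultimately have "Poly_Mapping.single S (\<phi>1 c * coef us) \<in> corner_coeffs ` P r 1" "\<phi>1 c * coef us \<noteq> 0" using c by simp_all
    from pm.subspace_scale[OF sub this(1), of "inverse (\<phi>1 c * coef us)"] this(2)
    show ?thesis by (simp add: field_simps)
  qed
  then show "{q. keys q \<subseteq> Pow {1..r}} \<subseteq> corner_coeffs ` P r 1"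
    unfolding span_unit_vectors[symmetric] by (intro pm.span_minimal[OF _ sub]) auto
qed

lemma cocharacter_one_z:
  assumes \<sigma>: "\<sigma> permutes {1..r}" and \<tau>: "\<tau> permutes {1..1}"
  shows "graded_cocharacter B (UT2_D \<phi>) r 1 \<sigma> \<tau> = of_nat (card {A. A \<subseteq> {1..r} \<and> \<sigma> ` A = A})"
proof -
  have "graded_cocharacter B (UT2_D \<phi>) r 1 \<sigma> \<tau> = of_nat (card {A \<in> Pow {1..r}. act_set \<sigma> A = A})"
  proof (rule cocharacter_eq_fixed_points[OF \<sigma> \<tau> linear_corner_coeffs corner_coeffs_eq_0_iff image_corner_coeffs])
    show "act_set \<sigma> ` Pow {1..r} \<subseteq> Pow {1..r}" using permutes_image[OF \<sigma>] by auto
    fix m :: "'w gmonomial"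
    obtain w0 us where m: "m = (w0, us)" by (cases m)
    let ?f = "map (map_prod (permute_var \<sigma> \<tau>) (\<lambda>x. x))"
    have word_\<phi>2: "prod_list (map (\<phi>2 \<circ> snd \<circ> map_prod (permute_var \<sigma> \<tau>) (\<lambda>x. x)) us) = prod_list (map (\<phi>2 \<circ> snd) us)" for us
      by (simp add: o_def)
    have 1: "before (?f us) = \<sigma> ` before us" by (induction us rule: before.induct) auto
    have 2: "coef (?f us) = coef us" by (induction us rule: coef.induct) (simp_all add: word_\<phi>2_def word_\<phi>2)
    show "corner_coeffs (unit_vector (permute_monomial \<sigma> \<tau> m)) = map_basis (act_set \<sigma>) (corner_coeffs (unit_vector m))"
      by (simp add: m corner_coeffs_unit permute_monomial_def id_def 1 2)
  qed auto
  then show ?thesis by (simp add: Pow_def)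
qed

section \<open>At least two variables of degree one\<close>

text \<open>
  The second variable of degree one has zeros on the diagonal, so the word after the first one has
  lower right entry 0.
\<close>

lemma P_subset_I:
  assumes k: "k \<ge> 2"
  shows "P r k \<subseteq> I"
proof
  fix p assume p: "p \<in> P r k"
  have "substitute (UT2_D \<phi>) (substitution \<alpha> \<beta> \<gamma>) p = 0" for \<alpha> \<beta> \<gamma>
  proof -
    interpret vector_space "matrix_scale :: 'f \<Rightarrow> _" by (rule vector_space_matrix_scale)
    have keys: "keys p \<subseteq> M r k" using p by (simp add: P_eq)
    have "substitute (UT2_D \<phi>) (substitution \<alpha> \<beta> \<gamma>) p \<in> {0}"
    proof (rule linear_in_subspace[OF linear_substitute subspace_single_0 _ keys])
      fix m assume m: "m \<in> M r k"
      obtain w0 us where m': "m = (w0, us)" by (cases m)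
      have us: "us \<noteq> []" "distinct (map fst us)" "fst ` set us = Y ` {1..r} \<union> Z ` {1..k}"
        using m by (auto simp: m' multilinear_monomials_def gmonomials_def)
      have Z: "Z 1 \<in> fst ` set us" "Z 2 \<in> fst ` set us" using us(3) k by auto
      have "word_corner \<alpha> \<beta> \<gamma> us = 0" by (rule word_corner_two[OF us(2) Z]) simp
      then show "substitute (UT2_D \<phi>) (substitution \<alpha> \<beta> \<gamma>) (unit_vector m) \<in> {0}"
        using diag_0[OF Z(1)] by (simp add: substitute_unit m' eval_monomial_UT2[OF us(1)])
    qed
    then show ?thesis by simp
  qed
  then show "p \<in> I" using P_I[OF p] by blast
qed

lemma cocharacter_two_z:
  assumes k: "k \<ge> 2" and \<sigma>: "\<sigma> permutes {1..r}" and \<tau>: "\<tau> permutes {1..k}"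
  shows "graded_cocharacter B (UT2_D \<phi>) r k \<sigma> \<tau> = 0"
proof -
  have eq: "P r k \<inter> I = P r k" using P_subset_I[OF k] by blast
  have "quotient_basis pm_scale (P r k) (P r k) {}"
    using pm.subspace_0[OF subspace_P] by (simp add: quotient_basis_def)
  from pm.quotient_trace_of_basis[OF this subspace_P subspace_P linear_map_basis permute_P[OF \<sigma> \<tau>] permute_P[OF \<sigma> \<tau>]]
  show ?thesis by (simp add: graded_cocharacter_def eq)
qed

end

section \<open>The multiplicities\<close>

lemma one_row_partition: "one_row N \<turnstile>\<^sub>p N"
  by (simp add: is_partition_def one_row_def)

lemma partition_0_iff: "mu \<turnstile>\<^sub>p 0 \<longleftrightarrow> mu = []"
  by (cases mu) (auto simp: is_partition_def)

lemma partition_1_iff: "mu \<turnstile>\<^sub>p 1 \<longleftrightarrow> mu = [1]"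
proof
  assume mu: "mu \<turnstile>\<^sub>p 1"
  then obtain x xs where x: "mu = x # xs" by (cases mu) (simp_all add: is_partition_def)
  then have *: "x + sum_list xs = 1" "x \<noteq> 0" "0 \<notin> set xs" using mu by (simp_all add: is_partition_def)
  then have "x = 1" "sum_list xs = 0" by linarith+
  with *(3) show "mu = [1]" using x by (cases xs) auto
qed (simp add: is_partition_def)

lemma partitions_0: "{mu. mu \<turnstile>\<^sub>p 0} = {one_row 0}" and partitions_1: "{mu. mu \<turnstile>\<^sub>p 1} = {one_row 1}"
  unfolding partition_0_iff partition_1_iff by (simp_all add: one_row_def)

lemma two_rows_partition:
  assumes "2 * j \<le> N"
  shows "two_rows N j \<turnstile>\<^sub>p N"
  using assms one_row_partition by (auto simp: two_rows_def is_partition_def)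

lemma two_rows_inj: "two_rows N i = two_rows N j \<Longrightarrow> i = j"
  by (auto simp: two_rows_def one_row_def split: if_splits)

text \<open>
  At most one \<open>j\<close> contributes. The form as a sum lets the sum over all partitions be regrouped into a
  sum over \<open>j\<close>.
\<close>

definition two_row_mult :: "nat \<Rightarrow> nat list \<Rightarrow> nat" where
  "two_row_mult N lam = (\<Sum>j\<in>{j \<in> {..N div 2}. two_rows N j = lam}. N - 2 * j + 1)"

lemma two_row_mult_eq:
  assumes "2 * j \<le> N"
  shows "two_row_mult N (two_rows N j) = N - 2 * j + 1"
proof -
  have "{i \<in> {..N div 2}. two_rows N i = two_rows N j} = {j}" using assms two_rows_inj by auto
  then show ?thesis unfolding two_row_mult_def by simp
qed

lemma two_row_mult_eq_0:
  assumes "\<And>j. 2 * j \<le> N \<Longrightarrow> lam \<noteq> two_rows N j"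
  shows "two_row_mult N lam = 0"
proof -
  have "2 * j \<le> N" if "j \<le> N div 2" for j using that by auto
  then have "{i \<in> {..N div 2}. two_rows N i = lam} = {}" using assms by blast
  then show ?thesis unfolding two_row_mult_def by simp
qed

context UT2_D_setup
begin

lemma multiplicities_no_z:
  assumes "r \<ge> 1"
  shows "multiplicities r 0 (graded_cocharacter B (UT2_D \<phi>) r 0) (\<lambda>lam mu. if lam = one_row r then 2 else 0)"
  unfolding multiplicities_def
proof (intro allI impI)
  fix \<sigma> \<tau> :: "nat \<Rightarrow> nat" assume p: "\<sigma> permutes {1..r} \<and> \<tau> permutes {1..0}"
  then have ch: "irr_char (one_row r) \<sigma> = (1 :: 'f)" "irr_char (one_row 0) \<tau> = (1 :: 'f)"
    using irr_char_one_row by blast+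
  have "(\<Sum>lam | lam \<turnstile>\<^sub>p r. \<Sum>mu | mu \<turnstile>\<^sub>p 0. of_nat (if lam = one_row r then 2 else 0) * (irr_char lam \<sigma> * irr_char mu \<tau>))
    = (\<Sum>lam | lam \<turnstile>\<^sub>p r. if lam = one_row r then 2 else (0 :: 'f))"
    unfolding partitions_0 by (intro sum.cong refl) (simp add: ch)
  also have "\<dots> = 2" using finite_partitions one_row_partition by simp
  finally show "graded_cocharacter B (UT2_D \<phi>) r 0 \<sigma> \<tau> = (\<Sum>lam | lam \<turnstile>\<^sub>p r. \<Sum>mu | mu \<turnstile>\<^sub>p 0.
      of_nat (if lam = one_row r then 2 else 0) * (irr_char lam \<sigma> * irr_char mu \<tau>))"
    using cocharacter_no_z[OF assms] p by simp
qed

lemma multiplicities_one_z: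
  "multiplicities r 1 (graded_cocharacter B (UT2_D \<phi>) r 1) (\<lambda>lam mu. two_row_mult r lam)"
  unfolding multiplicities_def
proof (intro allI impI)
  fix \<sigma> \<tau> :: "nat \<Rightarrow> nat" assume p: "\<sigma> permutes {1..r} \<and> \<tau> permutes {1..1}"
  then have ch: "irr_char (one_row 1) \<tau> = (1 :: 'f)" using irr_char_one_row by blast
  have "(\<Sum>lam | lam \<turnstile>\<^sub>p r. \<Sum>mu | mu \<turnstile>\<^sub>p 1. of_nat (two_row_mult r lam) * (irr_char lam \<sigma> * irr_char mu \<tau>))
    = (\<Sum>lam | lam \<turnstile>\<^sub>p r. \<Sum>j\<in>{j \<in> {..r div 2}. two_rows r j = lam}. of_nat (r - 2 * j + 1) * irr_char (two_rows r j) \<sigma> :: 'f)"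
    unfolding partitions_1
    by (intro sum.cong refl) (simp add: ch two_row_mult_def sum_distrib_right del: of_nat_add of_nat_Suc One_nat_def)
  also have "\<dots> = (\<Sum>j\<in>{..r div 2}. of_nat (r - 2 * j + 1) * irr_char (two_rows r j) \<sigma>)"
    using finite_partitions two_rows_partition by (intro sum.group) auto
  also have "\<dots> = graded_cocharacter B (UT2_D \<phi>) r 1 \<sigma> \<tau>"
    unfolding cocharacter_one_z[OF conjunct1[OF p] conjunct2[OF p]] card_all_fixed_subsets[OF conjunct1[OF p]] ..
  finally show "graded_cocharacter B (UT2_D \<phi>) r 1 \<sigma> \<tau> = (\<Sum>lam | lam \<turnstile>\<^sub>p r. \<Sum>mu | mu \<turnstile>\<^sub>p 1.
      of_nat (two_row_mult r lam) * (irr_char lam \<sigma> * irr_char mu \<tau>))" ..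
qed

lemma multiplicities_two_z:
  assumes "k \<ge> 2"
  shows "multiplicities r k (graded_cocharacter B (UT2_D \<phi>) r k) (\<lambda>lam mu. 0)"
  using cocharacter_two_z[OF assms] by (simp add: multiplicities_def)

end

theorem theorem6p4:
  fixes sc :: "'f::field_char_0 \<Rightarrow> 'w::ring_1 \<Rightarrow> 'w"
    and W :: "bit \<Rightarrow> 'w set"
    and \<phi> :: "'w \<Rightarrow> 'f^2^2"
    and B :: "'w set"
    and n r :: nat
  assumes "Z2_graded_algebra sc W"
    and "graded_hom_onto_D sc W \<phi>"
    and "\<not> module.dependent sc B" and "module.span sc B = UNIV"
    and "n \<ge> 1" and "r \<le> n"
  shows "(\<exists>m. multiplicities r (n - r) (graded_cocharacter B (UT2_D \<phi>) r (n - r)) m) \<and>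
    (\<forall>m. multiplicities r (n - r) (graded_cocharacter B (UT2_D \<phi>) r (n - r)) m \<longrightarrow>
      (r = n \<longrightarrow>
         m (one_row n) [] = 2 \<and>
         (\<forall>lam mu. lam \<turnstile>\<^sub>p r \<and> mu \<turnstile>\<^sub>p n - r \<and> \<not> (lam = one_row n \<and> mu = []) \<longrightarrow> m lam mu = 0)) \<and>
      (r = n - 1 \<longrightarrow>
         m (one_row (n - 1)) [1] = n \<and>
         (\<forall>p q. p \<ge> 1 \<and> 2 * p + q = n - 1 \<longrightarrow> m [p + q, p] [1] = q + 1) \<and>
         (\<forall>lam mu. lam \<turnstile>\<^sub>p r \<and> mu \<turnstile>\<^sub>p n - r \<and>
            \<not> (lam = one_row (n - 1) \<and> mu = [1]) \<and>
            \<not> (\<exists>p q. p \<ge> 1 \<and> 2 * p + q = n - 1 \<and> lam = [p + q, p] \<and> mu = [1])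
            \<longrightarrow> m lam mu = 0)) \<and>
      (r + 2 \<le> n \<longrightarrow> (\<forall>lam mu. lam \<turnstile>\<^sub>p r \<and> mu \<turnstile>\<^sub>p n - r \<longrightarrow> m lam mu = 0)))"
proof -
  interpret UT2_D_setup sc W \<phi> B by (rule UT2_D_setup.intro[OF assms(1,2,4)])
  let ?ch = "graded_cocharacter B (UT2_D \<phi>) r (n - r)"
  have unique: "m lam mu = m' lam mu"
    if "multiplicities r (n - r) ?ch m" "multiplicities r (n - r) ?ch m'" "lam \<turnstile>\<^sub>p r" "mu \<turnstile>\<^sub>p n - r" for m m' lam mu
    using multiplicities_unique[OF that] .
  consider "r = n" | "r = n - 1" "r \<noteq> n" | "r + 2 \<le> n" using assms(6) by linarith
  then show ?thesis
  proof cases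
    case 1
    have M: "multiplicities r (n - r) ?ch (\<lambda>lam mu. if lam = one_row r then 2 else 0)"
      using multiplicities_no_z[of r] 1 assms(5) by simp
    have mu: "mu = []" if "mu \<turnstile>\<^sub>p n - r" for mu
      using that 1 by (simp add: partition_0_iff)
    have "[] \<turnstile>\<^sub>p n - r" using 1 by (simp add: is_partition_def)
    show ?thesis
    proof (intro conjI allI impI exI)
      show "multiplicities r (n - r) ?ch (\<lambda>lam mu. if lam = one_row r then 2 else 0)" by (rule M)
      fix m assume m: "multiplicities r (n - r) ?ch m"
      have m_eq: "m lam [] = (if lam = one_row r then 2 else 0)" if "lam \<turnstile>\<^sub>p r" for lam
        by (rule unique[OF m M that \<open>[] \<turnstile>\<^sub>p n - r\<close>])
      show "m (one_row n) [] = 2" using m_eq[OF one_row_partition] 1 by simp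
      show "m lam mu = 0" if "lam \<turnstile>\<^sub>p r \<and> mu \<turnstile>\<^sub>p n - r \<and> \<not> (lam = one_row n \<and> mu = [])" for lam mu
        using that m_eq[of lam] mu[of mu] 1 by auto
    qed (use 1 assms(5) in auto)
  next
    case 2
    have nr: "n - r = 1" and n: "n = r + 1" using 2 assms(5) by simp_all
    then have "\<not> r + 2 \<le> n" by simp
    have M: "multiplicities r (n - r) ?ch (\<lambda>lam mu. two_row_mult r lam)"
      using multiplicities_one_z[of r] nr by simp
    have mu: "mu = [1]" if "mu \<turnstile>\<^sub>p n - r" for mu
      using that unfolding nr partition_1_iff .
    have 1: "[1] \<turnstile>\<^sub>p n - r" using nr by (simp add: is_partition_def)
    show ?thesis
    proof (intro conjI allI impI exI)
      show "multiplicities r (n - r) ?ch (\<lambda>lam mu. two_row_mult r lam)" by (rule M)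
      fix m assume m: "multiplicities r (n - r) ?ch m"
      have m_eq: "m lam [1] = two_row_mult r lam" if "lam \<turnstile>\<^sub>p r" for lam
        by (rule unique[OF m M that 1])
      show "m (one_row (n - 1)) [1] = n"
        using m_eq[OF one_row_partition] two_row_mult_eq[of 0 r] n by (simp add: two_rows_def)
      show "m [p + q, p] [1] = q + 1" if "1 \<le> p \<and> 2 * p + q = n - 1" for p q
      proof -
        have pq: "[p + q, p] = two_rows r p" "2 * p \<le> r" "r - 2 * p = q" using that n by (auto simp: two_rows_def)
        show ?thesis unfolding pq(1) using m_eq[OF two_rows_partition[OF pq(2)]] two_row_mult_eq[OF pq(2)] pq(3) by simp
      qed
      show "m lam mu = 0" if "lam \<turnstile>\<^sub>p r \<and> mu \<turnstile>\<^sub>p n - r \<and> \<not> (lam = one_row (n - 1) \<and> mu = [1]) \<and>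
            \<not> (\<exists>p q. p \<ge> 1 \<and> 2 * p + q = n - 1 \<and> lam = [p + q, p] \<and> mu = [1])" for lam mu
      proof -
        have mu1: "mu = [1]" using that mu by blast
        have "lam \<noteq> two_rows r j" if j: "2 * j \<le> r" for j
        proof
          assume lam: "lam = two_rows r j"
          have "j \<noteq> 0"
          proof
            assume "j = 0"
            then have "lam = one_row (n - 1) \<and> mu = [1]" using lam mu1 n by (simp add: two_rows_def)
            then show False using \<open>lam \<turnstile>\<^sub>p r \<and> _\<close> by blast
          qed
          then have "1 \<le> j \<and> 2 * j + (r - 2 * j) = n - 1 \<and> lam = [j + (r - 2 * j), j] \<and> mu = [1]"
            using lam j n mu1 by (simp add: two_rows_def)
          then show False using \<open>lam \<turnstile>\<^sub>p r \<and> _\<close> by blast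
        qed
        then have "two_row_mult r lam = 0" by (rule two_row_mult_eq_0)
        then show ?thesis using m_eq[of lam] that mu1 by simp
      qed
    qed (use \<open>r \<noteq> n\<close> \<open>\<not> r + 2 \<le> n\<close> in \<open>blast+\<close>)
  next
    case 3
    have M: "multiplicities r (n - r) ?ch (\<lambda>lam mu. 0)"
      using multiplicities_two_z[of "n - r" r] 3 by simp
    then show ?thesis using unique[OF _ M] 3 by auto
  qed
qed

end
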